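(* If $(G,\alpha)$ is a simple locally compact contraction group, then $G$ is either connected or totally disconnected. The family $(E_f,\alpha_f)_{f\in\Omega_\infty}$ is a system of representatives for the isomorphism classes of the connected simple locally compact contraction groups (i.e. each $(E_f,\alpha_f)$ is a connected simple locally compact contraction group, and each connected simple locally compact contraction group is isomorphic to $(E_f,\alpha_f)$ for exactly one $f\in\Omega_\infty$).
   Context: A locally compact contraction group is a pair $(G,\alpha)$ where $G$ is a (Hausdorff) locally compact group and $\alpha\colon G\to G$ is a bicontinuous automorphism with $\alpha^n(x)\to e$ as $n\to\infty$ for each $x\in G$. An isomorphism $(G,\alpha_G)\to(H,\alpha_H)$ of contraction groups is an isomorphism of topological groups $\phi$ with $\alpha_H\circ\phi=\phi\circ\alpha_G$. $(G,\alpha)$ is simple if $G\neq\{e\}$ and $G$ has no closed normal subgroups $N$ with $\alpha(N)=N$ except for $\{e\}$ and $G$. $\Omega_\infty$ is the set of all monic irreducible polynomials $f\in\mathbb{R}[X]$ with $f\neq X$ such that $|\lambda|<1$ for all zeros $\lambda$ of $f$ in $\mathbb{C}$. For $f\in\Omega_\infty$, $E_f:=\mathbb{R}[X]/f\mathbb{R}[X]$ (additive group of a finite-dimensional real vector space with its usual topology) and $\alpha_f\colon E_f\to E_f$ is the linear automorphism $g+f\mathbb{R}[X]\mapsto Xg+f\mathbb{R}[X]$. *)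

theory Defs
  imports
    "HOL-Analysis.Analysis"
    "HOL-Algebra.QuotRing"
    "HOL-Computational_Algebra.Polynomial_Factorial"
begin

locale topological_group = group G for G (structure) and T +
  assumes topspace_eq_carrier: "topspace T = carrier G"
    and continuous_map_mult: "continuous_map (prod_topology T T) T (\<lambda>(x, y). x \<otimes> y)"
    and continuous_map_inv: "continuous_map T T (\<lambda>x. inv x)"

locale lc_contraction_group = topological_group G T for G (structure) and T +
  fixes \<alpha>
  assumes Hausdorff: "Hausdorff_space T"
    and locally_compact: "locally_compact_space T"
    and automorphism: "\<alpha> \<in> iso G G"
    and bicontinuous: "homeomorphic_map T T \<alpha>"
    and contractive: "\<And>x. x \<in> carrier G \<Longrightarrow> limitin T (\<lambda>n. (\<alpha> ^^ n) x) \<one> sequentially"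

locale simple_lc_contraction_group = lc_contraction_group G T \<alpha>
  for G (structure) and T and \<alpha> +
  assumes nontrivial: "carrier G \<noteq> {\<one>}"
    and simple: "\<And>N. N \<lhd> G \<Longrightarrow> closedin T N \<Longrightarrow> \<alpha> ` N = N \<Longrightarrow> N = {\<one>} \<or> N = carrier G"

definition contraction_group_isomorphism ::
    "('a, 'c) monoid_scheme \<Rightarrow> 'a topology \<Rightarrow> ('a \<Rightarrow> 'a) \<Rightarrow>
     ('b, 'd) monoid_scheme \<Rightarrow> 'b topology \<Rightarrow> ('b \<Rightarrow> 'b) \<Rightarrow> ('a \<Rightarrow> 'b) \<Rightarrow> bool"
  where "contraction_group_isomorphism G S \<alpha> H T \<beta> \<phi> \<longleftrightarrow>
    \<phi> \<in> iso G H \<and> homeomorphic_map S T \<phi> \<and> (\<forall>x\<in>carrier G. \<beta> (\<phi> x) = \<phi> (\<alpha> x))"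

definition contraction_group_isomorphic ::
    "('a, 'c) monoid_scheme \<Rightarrow> 'a topology \<Rightarrow> ('a \<Rightarrow> 'a) \<Rightarrow>
     ('b, 'd) monoid_scheme \<Rightarrow> 'b topology \<Rightarrow> ('b \<Rightarrow> 'b) \<Rightarrow> bool"
  where "contraction_group_isomorphic G S \<alpha> H T \<beta> \<longleftrightarrow>
    (\<exists>\<phi>. contraction_group_isomorphism G S \<alpha> H T \<beta> \<phi>)"

definition totally_disconnected_space :: "'a topology \<Rightarrow> bool"
  where "totally_disconnected_space T \<longleftrightarrow>
    (\<forall>x\<in>topspace T. connected_component_of_set T x = {x})"

definition Omega_infinity :: "real poly set"  (\<open>\<Omega>\<^sub>\<infinity>\<close>)
  where "\<Omega>\<^sub>\<infinity> = {f. lead_coeff f = 1 \<and> irreducible f \<and> f \<noteq> [:0, 1:] \<and>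
    (\<forall>z::complex. poly (map_poly of_real f) z = 0 \<longrightarrow> norm z < 1)}"

definition real_poly_ring :: "real poly ring"
  where "real_poly_ring = \<lparr>carrier = UNIV, mult = (*), one = 1, zero = 0, add = (+)\<rparr>"

definition E_ring :: "real poly \<Rightarrow> real poly set ring"
  where "E_ring f = real_poly_ring Quot (PIdl\<^bsub>real_poly_ring\<^esub> f)"

definition E_group :: "real poly \<Rightarrow> real poly set monoid"
  where "E_group f = add_monoid (E_ring f)"

definition E_class :: "real poly \<Rightarrow> real poly \<Rightarrow> real poly set"
  where "E_class f g = PIdl\<^bsub>real_poly_ring\<^esub> f +>\<^bsub>real_poly_ring\<^esub> g"

definition E_map :: "real poly \<Rightarrow> real poly set \<Rightarrow> real poly set"
  where "E_map f C = E_class f [:0, 1:] \<otimes>\<^bsub>E_ring f\<^esub> C"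

text \<open>The coordinates of a coset with respect to the basis of the quotient formed by the classes
  of \<open>1, X, \<dots>, X\<^sup>d\<^sup>-\<^sup>1\<close>, where \<open>d\<close> is the degree of \<open>f\<close>.\<close>

definition E_coords :: "real poly \<Rightarrow> real poly set \<Rightarrow> nat \<Rightarrow> real"
  where "E_coords f C = (\<lambda>i\<in>{..<degree f}. coeff ((SOME g. g \<in> C) mod f) i)"

text \<open>The usual topology of a finite-dimensional real vector space: the one that makes the
  coordinate map a homeomorphism onto \<open>\<real>\<^sup>d\<close>.\<close>

definition E_topology :: "real poly \<Rightarrow> real poly set topology"
  where "E_topology f =
    pullback_topology (carrier (E_group f)) (E_coords f) (powertop_real {..<degree f})"

lemma cring_real_poly_ring: "cring real_poly_ring"
  by (rule cringI)
     (auto simp: real_poly_ring_def algebra_simps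
        intro!: abelian_groupI comm_monoidI exI[of _ "- x" for x])

lemma ideal_PIdl_real_poly: "ideal (PIdl\<^bsub>real_poly_ring\<^esub> f) real_poly_ring"
  by (rule cring.cgenideal_ideal[OF cring_real_poly_ring]) (simp add: real_poly_ring_def)

lemma carrier_E_group: "carrier (E_group f) = range (E_class f)"
  by (auto simp: E_group_def E_ring_def E_class_def FactRing_def A_RCOSETS_def' real_poly_ring_def)

lemma E_class_eq: "E_class f g = {h. h mod f = g mod f}"
proof -
  have "E_class f g = {h * f + g | h. True}"
    by (auto simp: E_class_def cgenideal_def a_r_coset_def' real_poly_ring_def)
  also have "\<dots> = {h. h mod f = g mod f}"
    by (auto simp: mod_eq_dvd_iff dvd_def) (metis diff_add_cancel mult.commute)
  finally show ?thesis .
qed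

lemma E_group_mult_class:
  "E_class f g \<otimes>\<^bsub>E_group f\<^esub> E_class f h = E_class f (g + h)"
proof -
  interpret ideal "PIdl\<^bsub>real_poly_ring\<^esub> f" real_poly_ring
    by (rule ideal_PIdl_real_poly)
  show ?thesis
    using a_rcos_sum[of g h]
    by (simp add: E_group_def E_ring_def E_class_def FactRing_def real_poly_ring_def)
qed

lemma E_map_class: "E_map f (E_class f g) = E_class f ([:0, 1:] * g)"
  using ideal.rcoset_mult_add[OF ideal_PIdl_real_poly, of "[:0, 1:]" g f]
  by (simp add: E_map_def E_ring_def E_class_def FactRing_def real_poly_ring_def)

lemma E_coords_class: "E_coords f (E_class f g) = (\<lambda>i\<in>{..<degree f}. coeff (g mod f) i)"
proof -
  have "g \<in> E_class f g"
    by (simp add: E_class_eq)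
  then have "(SOME h. h \<in> E_class f g) \<in> E_class f g"
    by (rule someI)
  then show ?thesis
    by (simp add: E_coords_def E_class_eq)
qed

lemma homeomorphic_map_E_coords:
  assumes "f \<noteq> 0"
  shows "homeomorphic_map (E_topology f) (powertop_real {..<degree f}) (E_coords f)"
proof -
  let ?A = "carrier (E_group f)" and ?Y = "powertop_real {..<degree f}"
  have inj: "inj_on (E_coords f) ?A"
  proof (rule inj_onI)
    fix C D
    assume "C \<in> ?A" "D \<in> ?A" and eq: "E_coords f C = E_coords f D"
    then obtain g h where CD: "C = E_class f g" "D = E_class f h"
      by (auto simp: carrier_E_group)
    have "coeff (g mod f) i = coeff (h mod f) i" for i
    proof (cases "i < degree f")
      case True
      with fun_cong[OF eq, of i] show ?thesis
        by (simp add: CD E_coords_class)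
    next
      case False
      have "coeff (p mod f) i = 0" for p
        using degree_mod_less[OF assms, of p] False by (auto intro: coeff_eq_0)
      then show ?thesis by simp
    qed
    then have "g mod f = h mod f"
      by (simp add: poly_eq_iff)
    then show "C = D"
      by (simp add: CD E_class_eq)
  qed
  have "x \<in> E_coords f ` ?A" if x: "x \<in> topspace ?Y" for x
  proof -
    define g where "g = (\<Sum>i<degree f. monom (x i) i)"
    have coeff_g: "coeff g i = (if i < degree f then x i else 0)" for i
      by (simp add: g_def coeff_sum)
    have "g mod f = g"
    proof (cases "degree f = 0")
      case True
      then show ?thesis by (simp add: g_def)
    next
      case False
      then have "degree g < degree f"
        by (intro degree_lessI) (auto simp: coeff_g)
      then show ?thesis by (rule mod_poly_less)
    qed
    then have "E_coords f (E_class f g) = x"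
      using x by (auto simp: E_coords_class coeff_g fun_eq_iff PiE_def extensional_def)
    then show ?thesis
      by (auto simp: carrier_E_group)
  qed
  moreover have "E_coords f ` ?A \<subseteq> topspace ?Y"
    by (auto simp: E_coords_def split: if_splits)
  ultimately have img: "E_coords f ` ?A = topspace ?Y"
    by blast
  have top: "topspace (E_topology f) = ?A"
    using img by (auto simp: E_topology_def topspace_pullback_topology)
  have "continuous_map (E_topology f) ?Y (E_coords f)"
    using continuous_map_pullback[OF continuous_map_id, of ?A "E_coords f" ?Y]
    by (simp add: E_topology_def)
  moreover have "open_map (E_topology f) ?Y (E_coords f)"
    unfolding open_map_def
  proof (intro allI impI)
    fix W assume "openin (E_topology f) W"
    then obtain U where U: "openin ?Y U" and W: "W = E_coords f -` U \<inter> ?A"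
      by (auto simp: E_topology_def openin_pullback_topology)
    have "E_coords f ` W = U \<inter> E_coords f ` ?A"
      by (auto simp: W)
    also have "\<dots> = U"
      using openin_subset[OF U] by (simp add: img Int_absorb2)
    finally show "openin ?Y (E_coords f ` W)"
      using U by simp
  qed
  ultimately show ?thesis
    using inj img top by (intro bijective_open_imp_homeomorphic_map) simp_all
qed

end

theory Submission
  imports
    Defs
    "HOL-Computational_Algebra.Fundamental_Theorem_Algebra"
    "HOL-Computational_Algebra.Field_as_Ring"
begin

text \<open>
  A simple contraction group coincides with its identity component or meets it trivially, so let
  \<open>G\<close> be connected. Choose a compact neighbourhood \<open>U\<close> of the identity with \<open>\<alpha>(U) \<subseteq> U\<close> and put
  \<open>Q\<^sub>k = \<alpha>\<^sup>k(U)\<close>. Let \<open>M\<^sub>k\<close> be the largest \<open>M\<close> with \<open>Q\<^sub>k\<^sup>M \<subseteq> U\<close>; connectedness makes it finite, and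
  self-similarity gives \<open>M\<^sub>k\<^sub>+\<^sub>t \<le> C\<^sub>t M\<^sub>k\<close>. As in Gleason's lemmas, a function that is
  \<open>1 / M\<^sub>k\<close>-Lipschitz along \<open>Q\<^sub>k\<close> is convolved (by Haar integration) with a fixed bump function. The
  first differences of the resulting \<open>\<phi>\<^sub>k\<close> along \<open>Q\<^sub>k\<close> have exact order \<open>1 / M\<^sub>k\<close>, whereas the second
  differences are \<open>o(1 / M\<^sub>k)\<close>. Rescaled by \<open>M\<^sub>k\<close> and transported by \<open>\<alpha>\<^sup>k\<close>, the first differences
  therefore converge, along a suitable filter, to a nonzero continuous homomorphism \<open>G \<Rightarrow> \<real>\<close>.

  The homomorphisms into \<open>\<real>\<close> form a finite-dimensional space, so there is a nonzero \<open>\<chi> : G \<Rightarrow> \<complex>\<close> with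
  \<open>\<chi> \<circ> \<alpha> = z \<chi>\<close>, real-valued if \<open>z\<close> is real. By simplicity \<open>\<chi>\<close> is injective, and comparison with the
  shells \<open>\<alpha>\<^sup>-\<^sup>n(U) - \<alpha>\<^sup>1\<^sup>-\<^sup>n(U)\<close> shows that it is proper. Its image is a closed subgroup stable under \<open>z\<close>;
  it contains arbitrarily small elements, hence a real line, hence all of \<open>\<real>\<close> or \<open>\<complex>\<close>. Evaluation at
  \<open>z\<close> identifies this group with \<open>E\<^sub>f\<close> for the minimal polynomial \<open>f\<close> of \<open>z\<close>.
\<close>

section \<open>Generalized limits\<close>

text \<open>The difficulty is to produce one nonzero continuous homomorphism into the reals when no
  one-parameter subgroup is at hand. Two opposite estimates at the scale 1 / M_k are needed. The
  upper one is built into the Lipschitz function. The lower one comes from self-similarity: phi_k is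
  at least a fixed positive constant at the identity and vanishes outside a fixed ball, and some
  chain with steps in Q_k leaves that ball after O(M_k) steps, because passing from scale k to k + t
  multiplies the count by at most a constant; hence some step moves phi_k by the order 1 / M_k. That
  step depends on k, so the pointwise limit could still vanish; powers of small elements give the
  equicontinuity with which a finite net excludes this. A filter makes all bounded sequences
  converge at once and spares any diagonal argument. That f is determined by the group rests on
  another fact: a continuous additive map is real-linear, so an isomorphism carrying multiplication
  by z to multiplication by w carries f(z) = 0 to f(w) = 0.\<close>

lemma generalized_limit_filter:
  obtains F :: "nat filter" where "F \<noteq> bot" "F \<le> sequentially"
    "\<And>x :: nat \<Rightarrow> real. Bseq x \<Longrightarrow> (x \<longlongrightarrow> Lim F x) F"
proof -
  obtain C :: "(nat \<Rightarrow> real) \<Rightarrow> real" where C: "\<And>x n. Bseq x \<Longrightarrow> \<bar>x n\<bar> \<le> C x"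
    by (metis Bseq_def real_norm_def)
  \<comment> \<open>Each real sequence becomes a coordinate of a compact product of intervals, and
    the index \<open>k\<close> becomes the point formed by the k-th values. Unbounded sequences get
    the value 0, which keeps this point inside the box.\<close>
  define a where "a = (\<lambda>k (x :: nat \<Rightarrow> real). if Bseq x then x k else 0)"
  define S where "S = (\<Pi>\<^sub>E x\<in>UNIV. {- \<bar>C x\<bar>..\<bar>C x\<bar>})"
  have "compact S"
    unfolding S_def compactin_euclidean_iff[symmetric] euclidean_product_topology[symmetric]
    by (simp add: compactin_PiE)
  have aS: "a k \<in> S" for k
  proof -
    have "\<bar>a k x\<bar> \<le> \<bar>C x\<bar>" for x
      using C[of x k] by (auto simp: a_def)
    then have "a k x \<in> {- \<bar>C x\<bar>..\<bar>C x\<bar>}" for x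
      by (metis abs_le_iff atLeastAtMost_iff minus_le_iff)
    then show ?thesis unfolding S_def by (simp add: PiE_UNIV_domain)
  qed
  have "filtermap a sequentially \<noteq> bot" "filtermap a sequentially \<le> principal S"
    using aS by (auto simp: filtermap_bot_iff le_principal eventually_filtermap)
  then obtain L where L: "inf (nhds L) (filtermap a sequentially) \<noteq> bot"
    using \<open>compact S\<close> unfolding compact_filter by (metis eventually_principal le_principal)
  \<comment> \<open>\<open>L\<close> is a cluster point of the points \<open>a k\<close>; the filter
    is generated by the sets of large indices \<open>k\<close> with \<open>a k\<close> close to
    \<open>L\<close>.\<close>
  define F where "F = inf (filtercomap a (nhds L)) sequentially"
  have "F \<noteq> bot"
  proof
    assume "F = bot"
    then have "eventually (\<lambda>_. False) F" by simp
    then obtain P Q where P: "eventually P (filtercomap a (nhds L))" and Q: "eventually Q sequentially"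
      and PQ: "\<And>n. P n \<and> Q n \<Longrightarrow> False"
      unfolding F_def eventually_inf by blast
    from P obtain P' where P': "eventually P' (nhds L)" "\<And>n. P' (a n) \<Longrightarrow> P n"
      unfolding eventually_filtercomap by blast
    have "eventually (\<lambda>y. \<not> P' y) (filtermap a sequentially)"
      unfolding eventually_filtermap using Q by eventually_elim (use P'(2) PQ in blast)
    then have "eventually (\<lambda>_. False) (inf (nhds L) (filtermap a sequentially))"
      using P'(1) unfolding eventually_inf by blast
    with L show False by (simp add: trivial_limit_def)
  qed
  moreover have "F \<le> sequentially" by (simp add: F_def)
  moreover have "(x \<longlongrightarrow> Lim F x) F" if "Bseq x" for x :: "nat \<Rightarrow> real"
  proof -
    have "(a \<longlongrightarrow> L) F"
      unfolding F_def by (meson filterlim_def filtermap_filtercomap filtermap_mono inf_le1 order_trans)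
    moreover have "((\<lambda>f :: (nat \<Rightarrow> real) \<Rightarrow> real. f x) \<longlongrightarrow> L x) (nhds L)"
      using continuous_on_product_coordinates[of x]
      by (auto simp: continuous_on_def tendsto_at_iff_tendsto_nhds[of "\<lambda>f. f x" L, symmetric])
    ultimately have "((\<lambda>k. a k x) \<longlongrightarrow> L x) F"
      by (rule filterlim_compose[rotated])
    then have "(x \<longlongrightarrow> L x) F"
      using that by (simp add: a_def)
    then show ?thesis
      using \<open>F \<noteq> bot\<close> tendsto_Lim by fastforce
  qed
  ultimately show ?thesis using that by blast
qed

section \<open>Filtered groups and test functions\<close>

lemma (in group) funpow_iso:
  assumes "h \<in> iso G G" shows "h ^^ k \<in> iso G G"
proof (induction k)
  case 0
  then show ?case by (simp add: id_def iso_set_refl)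
next
  case (Suc k)
  then show ?case using iso_set_trans[OF Suc assms] by (simp add: comp_def)
qed

text \<open>The sets \<^term>\<open>B n\<close> abstract the images \<open>\<alpha>\<^sup>-\<^sup>n(U)\<close> of a compact
  neighbourhood \<open>U\<close> of the identity that \<open>\<alpha>\<close> maps into itself: they are small for
  \<open>n \<longlonglongrightarrow> -\<infinity>\<close> and exhaust the group for \<open>n \<longlonglongrightarrow> \<infinity>\<close>, so that the whole argument can be run
  without mentioning the topology.\<close>

locale filtered_group = group G for G (structure) +
  fixes B :: "int \<Rightarrow> 'a set" and s :: int
  assumes B_sub: "B n \<subseteq> carrier G"
    and B_mono: "m \<le> n \<Longrightarrow> B m \<subseteq> B n"
    and B_one: "\<one> \<in> B n"
    and B_inv: "x \<in> B n \<Longrightarrow> inv x \<in> B n"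
    and s_nonneg: "s \<ge> 0"
    and B_mult: "x \<in> B n \<Longrightarrow> y \<in> B n \<Longrightarrow> x \<otimes> y \<in> B (n + s)"
    and B_exhaust: "x \<in> carrier G \<Longrightarrow> \<exists>n. x \<in> B n"
    and B_totally_bounded:
      "\<exists>S. finite S \<and> S \<subseteq> carrier G \<and> (\<forall>x\<in>B n. \<exists>t\<in>S. inv t \<otimes> x \<in> B k)"
begin

lemma B_carrier [intro]: "x \<in> B n \<Longrightarrow> x \<in> carrier G"
  using B_sub by blast

definition right_uniform :: "('a \<Rightarrow> real) \<Rightarrow> bool"
  where "right_uniform f \<longleftrightarrow> (\<forall>e>0. \<exists>k. \<forall>x\<in>carrier G. \<forall>v\<in>B k. \<bar>f (x \<otimes> v) - f x\<bar> \<le> e)"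

definition supp_in :: "int \<Rightarrow> ('a \<Rightarrow> real) \<Rightarrow> bool"
  where "supp_in n f \<longleftrightarrow> (\<forall>x\<in>carrier G - B n. f x = 0)"

definition bdd :: "('a \<Rightarrow> real) \<Rightarrow> bool"
  where "bdd f \<longleftrightarrow> (\<exists>K. \<forall>x\<in>carrier G. \<bar>f x\<bar> \<le> K)"

definition test :: "('a \<Rightarrow> real) \<Rightarrow> bool"
  where "test f \<longleftrightarrow> right_uniform f \<and> bdd f \<and> (\<exists>n. supp_in n f)"

definition tr :: "'a \<Rightarrow> ('a \<Rightarrow> real) \<Rightarrow> 'a \<Rightarrow> real"
  where "tr t f = (\<lambda>x. f (inv t \<otimes> x))"

lemma bddE:
  assumes "bdd f" obtains K where "K > 0" "\<And>x. x \<in> carrier G \<Longrightarrow> \<bar>f x\<bar> \<le> K"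
  using assms unfolding bdd_def by (meson le_less_trans less_le_not_le linear order_trans zero_less_one)

lemma supp_in_mono: "supp_in m f \<Longrightarrow> m \<le> n \<Longrightarrow> supp_in n f"
  using B_mono[of m n] by (auto simp: supp_in_def)

lemma right_uniform_lipschitz:
  assumes f: "right_uniform f" and g: "right_uniform g" and "C \<ge> 0"
    and "\<And>x y. x \<in> carrier G \<Longrightarrow> y \<in> carrier G \<Longrightarrow> \<bar>h y - h x\<bar> \<le> C * (\<bar>f y - f x\<bar> + \<bar>g y - g x\<bar>)"
  shows "right_uniform h"
  unfolding right_uniform_def
proof (intro allI impI)
  fix e :: real assume "e > 0"
  \<comment> \<open>The summand 1 keeps the denominator positive when \<open>C = 0\<close>.\<close>
  define d where "d = e / (2 * C + 1)"
  have d: "d > 0" "2 * C * d \<le> e" using \<open>e > 0\<close> \<open>C \<ge> 0\<close> by (auto simp: d_def field_simps)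
  obtain k1 k2 where k: "\<And>x v. x \<in> carrier G \<Longrightarrow> v \<in> B k1 \<Longrightarrow> \<bar>f (x \<otimes> v) - f x\<bar> \<le> d"
     "\<And>x v. x \<in> carrier G \<Longrightarrow> v \<in> B k2 \<Longrightarrow> \<bar>g (x \<otimes> v) - g x\<bar> \<le> d"
    using f g d(1) unfolding right_uniform_def by meson
  have "\<bar>h (x \<otimes> v) - h x\<bar> \<le> e" if "x \<in> carrier G" "v \<in> B (min k1 k2)" for x v
  proof -
    have v: "v \<in> B k1" "v \<in> B k2" using that B_mono by (meson min.cobounded1 min.cobounded2 subsetD)+
    have "\<bar>h (x \<otimes> v) - h x\<bar> \<le> C * (\<bar>f (x \<otimes> v) - f x\<bar> + \<bar>g (x \<otimes> v) - g x\<bar>)"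
      using that(1) v B_carrier by (intro assms(4)) auto
    also have "\<dots> \<le> C * (d + d)"
      using k that v \<open>C \<ge> 0\<close> by (intro mult_left_mono add_mono) auto
    finally show ?thesis using d by simp
  qed
  then show "\<exists>k. \<forall>x\<in>carrier G. \<forall>v\<in>B k. \<bar>h (x \<otimes> v) - h x\<bar> \<le> e" by blast
qed

text \<open>Sums, differences, multiples, positive parts and products are all controlled by the
  values and increments of two test functions, so this one criterion replaces separate checks of
  uniformity, boundedness and support.\<close>

lemma test_lipschitz:
  assumes f: "test f" and g: "test g" and "C \<ge> 0"
    and lip: "\<And>x y. x \<in> carrier G \<Longrightarrow> y \<in> carrier G \<Longrightarrow> \<bar>h y - h x\<bar> \<le> C * (\<bar>f y - f x\<bar> + \<bar>g y - g x\<bar>)"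
    and le: "\<And>x. x \<in> carrier G \<Longrightarrow> \<bar>h x\<bar> \<le> C * (\<bar>f x\<bar> + \<bar>g x\<bar>)"
  shows "test h"
proof -
  obtain K L where K: "\<And>x. x \<in> carrier G \<Longrightarrow> \<bar>f x\<bar> \<le> K" "\<And>x. x \<in> carrier G \<Longrightarrow> \<bar>g x\<bar> \<le> L"
    using f g unfolding test_def bdd_def by auto
  have "\<bar>h x\<bar> \<le> C * (K + L)" if "x \<in> carrier G" for x
    using le[OF that] mult_left_mono[OF add_mono[OF K(1)[OF that] K(2)[OF that]] \<open>C \<ge> 0\<close>] by linarith
  then have "bdd h" unfolding bdd_def by blast
  moreover obtain m n where mn: "supp_in m f" "supp_in n g"
    using f g by (auto simp: test_def)
  have "supp_in (max m n) h"
    using supp_in_mono[OF mn(1), of "max m n"] supp_in_mono[OF mn(2), of "max m n"] le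
    by (force simp: supp_in_def)
  ultimately show ?thesis
    using right_uniform_lipschitz[OF _ _ \<open>C \<ge> 0\<close> lip] f g by (auto simp: test_def)
qed

lemma test_add: "test f \<Longrightarrow> test g \<Longrightarrow> test (\<lambda>x. f x + g x)"
  by (rule test_lipschitz[of f g 1]) auto

lemma test_diff: "test f \<Longrightarrow> test g \<Longrightarrow> test (\<lambda>x. f x - g x)"
  by (rule test_lipschitz[of f g 1]) auto

lemma test_scale: 
  assumes "test f" shows "test (\<lambda>x. c * f x)"
proof (rule test_lipschitz[OF assms assms, of "\<bar>c\<bar>"])
  fix x y
  have "c * f y - c * f x = c * (f y - f x)" by (simp add: algebra_simps)
  then show "\<bar>c * f y - c * f x\<bar> \<le> \<bar>c\<bar> * (\<bar>f y - f x\<bar> + \<bar>f y - f x\<bar>)"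
    by (simp add: abs_mult mult_left_mono)
qed (auto simp: abs_mult mult_left_mono)

lemma test_pos: "test f \<Longrightarrow> test (\<lambda>x. max 0 (f x))"
  by (rule test_lipschitz[of f f 1]) (auto simp: abs_if max_def split: if_splits)

lemma test_neg: "test f \<Longrightarrow> test (\<lambda>x. max 0 (- f x))"
  by (rule test_lipschitz[of f f 1]) (auto simp: abs_if max_def split: if_splits)

lemma test_zero: "test (\<lambda>x. 0)"
  unfolding test_def right_uniform_def bdd_def supp_in_def by auto

lemma test_mult:
  assumes f: "test f" and g: "test g" shows "test (\<lambda>x. f x * g x)"
proof -
  from f have "bdd f" by (simp add: test_def)
  then obtain K where K: "K > 0" "\<And>x. x \<in> carrier G \<Longrightarrow> \<bar>f x\<bar> \<le> K" by (rule bddE) blast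
  from g have "bdd g" by (simp add: test_def)
  then obtain L where L: "L > 0" "\<And>x. x \<in> carrier G \<Longrightarrow> \<bar>g x\<bar> \<le> L" by (rule bddE) blast
  show ?thesis
  proof (rule test_lipschitz[OF f g, of "K + L"])
    show "0 \<le> K + L" using K L by simp
    fix x assume x: "x \<in> carrier G"
    show "\<bar>f x * g x\<bar> \<le> (K + L) * (\<bar>f x\<bar> + \<bar>g x\<bar>)"
      unfolding abs_mult using K(1) L(1) K(2)[OF x] by (intro mult_mono) auto
    fix y assume y: "y \<in> carrier G"
    have "f y * g y - f x * g x = f y * (g y - g x) + g x * (f y - f x)" by (simp add: algebra_simps)
    then have "\<bar>f y * g y - f x * g x\<bar> \<le> \<bar>f y\<bar> * \<bar>g y - g x\<bar> + \<bar>g x\<bar> * \<bar>f y - f x\<bar>"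
      by (metis abs_mult abs_triangle_ineq)
    also have "\<dots> \<le> (K + L) * \<bar>g y - g x\<bar> + (K + L) * \<bar>f y - f x\<bar>"
      using K(1) L(1) K(2)[OF y] L(2)[OF x] by (intro add_mono mult_right_mono) auto
    finally show "\<bar>f y * g y - f x * g x\<bar> \<le> (K + L) * (\<bar>f y - f x\<bar> + \<bar>g y - g x\<bar>)"
      by (simp add: algebra_simps)
  qed
qed

text \<open>If \<open>t\<close> and \<open>inv t \<otimes> x\<close> both lie in \<open>B k\<close>,
  their product \<open>x\<close> lies in \<open>B (k + s)\<close>.\<close>

lemma supp_in_tr:
  assumes "supp_in n f" "t \<in> B m" "n \<le> k" "m \<le> k" shows "supp_in (k + s) (tr t f)"
  unfolding supp_in_def
proof
  fix x assume x: "x \<in> carrier G - B (k + s)"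
  have "inv t \<otimes> x \<notin> B k"
  proof
    assume a: "inv t \<otimes> x \<in> B k"
    have "t \<in> B k" using assms B_mono by blast
    then have "t \<otimes> (inv t \<otimes> x) \<in> B (k + s)" using a by (rule B_mult)
    moreover have "t \<otimes> (inv t \<otimes> x) = x" using x assms(2) B_carrier by (simp add: inv_solve_left' m_assoc[symmetric])
    ultimately show False using x by simp
  qed
  then have "inv t \<otimes> x \<notin> B n" using B_mono assms by blast
  then show "tr t f x = 0" using assms x B_carrier by (auto simp: tr_def supp_in_def)
qed

text \<open>Left translations commute with the right increments that \<open>right_uniform\<close>
  measures, so uniformity survives with the same ball; this is why increments are taken on the
  right.\<close>

lemma test_tr:
  assumes f: "test f" and t: "t \<in> carrier G" shows "test (tr t f)"
proof -
  obtain K n where K: "\<And>x. x \<in> carrier G \<Longrightarrow> \<bar>f x\<bar> \<le> K" and n: "supp_in n f"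
    using f by (auto simp: test_def bdd_def)
  obtain m where m: "t \<in> B m" using B_exhaust t by blast
  have "supp_in (max m n + s) (tr t f)"
    using supp_in_tr[OF n m, of "max m n"] by simp
  moreover have "bdd (tr t f)"
    unfolding bdd_def tr_def using K t by (intro exI[of _ K]) auto
  moreover have "right_uniform (tr t f)"
    unfolding right_uniform_def tr_def
  proof (intro allI impI)
    fix e :: real assume "e > 0"
    then obtain k where k: "\<And>x v. x \<in> carrier G \<Longrightarrow> v \<in> B k \<Longrightarrow> \<bar>f (x \<otimes> v) - f x\<bar> \<le> e"
      using f unfolding test_def right_uniform_def by meson
    have "\<bar>f (inv t \<otimes> (x \<otimes> v)) - f (inv t \<otimes> x)\<bar> \<le> e" if "x \<in> carrier G" "v \<in> B k" for x v
      using k[of "inv t \<otimes> x" v] that t B_carrier by (simp add: m_assoc)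
    then show "\<exists>k. \<forall>x\<in>carrier G. \<forall>v\<in>B k. \<bar>f (inv t \<otimes> (x \<otimes> v)) - f (inv t \<otimes> x)\<bar> \<le> e" by blast
  qed
  ultimately show ?thesis unfolding test_def by blast
qed

end

section \<open>The Haar integral\<close>

context filtered_group begin

text \<open>Families of weighted left translates are lists because adding, rescaling and translating
  them are then concatenation and \<open>map\<close>, each with a simple effect on
  \<open>weight\<close>.\<close>

definition cover_sum :: "('a \<Rightarrow> real) \<Rightarrow> (real \<times> 'a) list \<Rightarrow> 'a \<Rightarrow> real"
  where "cover_sum g xs x = (\<Sum>(c, t)\<leftarrow>xs. c * g (inv t \<otimes> x))"

abbreviation weight :: "(real \<times> 'a) list \<Rightarrow> real"
  where "weight xs \<equiv> sum_list (map fst xs)"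

definition covers :: "('a \<Rightarrow> real) \<Rightarrow> ('a \<Rightarrow> real) \<Rightarrow> (real \<times> 'a) list \<Rightarrow> bool"
  where "covers f g xs \<longleftrightarrow> (\<forall>(c, t)\<in>set xs. 0 \<le> c \<and> t \<in> carrier G) \<and>
    (\<forall>x\<in>carrier G. f x \<le> cover_sum g xs x)"

text \<open>Haar's covering index \<open>(f : g)\<close>, the infimum of the total weights of the coverings of \<open>f\<close>
  by left translates of \<open>g\<close>.\<close>

definition index :: "('a \<Rightarrow> real) \<Rightarrow> ('a \<Rightarrow> real) \<Rightarrow> real"
  where "index f g = Inf (weight ` {xs. covers f g xs})"

definition bump :: "('a \<Rightarrow> real) \<Rightarrow> bool"
  where "bump g \<longleftrightarrow> test g \<and> (\<forall>x\<in>carrier G. 0 \<le> g x) \<and> 0 < g \<one>"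

lemma test_bound:
  assumes "test f" obtains K where "K > 0" "\<And>x. x \<in> carrier G \<Longrightarrow> \<bar>f x\<bar> \<le> K"
proof -
  from assms have "bdd f" by (simp add: test_def)
  then show ?thesis using that by (rule bddE)
qed

lemma bump_test: "bump g \<Longrightarrow> test g"
  by (simp add: bump_def)

lemma cover_sum_simps [simp]:
  "cover_sum g [] x = 0"
  "cover_sum g (p # xs) x = fst p * g (inv (snd p) \<otimes> x) + cover_sum g xs x"
  "cover_sum g (xs @ ys) x = cover_sum g xs x + cover_sum g ys x"
  by (auto simp: cover_sum_def case_prod_beta)

lemma test_cover_sum:
  assumes "test g" "\<forall>(c, t)\<in>set xs. 0 \<le> c \<and> t \<in> carrier G"
  shows "test (cover_sum g xs)"
  using assms(2)
proof (induction xs)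
  case Nil
  then show ?case using test_zero by (simp add: cover_sum_def[abs_def])
next
  case (Cons p xs)
  have "test (\<lambda>x. fst p * tr (snd p) g x + cover_sum g xs x)"
    using Cons by (intro test_add test_scale test_tr assms) auto
  moreover have "cover_sum g (p # xs) = (\<lambda>x. fst p * tr (snd p) g x + cover_sum g xs x)"
    by (simp add: fun_eq_iff tr_def)
  ultimately show ?case by (simp only:)
qed

lemma bump_lower:
  assumes "bump g" obtains k a where "a > 0" "\<And>v. v \<in> B k \<Longrightarrow> a \<le> g v"
proof -
  have pos: "0 < g \<one> / 2" and "right_uniform g" using assms by (auto simp: bump_def test_def)
  then obtain k where "\<And>v. v \<in> B k \<Longrightarrow> \<bar>g (\<one> \<otimes> v) - g \<one>\<bar> \<le> g \<one> / 2"
    unfolding right_uniform_def using one_closed by blast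
  then have "g \<one> / 2 \<le> g v" if "v \<in> B k" for v
    using that B_carrier[OF that] by (smt (verit) field_sum_of_halves l_one)
  with pos that show ?thesis by blast
qed

text \<open>Total boundedness is applied at a scale \<open>k\<close> on which \<open>g\<close> stays
  above some \<open>a > 0\<close>: each point of the ball lies in a translate of \<open>B k\<close>,
  and the weight \<open>1 / a\<close> lifts that translate of \<open>g\<close> to at least
  1.\<close>

lemma cover_ball:
  assumes "bump g" 
  obtains xs where "\<forall>(c, t)\<in>set xs. 0 \<le> c \<and> t \<in> carrier G"
    "\<And>x. x \<in> carrier G \<Longrightarrow> 0 \<le> cover_sum g xs x" "\<And>x. x \<in> B n \<Longrightarrow> 1 \<le> cover_sum g xs x"
proof -
  obtain k a where a: "a > 0" "\<And>v. v \<in> B k \<Longrightarrow> a \<le> g v" using bump_lower assms by blast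
  have g0: "\<And>x. x \<in> carrier G \<Longrightarrow> 0 \<le> g x" using assms by (auto simp: bump_def)
  obtain S where S: "finite S" "S \<subseteq> carrier G" "\<And>x. x \<in> B n \<Longrightarrow> \<exists>t\<in>S. inv t \<otimes> x \<in> B k"
    using B_totally_bounded[of n k] by blast
  obtain ts where ts: "set ts = S" using S finite_list by blast
  define xs where "xs = map (\<lambda>t. (1 / a, t)) ts"
  have nonneg: "0 \<le> cover_sum g (map (\<lambda>t. (1 / a, t)) us) x" if "x \<in> carrier G" "set us \<subseteq> carrier G" for us x
    using that(2) by (induction us) (use g0 a that in auto)
  have "1 \<le> cover_sum g (map (\<lambda>t. (1 / a, t)) us) x" 
    if "x \<in> carrier G" "set us \<subseteq> carrier G" "t \<in> set us" "inv t \<otimes> x \<in> B k" for us x t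
    using that(2,3)
  proof (induction us)
    case (Cons u us)
    have 1: "0 \<le> cover_sum g (map (\<lambda>t. (1 / a, t)) us) x" using Cons nonneg that by auto
    have 2: "0 \<le> g (inv u \<otimes> x) / a" using g0[of "inv u \<otimes> x"] Cons.prems \<open>x \<in> carrier G\<close> a(1) by simp
    show ?case
    proof (cases "u = t")
      case True
      then have "1 \<le> g (inv u \<otimes> x) / a" using a that(4) by simp
      with 1 show ?thesis by simp
    next
      case False
      then have "1 \<le> cover_sum g (map (\<lambda>t. (1 / a, t)) us) x" using Cons by auto
      with 2 show ?thesis by simp
    qed
  qed simp
  note le = this
  have "1 \<le> cover_sum g xs x" if x: "x \<in> B n" for x
  proof -
    obtain t where "t \<in> S" "inv t \<otimes> x \<in> B k" using S(3)[OF x] by blast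
    then show ?thesis
      unfolding xs_def using S(2) ts B_carrier[OF x] by (intro le) auto
  qed
  moreover have "0 \<le> cover_sum g xs x" if "x \<in> carrier G" for x
    using nonneg[OF that] S ts by (simp add: xs_def)
  ultimately show ?thesis
    using that[of xs] a S ts by (auto simp: xs_def)
qed

lemma cover_sum_scale: "cover_sum g (map (\<lambda>(c, t). (d * c, t)) xs) x = d * cover_sum g xs x"
  by (induction xs) (auto simp: algebra_simps)

lemma weight_scale: "weight (map (\<lambda>(c, t). (d * c, t)) xs) = d * weight xs"
  by (induction xs) (auto simp: algebra_simps)

lemma weight_shift: "weight (map (\<lambda>(c, t). (c, u \<otimes> t)) xs) = weight xs"
  by (induction xs) auto

lemma cover_sum_shift:
  assumes "u \<in> carrier G" "x \<in> carrier G" "\<forall>(c, t)\<in>set xs. 0 \<le> c \<and> t \<in> carrier G"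
  shows "cover_sum g (map (\<lambda>(c, t). (c, u \<otimes> t)) xs) x = cover_sum g xs (inv u \<otimes> x)"
  using assms(3) by (induction xs) (use assms(1,2) in \<open>auto simp: inv_mult_group m_assoc\<close>)

text \<open>A covering of the ball that carries \<open>f\<close>, multiplied by a bound of
  \<open>f\<close>, dominates \<open>f\<close>. Thus the infimum in \<open>index\<close> is taken
  over a nonempty set.\<close>

lemma covers_exists:
  assumes "test f" "bump g" shows "\<exists>xs. covers f g xs"
proof -
  obtain n where n: "supp_in n f" using assms by (auto simp: test_def)
  obtain K where K: "K > 0" "\<And>x. x \<in> carrier G \<Longrightarrow> \<bar>f x\<bar> \<le> K"
    using test_bound[OF assms(1)] by blast
  obtain xs where xs: "\<forall>(c, t)\<in>set xs. 0 \<le> c \<and> t \<in> carrier G"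
    "\<And>x. x \<in> carrier G \<Longrightarrow> 0 \<le> cover_sum g xs x" "\<And>x. x \<in> B n \<Longrightarrow> 1 \<le> cover_sum g xs x"
    using cover_ball[OF assms(2), where n = n] by blast
  have "f x \<le> K * cover_sum g xs x" if "x \<in> carrier G" for x
  proof (cases "x \<in> B n")
    case True
    have "f x \<le> K" using K(2)[OF that] by linarith
    also have "\<dots> \<le> K * cover_sum g xs x" using xs(3)[OF True] K(1) by simp
    finally show ?thesis .
  next
    case False
    then show ?thesis using n that xs(2) K(1) by (auto simp: supp_in_def)
  qed
  then have "covers f g (map (\<lambda>(c, t). (K * c, t)) xs)"
    using xs(1) K(1) by (auto simp: covers_def cover_sum_scale)
  then show ?thesis by blast
qed

lemma weight_nonneg: "covers f g xs \<Longrightarrow> 0 \<le> weight xs"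
  by (rule sum_list_nonneg) (auto simp: covers_def)

lemma index_le: "covers f g xs \<Longrightarrow> index f g \<le> weight xs"
  unfolding index_def using weight_nonneg by (intro cInf_lower) (auto intro!: bdd_belowI2[of _ 0])

lemma index_ge:
  assumes "test f" "bump g" "\<And>xs. covers f g xs \<Longrightarrow> c \<le> weight xs"
  shows "c \<le> index f g"
  unfolding index_def using assms covers_exists[OF assms(1,2)] by (intro cInf_greatest) auto

lemma index_nonneg: "test f \<Longrightarrow> bump g \<Longrightarrow> 0 \<le> index f g"
  by (rule index_ge) (auto intro: weight_nonneg)

lemma index_mono_gen:
  assumes "test f" "bump g" "\<And>xs. covers f g xs \<Longrightarrow> \<exists>ys. covers h g' ys \<and> weight ys \<le> weight xs"
  shows "index h g' \<le> index f g"
proof (rule index_ge[OF assms(1,2)])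
  fix xs assume "covers f g xs"
  then obtain ys where "covers h g' ys" "weight ys \<le> weight xs" using assms(3) by blast
  with index_le[of h g' ys] show "index h g' \<le> weight xs" by linarith
qed

lemma index_mono:
  assumes "test f" "bump g" "\<And>x. x \<in> carrier G \<Longrightarrow> h x \<le> f x"
  shows "index h g \<le> index f g"
proof (rule index_mono_gen[OF assms(1,2)])
  fix xs assume "covers f g xs"
  then have "covers h g xs"
    using assms(3) unfolding covers_def by (blast intro: order_trans)
  then show "\<exists>ys. covers h g ys \<and> weight ys \<le> weight xs" by blast
qed

lemma index_scale_le:
  assumes "test f" "bump g" "c > 0"
  shows "index (\<lambda>x. c * f x) g \<le> c * index f g"
proof -
  have "index (\<lambda>x. c * f x) g / c \<le> index f g"
  proof (rule index_ge[OF assms(1,2)])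
    fix xs assume "covers f g xs"
    then have "covers (\<lambda>x. c * f x) g (map (\<lambda>(d, t). (c * d, t)) xs)"
      using assms(3) by (auto simp: covers_def cover_sum_scale)
    from index_le[OF this] have "index (\<lambda>x. c * f x) g \<le> c * weight xs"
      unfolding weight_scale .
    then show "index (\<lambda>x. c * f x) g / c \<le> weight xs"
      using assms(3) by (simp only: pos_divide_le_eq mult.commute)
  qed
  then show ?thesis using assms(3) by (simp add: field_simps)
qed

lemma index_scale:
  assumes "test f" "bump g" "c > 0"
  shows "index (\<lambda>x. c * f x) g = c * index f g"
proof (rule antisym[OF index_scale_le[OF assms]])
  have "index (\<lambda>x. (1/c) * (c * f x)) g \<le> (1/c) * index (\<lambda>x. c * f x) g"
    using assms by (intro index_scale_le test_scale) auto
  then show "c * index f g \<le> index (\<lambda>x. c * f x) g"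
    using assms(3) by (simp add: field_simps)
qed

lemma index_tr_le:
  assumes "test f" "bump g" "u \<in> carrier G"
  shows "index (tr u f) g \<le> index f g"
proof (rule index_mono_gen[OF assms(1,2)])
  fix xs assume xs: "covers f g xs"
  then have "covers (tr u f) g (map (\<lambda>(c, t). (c, u \<otimes> t)) xs)"
    using assms(3) by (auto simp: covers_def tr_def cover_sum_shift)
  then show "\<exists>ys. covers (tr u f) g ys \<and> weight ys \<le> weight xs"
    using weight_shift[of u xs] by (metis order_refl)
qed

lemma index_tr:
  assumes "test f" "bump g" "u \<in> carrier G"
  shows "index (tr u f) g = index f g"
proof (rule antisym[OF index_tr_le[OF assms]])
  have "index f g \<le> index (tr (inv u) (tr u f)) g"
    using assms by (intro index_mono test_tr) (auto simp: tr_def m_assoc[symmetric])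
  also have "\<dots> \<le> index (tr u f) g"
    using assms by (intro index_tr_le test_tr) auto
  finally show "index f g \<le> index (tr u f) g" .
qed

lemma index_add_le:
  assumes "test f" "test h" "bump g"
  shows "index (\<lambda>x. f x + h x) g \<le> index f g + index h g"
proof -
  have le: "index (\<lambda>x. f x + h x) g \<le> weight xs + weight ys" if "covers f g xs" "covers h g ys" for xs ys
  proof -
    have "covers (\<lambda>x. f x + h x) g (xs @ ys)"
      using that by (auto simp: covers_def intro: add_mono)
    from index_le[OF this] show ?thesis by simp
  qed
  \<comment> \<open>The infima are taken one at a time: first over the coverings of \<open>h\<close>
    with \<open>xs\<close> fixed, then over the coverings of \<open>f\<close>.\<close>
  have *: "index (\<lambda>x. f x + h x) g - weight xs \<le> index h g" if "covers f g xs" for xs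
  proof (intro index_ge assms)
    fix ys assume "covers h g ys"
    from le[OF that this] show "index (\<lambda>x. f x + h x) g - weight xs \<le> weight ys" by linarith
  qed
  have "index (\<lambda>x. f x + h x) g - index h g \<le> index f g"
  proof (intro index_ge assms)
    fix xs assume "covers f g xs"
    from *[OF this] show "index (\<lambda>x. f x + h x) g - index h g \<le> weight xs" by linarith
  qed
  then show ?thesis by simp
qed

text \<open>Substituting a covering of \<open>g\<close> by \<open>h\<close> into every translate of
  \<open>g\<close> in a covering of \<open>f\<close> multiplies the weights. This bounds the
  normalised indices from both sides.\<close>

lemma index_trans:
  assumes "test f" "bump g" "bump h"
  shows "index f h \<le> index f g * index g h"
proof -
  have *: "\<exists>zs. covers f h zs \<and> weight zs = weight xs * weight ys" 
    if xs: "covers f g xs" and ys: "covers g h ys" for xs ys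
  proof -
    have "\<exists>zs. (\<forall>(c, t)\<in>set zs. 0 \<le> c \<and> t \<in> carrier G) \<and>
        (\<forall>x\<in>carrier G. cover_sum g xs x \<le> cover_sum h zs x) \<and> weight zs = weight xs * weight ys"
      if "\<forall>(c, t)\<in>set xs. 0 \<le> c \<and> t \<in> carrier G"
      using that
    proof (induction xs)
      case Nil then show ?case by (intro exI[of _ "[]"]) auto
    next
      case (Cons p xs)
      then obtain zs where zs: "\<forall>(c, t)\<in>set zs. 0 \<le> c \<and> t \<in> carrier G"
        "\<And>x. x \<in> carrier G \<Longrightarrow> cover_sum g xs x \<le> cover_sum h zs x" "weight zs = weight xs * weight ys"
        by auto
      obtain c t where p: "p = (c, t)" "0 \<le> c" "t \<in> carrier G" using Cons.prems by (cases p) auto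
      define ws where "ws = map (\<lambda>(d, u). (c * d, u)) (map (\<lambda>(d, u). (d, t \<otimes> u)) ys)"
      have ys': "\<forall>(c, t)\<in>set ys. 0 \<le> c \<and> t \<in> carrier G" using ys by (simp add: covers_def)
      have "c * g (inv t \<otimes> x) \<le> cover_sum h ws x" if "x \<in> carrier G" for x
        using ys that p unfolding ws_def cover_sum_scale 
        by (subst cover_sum_shift[OF _ _ ys']) (auto simp: covers_def intro!: mult_left_mono)
      moreover have "weight ws = c * weight ys" by (simp add: ws_def weight_scale weight_shift del: map_map)
      moreover have "\<forall>(c, t)\<in>set ws. 0 \<le> c \<and> t \<in> carrier G" using ys' p by (auto simp: ws_def)
      moreover from calculation(1) have "cover_sum g (p # xs) x \<le> cover_sum h (ws @ zs) x" if "x \<in> carrier G" for x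
        using zs(2)[OF that] that p by (simp add: add_mono)
      ultimately show ?case
        using zs(1,3) p by (intro exI[of _ "ws @ zs"]) (auto simp: algebra_simps)
    qed
    then obtain zs where zs: "\<forall>(c, t)\<in>set zs. 0 \<le> c \<and> t \<in> carrier G"
      "\<forall>x\<in>carrier G. cover_sum g xs x \<le> cover_sum h zs x" "weight zs = weight xs * weight ys"
      using xs unfolding covers_def by blast
    then have "covers f h zs" using xs unfolding covers_def by (blast intro: order_trans)
    with zs(3) show ?thesis by blast
  qed
  have le: "index f h \<le> weight xs * weight ys" if "covers f g xs" "covers g h ys" for xs ys
    using *[OF that] index_le by metis
  have tg: "test g" using assms by (simp add: bump_def)
  \<comment> \<open>The infimum over the second factor needs division by the first, so vanishing
    weights and vanishing indices are treated separately.\<close>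
  have le2: "index f h \<le> weight xs * index g h" if xs: "covers f g xs" for xs
  proof (cases "weight xs = 0")
    case True
    then show ?thesis using le[OF xs] covers_exists[OF tg assms(3)] by force
  next
    case False
    then have w: "weight xs > 0" using weight_nonneg[OF xs] by simp
    have "index f h / weight xs \<le> index g h"
      using le[OF xs] w by (intro index_ge tg assms) (simp add: field_simps)
    then show ?thesis using w by (simp add: field_simps)
  qed
  show ?thesis
  proof (cases "index g h = 0")
    case True
    then show ?thesis using le2 covers_exists[OF assms(1,2)] by force
  next
    case False
    then have w: "index g h > 0" using index_nonneg[OF tg assms(3)] by simp
    have "index f h / index g h \<le> index f g"
      using le2 w by (intro index_ge assms) (simp add: field_simps)
    then show ?thesis using w by (simp add: field_simps)
  qed
qed

text \<open>Evaluate a covering at the identity: its value there is at most its weight times a bound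
  \<open>K\<close> of \<open>g\<close>, so the weight is at least
  \<open>f \<one> / K\<close>.\<close>

lemma index_pos:
  assumes "bump f" "bump g" shows "0 < index f g"
proof -
  obtain K where K: "K > 0" "\<And>x. x \<in> carrier G \<Longrightarrow> \<bar>g x\<bar> \<le> K"
    using test_bound[OF bump_test[OF assms(2)]] by blast
  have "f \<one> / K \<le> index f g"
  proof (rule index_ge)
    fix xs assume xs: "covers f g xs"
    have "cover_sum g xs \<one> \<le> weight xs * K" if "\<forall>(c, t)\<in>set xs. 0 \<le> c \<and> t \<in> carrier G"
      using that
    proof (induction xs)
      case (Cons p xs)
      then have "g (inv (snd p) \<otimes> \<one>) \<le> K" "fst p \<ge> 0" using K(2)[of "inv (snd p) \<otimes> \<one>"] by auto
      then have "fst p * g (inv (snd p) \<otimes> \<one>) \<le> fst p * K" by (rule mult_left_mono)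
      with Cons show ?case by (auto simp: algebra_simps)
    qed simp
    then have "f \<one> \<le> weight xs * K" using xs by (force simp: covers_def)
    then show "f \<one> / K \<le> weight xs" using K by (simp add: field_simps)
  qed (use assms in \<open>auto simp: bump_def\<close>)
  moreover have "0 < f \<one> / K" using assms K by (simp add: bump_def)
  ultimately show ?thesis by linarith
qed

end

section \<open>Asymptotic additivity of the covering index\<close>

context filtered_group begin

text \<open>The lower bound on \<open>h\<close> holds only in a larger ball. If \<open>x\<close> or
  \<open>x \<otimes> v\<close> lies outside it, neither of the two lies in \<open>B n\<close>, so
  both quotients are 0.\<close>

lemma quotient_uniform:
  assumes f: "test f" and h: "test h"
    and fh: "\<And>x. x \<in> carrier G \<Longrightarrow> 0 \<le> f x \<and> f x \<le> h x"
    and n: "supp_in n f" and "d > 0" "e > 0"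
    and low: "\<And>x. x \<in> B (max n 0 + s) \<Longrightarrow> d \<le> h x"
  obtains k where "\<And>x v. x \<in> carrier G \<Longrightarrow> v \<in> B k \<Longrightarrow> \<bar>f (x \<otimes> v) / h (x \<otimes> v) - f x / h x\<bar> \<le> e"
proof -
  have "e * d / 2 > 0" using assms by simp
  then obtain k1 k2 where k: "\<And>x v. x \<in> carrier G \<Longrightarrow> v \<in> B k1 \<Longrightarrow> \<bar>f (x \<otimes> v) - f x\<bar> \<le> e * d / 2"
     "\<And>x v. x \<in> carrier G \<Longrightarrow> v \<in> B k2 \<Longrightarrow> \<bar>h (x \<otimes> v) - h x\<bar> \<le> e * d / 2"
    using f h unfolding right_uniform_def test_def by meson
  \<comment> \<open>Having \<open>v\<close> in \<open>B (max n 0)\<close> as well ensures that when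
    one of \<open>x\<close> and \<open>x \<otimes> v\<close> lies in \<open>B n\<close>, both lie in
    the ball on which \<open>h \<ge> d\<close>.\<close>
  define k where "k = min (min k1 k2) (max n 0)"
  have kk: "k \<le> k1" "k \<le> k2" "k \<le> max n 0" by (auto simp: k_def)
  have "\<bar>f (x \<otimes> v) / h (x \<otimes> v) - f x / h x\<bar> \<le> e" if x: "x \<in> carrier G" and v: "v \<in> B k" for x v
  proof -
    have vB: "v \<in> B k1" "v \<in> B k2" "v \<in> B (max n 0)" using v B_mono kk by blast+
    have y: "x \<otimes> v \<in> carrier G" using x v B_carrier by simp
    have xv: "x = (x \<otimes> v) \<otimes> inv v" using x B_carrier[OF v] by (simp add: m_assoc)
    show ?thesis
    proof (cases "x \<in> B (max n 0 + s) \<and> x \<otimes> v \<in> B (max n 0 + s)")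
      case True
      define a b a' b' where "a = f (x \<otimes> v)" "b = h (x \<otimes> v)" "a' = f x" "b' = h x"
      have A: "d \<le> b" "d \<le> b'" "0 \<le> a'" "a' \<le> b'" "\<bar>a - a'\<bar> \<le> e * d / 2" "\<bar>b - b'\<bar> \<le> e * d / 2"
        using True low fh[OF x] k(1)[OF x vB(1)] k(2)[OF x vB(2)] by (auto simp: a_b_a'_b'_def)
      have b: "b > 0" "b' > 0" using A \<open>d > 0\<close> by auto
      \<comment> \<open>In this form the increment of \<open>h\<close> is multiplied only by
        \<open>a' / b'\<close>, which is at most 1; the division by \<open>b \<ge> d\<close> is paid
        for by the factor \<open>d\<close> in the tolerances.\<close>
      have eq: "a / b - a' / b' = ((a - a') - (a' / b') * (b - b')) / b"
        using b by (simp add: field_simps)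
      have "\<bar>(a' / b') * (b - b')\<bar> \<le> 1 * \<bar>b - b'\<bar>"
        unfolding abs_mult using A b by (intro mult_right_mono) auto
      also have "1 * \<bar>b - b'\<bar> \<le> e * d / 2" using A(6) by (simp only: mult_1)
      finally have "\<bar>a - a'\<bar> + \<bar>(a' / b') * (b - b')\<bar> \<le> e * d / 2 + e * d / 2"
        by (rule add_mono[OF A(5)])
      then have "\<bar>(a - a') - (a' / b') * (b - b')\<bar> \<le> e * d"
        using abs_triangle_ineq4[of "a - a'" "(a' / b') * (b - b')"] by (simp only: field_sum_of_halves)
      also have "\<dots> \<le> e * b" using A \<open>e > 0\<close> by simp
      finally show ?thesis
        unfolding a_b_a'_b'_def[symmetric] eq using b by (simp add: abs_divide pos_divide_le_eq)
    next
      case False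
      have "x \<notin> B n \<and> x \<otimes> v \<notin> B n"
      proof (rule ccontr)
        assume "\<not> (x \<notin> B n \<and> x \<otimes> v \<notin> B n)"
        then have "x \<in> B (max n 0) \<or> x \<otimes> v \<in> B (max n 0)" using B_mono[of n "max n 0"] by auto
        then have "x \<in> B (max n 0 + s) \<and> x \<otimes> v \<in> B (max n 0 + s)"
          using B_mult[of x "max n 0" v] B_mult[of "x \<otimes> v" "max n 0" "inv v"] vB(3) B_inv[OF vB(3)] xv
            B_mono[of "max n 0" "max n 0 + s"] s_nonneg by auto
        with False show False by simp
      qed
      then show ?thesis using n x y \<open>e > 0\<close> by (simp add: supp_in_def)
    qed
  qed
  then show ?thesis by (rule that)
qed

text \<open>Take \<open>h\<close> slightly above \<open>f1 + f2\<close>. The quotients of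
  \<open>f1\<close> and \<open>f2\<close> by \<open>h\<close> are nearly constant on translates of a
  small support, so a covering of \<open>h\<close> splits into coverings of \<open>f1\<close> and
  \<open>f2\<close>, each coefficient being multiplied by the quotient at the translating element
  plus \<open>c\<close>. Since the quotients add up to at most 1, the total weight grows at most by
  the factor \<open>1 + 2 * c\<close>.\<close>

lemma index_almost_additive:
  assumes f1: "test f1" "\<And>x. x \<in> carrier G \<Longrightarrow> 0 \<le> f1 x"
    and f2: "test f2" "\<And>x. x \<in> carrier G \<Longrightarrow> 0 \<le> f2 x"
    and f0: "bump f0" and "e > 0"
  obtains k where "\<And>g. bump g \<Longrightarrow> supp_in k g \<Longrightarrow>
    index f1 g + index f2 g \<le> index (\<lambda>x. f1 x + f2 x) g + e * index f0 g"
proof -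
  obtain n1 n2 where "supp_in n1 f1" "supp_in n2 f2" using f1 f2 by (auto simp: test_def)
  then obtain n where n: "supp_in n f1" "supp_in n f2"
    using supp_in_mono by (meson max.cobounded1 max.cobounded2)
  obtain xs where xs: "\<forall>(c, t)\<in>set xs. 0 \<le> c \<and> t \<in> carrier G"
    "\<And>x. x \<in> carrier G \<Longrightarrow> 0 \<le> cover_sum f0 xs x"
    "\<And>x. x \<in> B (max n 0 + s) \<Longrightarrow> 1 \<le> cover_sum f0 xs x"
    using cover_ball[OF f0, where n = "max n 0 + s"] by blast
  define F where "F = cover_sum f0 xs"
  have F: "test F" unfolding F_def using xs(1) f0 by (intro test_cover_sum) (auto simp: bump_def)
  define f where "f = (\<lambda>x. f1 x + f2 x)"
  have f: "test f" using f1 f2 by (simp add: f_def test_add)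
  define K K' where "K = index f f0" "K' = index F f0"
  have K: "K \<ge> 0" "K' \<ge> 0" unfolding K_K'_def using f F f0 by (auto intro: index_nonneg)
  \<comment> \<open>The error is 2 c (f : g) + (1 + 2 c) d (F : g), and (f : g), (F : g) are at most
    \<open>K\<close>, \<open>K'\<close> times (f0 : g). With \<open>c \<le> 1 / 2\<close> each of
    the two terms is at most e / 2 times (f0 : g).\<close>
  define d where "d = e / (4 * (K' + 1))"
  define c where "c = min (1 / 2) (e / (4 * (K + 1)))"
  have d: "d > 0" using K \<open>e > 0\<close> by (simp add: d_def)
  have c: "c > 0" using K \<open>e > 0\<close> by (simp add: c_def)
  have c2: "c \<le> 1 / 2" unfolding c_def by (rule min.cobounded1)
  have "d * K' \<le> e / 4" using K \<open>e > 0\<close> by (simp add: d_def field_simps)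
  have "c * K \<le> e / (4 * (K + 1)) * K" using K by (intro mult_right_mono) (auto simp: c_def)
  also have "\<dots> \<le> e / 4" using K \<open>e > 0\<close> by (simp add: field_simps)
  finally have "c * K \<le> e / 4" .
  \<comment> \<open>Adding \<open>d * F x\<close>, which is at least \<open>d\<close> on a ball
    around the supports, bounds \<open>h\<close> away from 0 there and makes the quotients
    uniform.\<close>
  define h where "h = (\<lambda>x. f x + d * F x)"
  have h: "test h" using f F by (simp add: h_def test_add test_scale)
  have h1: "0 \<le> f1 x \<and> f1 x \<le> h x" and h2: "0 \<le> f2 x \<and> f2 x \<le> h x" if "x \<in> carrier G" for x
    using f1(2)[OF that] f2(2)[OF that] xs(2)[OF that] d by (auto simp: h_def f_def F_def)
  have low: "d \<le> h x" if "x \<in> B (max n 0 + s)" for x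
  proof -
    have "d * 1 \<le> d * F x" unfolding F_def using xs(3)[OF that] d by (intro mult_left_mono) auto
    then show ?thesis using f1(2)[of x] f2(2)[of x] B_carrier[OF that] by (simp add: h_def f_def)
  qed
  obtain k1 where k1: "\<And>x v. x \<in> carrier G \<Longrightarrow> v \<in> B k1 \<Longrightarrow> \<bar>f1 (x \<otimes> v) / h (x \<otimes> v) - f1 x / h x\<bar> \<le> c"
    using quotient_uniform[OF f1(1) h h1 n(1) d c low] by blast
  obtain k2 where k2: "\<And>x v. x \<in> carrier G \<Longrightarrow> v \<in> B k2 \<Longrightarrow> \<bar>f2 (x \<otimes> v) / h (x \<otimes> v) - f2 x / h x\<bar> \<le> c"
    using quotient_uniform[OF f2(1) h h2 n(2) d c low] by blast
  have "index f1 g + index f2 g \<le> index f g + e * index f0 g" 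
    if g: "bump g" and supp: "supp_in (min k1 k2) g" for g
  proof -
    have g0: "0 \<le> g x" if "x \<in> carrier G" for x using g that by (auto simp: bump_def)
    have cov: "covers u g (map (\<lambda>(a, t). (a * (u t / h t + c), t)) ys)"
      if ys: "covers h g ys" and u: "\<And>x. x \<in> carrier G \<Longrightarrow> 0 \<le> u x \<and> u x \<le> h x"
        and kk: "min k1 k2 \<le> k"
        and uc: "\<And>x v. x \<in> carrier G \<Longrightarrow> v \<in> B k \<Longrightarrow> \<bar>u (x \<otimes> v) / h (x \<otimes> v) - u x / h x\<bar> \<le> c"
      for u ys k
    proof -
      have "u x \<le> cover_sum g (map (\<lambda>(a, t). (a * (u t / h t + c), t)) ys) x" if x: "x \<in> carrier G" for x
      proof -
        have *: "u x / h x * cover_sum g ys x \<le> cover_sum g (map (\<lambda>(a, t). (a * (u t / h t + c), t)) ys) x"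
          if "\<forall>(a, t)\<in>set ys. 0 \<le> a \<and> t \<in> carrier G"
          using that
        proof (induction ys)
          case (Cons p ys)
          obtain a t where p: "p = (a, t)" "0 \<le> a" "t \<in> carrier G" using Cons.prems by (cases p) auto
          have "u x / h x * g (inv t \<otimes> x) \<le> (u t / h t + c) * g (inv t \<otimes> x)"
          proof (cases "inv t \<otimes> x \<in> B (min k1 k2)")
            case True
            then have "inv t \<otimes> x \<in> B k" using B_mono[OF kk] by blast
            moreover have "t \<otimes> (inv t \<otimes> x) = x" using x p by (simp add: m_assoc[symmetric])
            ultimately have "u x / h x \<le> u t / h t + c" using uc[of t "inv t \<otimes> x"] p by auto
            then show ?thesis using g0[of "inv t \<otimes> x"] x p by (intro mult_right_mono) auto
          next
            case False
            then have "g (inv t \<otimes> x) = 0" using supp x p by (auto simp: supp_in_def)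
            then show ?thesis by simp
          qed
          from mult_left_mono[OF this p(2)] Cons p(1) show ?case by (auto simp: algebra_simps)
        qed simp
        have hx: "h x \<le> cover_sum g ys x" using ys x by (auto simp: covers_def)
        have "u x = u x / h x * h x" using u[OF x] by auto
        also have "\<dots> \<le> u x / h x * cover_sum g ys x"
          using hx u[OF x] by (intro mult_left_mono) auto
        also have "\<dots> \<le> cover_sum g (map (\<lambda>(a, t). (a * (u t / h t + c), t)) ys) x"
          using * ys by (auto simp: covers_def)
        finally show ?thesis .
      qed
      moreover have "0 \<le> u t / h t" if "t \<in> carrier G" for t
        using u[OF that] by auto
      ultimately show ?thesis
        using ys c by (fastforce simp: covers_def)
    qed
    have main: "index f1 g + index f2 g \<le> (1 + 2 * c) * weight ys" if ys: "covers h g ys" for ys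
    proof -
      let ?m = "\<lambda>u. map (\<lambda>(a, t). (a * (u t / h t + c), t)) ys"
      have "covers f1 g (?m f1)" by (rule cov[OF ys h1 _ k1]) auto
      moreover have "covers f2 g (?m f2)" by (rule cov[OF ys h2 _ k2]) auto
      ultimately have "index f1 g + index f2 g \<le> weight (?m f1) + weight (?m f2)"
        by (intro add_mono index_le)
      also have "\<dots> \<le> (1 + 2 * c) * weight ys" if "\<forall>(a, t)\<in>set ys. 0 \<le> a \<and> t \<in> carrier G"
        using that
      proof (induction ys)
        case (Cons p ys)
        obtain a t where p: "p = (a, t)" "0 \<le> a" "t \<in> carrier G" using Cons.prems by (cases p) auto
        have "f1 t + f2 t \<le> h t" "0 \<le> h t"
          using xs(2)[OF p(3)] d h1[OF p(3)] by (auto simp: h_def f_def F_def)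
        then have "f1 t / h t + f2 t / h t \<le> 1"
          by (metis add_divide_distrib divide_le_eq_1 less_eq_real_def divide_self_if div_by_0 zero_le_one)
        then have "a * (f1 t / h t + f2 t / h t + 2 * c) \<le> a * (1 + 2 * c)"
          using p(2) by (intro mult_left_mono) auto
        moreover have "weight (map (\<lambda>(a, t). (a * (f1 t / h t + c), t)) ys) +
            weight (map (\<lambda>(a, t). (a * (f2 t / h t + c), t)) ys) \<le> (1 + 2 * c) * weight ys"
          using Cons by simp
        ultimately show ?case using p(1) by (simp add: algebra_simps)
      qed simp
      finally show ?thesis using ys by (simp add: covers_def)
    qed
    have "(index f1 g + index f2 g) / (1 + 2 * c) \<le> index h g"
    proof (rule index_ge[OF h g])
      fix ys assume "covers h g ys"
      from main[OF this] show "(index f1 g + index f2 g) / (1 + 2 * c) \<le> weight ys"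
        using c by (simp add: pos_divide_le_eq mult.commute)
    qed
    then have "index f1 g + index f2 g \<le> (1 + 2 * c) * index h g"
      using c by (simp add: pos_divide_le_eq mult.commute)
    also have "index h g \<le> index f g + d * index F g"
      using index_add_le[OF f test_scale[OF F, of d] g] index_scale[OF F g d] by (simp add: h_def)
    also have "(1 + 2 * c) * (index f g + d * index F g) = index f g + (2 * c * index f g + (1 + 2 * c) * (d * index F g))"
      by (simp add: algebra_simps)
    also have "\<dots> \<le> index f g + e * index f0 g"
    proof -
      have g0: "0 \<le> index f0 g" using f0 g by (intro index_nonneg) (auto simp: bump_def)
      have "c * index f g \<le> c * (K * index f0 g)"
        unfolding K_K'_def using c f f0 g by (intro mult_left_mono index_trans) auto
      also have "\<dots> \<le> e / 4 * index f0 g"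
        using mult_right_mono[OF \<open>c * K \<le> e / 4\<close> g0] by (simp add: mult.assoc)
      finally have 1: "c * index f g \<le> e / 4 * index f0 g" .
      have "(1 + 2 * c) * (d * index F g) \<le> 2 * (d * index F g)"
        using c c2 d index_nonneg[OF F g] by (intro mult_right_mono) auto
      also have "d * index F g \<le> d * (K' * index f0 g)"
        unfolding K_K'_def using d F f0 g by (intro mult_left_mono index_trans) auto
      also have "d * (K' * index f0 g) \<le> e / 4 * index f0 g"
        using mult_right_mono[OF \<open>d * K' \<le> e / 4\<close> g0] by (simp add: mult.assoc)
      finally have 2: "(1 + 2 * c) * (d * index F g) \<le> 2 * (e / 4 * index f0 g)" by simp
      show ?thesis using 1 2 by simp
    qed
    finally show ?thesis using c by simp
  qed
  then show ?thesis using that[of "min k1 k2"] by (simp add: f_def)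
qed

end

locale filtered_lc_group = filtered_group +
  assumes bump_exists: "\<exists>g. bump g \<and> supp_in n g"
begin

text \<open>Covering indices by bumps \<open>g k\<close> that shrink to the identity, divided by the
  index of \<open>f0\<close>, stay between 0 and (f : f0), so they converge along the filter.
  Subadditivity and translation invariance hold for each \<open>k\<close>; the reverse inequality
  for sums of nonnegative functions holds in the limit.\<close>

theorem haar_integral:
  assumes f0: "bump f0"
  shows "\<exists>I :: ('a \<Rightarrow> real) \<Rightarrow> real.
    (\<forall>f g. test f \<longrightarrow> test g \<longrightarrow> I (\<lambda>x. f x + g x) = I f + I g) \<and>
    (\<forall>c f. test f \<longrightarrow> I (\<lambda>x. c * f x) = c * I f) \<and>
    (\<forall>f. test f \<longrightarrow> (\<forall>x\<in>carrier G. 0 \<le> f x) \<longrightarrow> 0 \<le> I f) \<and>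
    (\<forall>t f. test f \<longrightarrow> t \<in> carrier G \<longrightarrow> I (tr t f) = I f) \<and>
    (\<forall>f. bump f \<longrightarrow> 0 < I f)"
proof -
  obtain g where g: "\<And>k. bump (g k)" "\<And>k :: nat. supp_in (- int k) (g k)"
  proof -
    have "\<forall>k :: nat. \<exists>g. bump g \<and> supp_in (- int k) g" using bump_exists by blast
    from choice[OF this] that show ?thesis by blast
  qed
  obtain F where F: "F \<noteq> bot" "F \<le> sequentially" "\<And>x :: nat \<Rightarrow> real. Bseq x \<Longrightarrow> (x \<longlongrightarrow> Lim F x) F"
    using generalized_limit_filter by blast
  define r where "r = (\<lambda>f k. index f (g k) / index f0 (g k))"
  define J where "J = (\<lambda>f. Lim F (r f))"
  have f0g: "0 < index f0 (g k)" for k using f0 g by (simp add: index_pos)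
  have r_nonneg: "0 \<le> r f k" if "test f" for f k
    unfolding r_def using index_nonneg[OF that g(1)] f0g[of k] by simp
  have r_le: "r f k \<le> index f f0" if "test f" for f k
    unfolding r_def using index_trans[OF that f0 g(1)] f0g[of k] by (simp add: pos_divide_le_eq)
  have lim: "(r f \<longlongrightarrow> J f) F" if "test f" for f
    unfolding J_def using r_nonneg[OF that] r_le[OF that] 
    by (intro F(3) BseqI'[of _ "index f f0"]) (simp add: abs_le_iff order_trans[of _ 0])
  have ev: "eventually P F" if "\<And>k. k \<ge> N \<Longrightarrow> P k" for P and N :: nat
    using that F(2) eventually_sequentially filter_leD by blast
  have J_eq: "J f = J h" if "test f" "test h" "\<And>k. index f (g k) = index h (g k)" for f h
  proof -
    have "r f = r h" using that by (simp add: r_def fun_eq_iff)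
    then show ?thesis by (simp add: J_def)
  qed
  have J_nonneg: "0 \<le> J f" if "test f" for f
    using r_nonneg[OF that] lim[OF that] F(1) by (intro tendsto_lowerbound[OF lim[OF that]]) auto
  have J_scale: "J (\<lambda>x. c * f x) = c * J f" if "test f" "c > 0" for c f
  proof -
    have "r (\<lambda>x. c * f x) = (\<lambda>k. c * r f k)"
      using index_scale[OF that(1) g(1) that(2)] by (simp add: r_def fun_eq_iff)
    then have "(r (\<lambda>x. c * f x) \<longlongrightarrow> c * J f) F"
      using tendsto_mult_left[OF lim[OF that(1)], of c] by simp
    then show ?thesis using lim[OF test_scale[OF that(1)]] F(1) tendsto_unique by blast
  qed
  have J_tr: "J (tr t f) = J f" if "test f" "t \<in> carrier G" for t f
    using that index_tr[OF that(1) g(1) that(2)] by (intro J_eq test_tr) auto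
  have J_add: "J (\<lambda>x. f x + h x) = J f + J h" 
    if f: "test f" "\<And>x. x \<in> carrier G \<Longrightarrow> 0 \<le> f x" and h: "test h" "\<And>x. x \<in> carrier G \<Longrightarrow> 0 \<le> h x" for f h
  proof (rule antisym)
    have "r (\<lambda>x. f x + h x) k \<le> r f k + r h k" for k
      unfolding r_def add_divide_distrib[symmetric]
      using index_add_le[OF f(1) h(1) g(1)] f0g[of k] by (intro divide_right_mono) auto
    then show "J (\<lambda>x. f x + h x) \<le> J f + J h"
      by (intro tendsto_le[OF F(1) tendsto_add[OF lim[OF f(1)] lim[OF h(1)]] lim[OF test_add[OF f(1) h(1)]]]) auto
    show "J f + J h \<le> J (\<lambda>x. f x + h x)"
    proof (rule field_le_epsilon)
      fix e :: real assume "e > 0"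
      then obtain k where k: "\<And>g. bump g \<Longrightarrow> supp_in k g \<Longrightarrow>
        index f g + index h g \<le> index (\<lambda>x. f x + h x) g + e * index f0 g"
        using index_almost_additive[OF f h f0] by blast
      have "r f j + r h j \<le> r (\<lambda>x. f x + h x) j + e" if "j \<ge> nat (- k)" for j
      proof -
        have "supp_in k (g j)" using that by (intro supp_in_mono[OF g(2)]) auto
        from k[OF g(1) this] have "(index f (g j) + index h (g j)) / index f0 (g j) \<le>
            (index (\<lambda>x. f x + h x) (g j) + e * index f0 (g j)) / index f0 (g j)"
          using f0g[of j] by (intro divide_right_mono) auto
        then show ?thesis using f0g[of j] by (simp add: r_def add_divide_distrib)
      qed
      then show "J f + J h \<le> J (\<lambda>x. f x + h x) + e"
        by (intro tendsto_le[OF F(1) tendsto_add[OF lim[OF test_add[OF f(1) h(1)]] tendsto_const]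
            tendsto_add[OF lim[OF f(1)] lim[OF h(1)]]] ev)
    qed
  qed
  have J_zero: "J f = 0" if f: "test f" "\<And>x. x \<in> carrier G \<Longrightarrow> f x = 0" for f
  proof -
    have "index f (g k) = 0" for k
      using index_le[of f "g k" "[]"] index_nonneg[OF f(1) g(1), of k] f(2) by (simp add: covers_def)
    then have "r f = (\<lambda>_. 0)" by (simp add: r_def fun_eq_iff)
    then show ?thesis using lim[OF f(1)] F(1) by (metis tendsto_const tendsto_unique)
  qed
  \<comment> \<open>The covering index of a nonpositive function is 0, so \<open>J\<close> is
    meaningful only on nonnegative functions and is extended from them by differences.\<close>
  define I where "I = (\<lambda>f. J (\<lambda>x. max 0 (f x)) - J (\<lambda>x. max 0 (- f x)))"
  note tp = test_pos test_neg test_add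
  have "I (\<lambda>x. f x + h x) = I f + I h" if f: "test f" and h: "test h" for f h
  proof -
    let ?p = "\<lambda>f x. max 0 (f x) :: real" and ?n = "\<lambda>f x. max 0 (- f x) :: real"
    let ?s = "\<lambda>x. f x + h x"
    \<comment> \<open>The identity between the positive and negative parts of f, h and f + h is
      rearranged so that only sums of nonnegative functions occur, where \<open>J\<close> is
      additive.\<close>
    have "J (\<lambda>x. ?p ?s x + (?n f x + ?n h x)) = J (\<lambda>x. ?n ?s x + (?p f x + ?p h x))"
      by (rule arg_cong[where f = J]) (auto simp: fun_eq_iff max_def)
    then show ?thesis
      using f h test_neg[OF test_add[OF f h]] by (simp add: J_add tp I_def)
  qed
  moreover have "I (\<lambda>x. c * f x) = c * I f" if f: "test f" for c f
  proof (cases c "0 :: real" rule: linorder_cases)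
    case less
    have "(\<lambda>x. max 0 (c * f x)) = (\<lambda>x. - c * max 0 (- f x))" "(\<lambda>x. max 0 (- (c * f x))) = (\<lambda>x. - c * max 0 (f x))"
      using less by (auto simp: fun_eq_iff max_def mult_le_0_iff zero_le_mult_iff)
    then show ?thesis using J_scale[OF test_pos[OF f], of "- c"] J_scale[OF test_neg[OF f], of "- c"] less
      by (simp add: I_def algebra_simps)
  next
    case equal
    then show ?thesis by (simp add: I_def)
  next
    case greater
    have "(\<lambda>x. max 0 (c * f x)) = (\<lambda>x. c * max 0 (f x))" "(\<lambda>x. max 0 (- (c * f x))) = (\<lambda>x. c * max 0 (- f x))"
      using greater by (auto simp: fun_eq_iff max_def mult_le_0_iff zero_le_mult_iff)
    then show ?thesis using J_scale[OF test_pos[OF f], of c] J_scale[OF test_neg[OF f], of c] greater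
      by (simp add: I_def algebra_simps)
  qed
  moreover have I_pos: "I f = J (\<lambda>x. max 0 (f x))" if "test f" "\<And>x. x \<in> carrier G \<Longrightarrow> 0 \<le> f x" for f
    using J_zero[OF test_neg[OF that(1)]] that(2) by (simp add: I_def)
  moreover have "0 \<le> I f" if "test f" "\<And>x. x \<in> carrier G \<Longrightarrow> 0 \<le> f x" for f
    using I_pos[OF that] J_nonneg[OF test_pos[OF that(1)]] by simp
  moreover have "I (tr t f) = I f" if "test f" "t \<in> carrier G" for t f
    using J_tr[OF test_pos that(2)] J_tr[OF test_neg that(2)] that(1) by (simp add: I_def tr_def)
  moreover have "0 < I f" if f: "bump f" for f
  proof -
    let ?p = "\<lambda>x. max 0 (f x)"
    have p: "bump ?p" using f by (auto simp: bump_def test_pos)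
    have pos: "0 < index f0 ?p" using index_pos[OF f0 p] .
    \<comment> \<open>Covering \<open>f0\<close> by \<open>?p\<close>, and \<open>?p\<close> by
      \<open>g k\<close>, bounds the ratio below independently of \<open>k\<close>, so strict
      positivity survives the limit.\<close>
    have "1 / index f0 ?p \<le> r ?p k" for k
      using index_trans[OF bump_test[OF f0] p g(1)] f0g[of k] pos
      by (simp add: r_def divide_simps mult.commute)
    then have "1 / index f0 ?p \<le> J ?p"
      using F(1) by (intro tendsto_lowerbound[OF lim[OF bump_test[OF p]]]) auto
    then show ?thesis
      using I_pos[of f] f pos by (simp add: bump_def) (smt (verit) divide_pos_pos)
  qed
  ultimately show ?thesis by (intro exI[of _ I]) simp
qed

end

section \<open>Self-similar groups\<close>

context filtered_group begin

primrec set_power :: "'a set \<Rightarrow> nat \<Rightarrow> 'a set"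
  where "set_power A 0 = {\<one>}"
  | "set_power A (Suc j) = {a \<otimes> b | a b. a \<in> A \<and> b \<in> set_power A j}"

lemma set_power_carrier: "A \<subseteq> carrier G \<Longrightarrow> set_power A j \<subseteq> carrier G"
  by (induction j) auto

lemma set_power_add:
  assumes "A \<subseteq> carrier G" "x \<in> set_power A i" "y \<in> set_power A j"
  shows "x \<otimes> y \<in> set_power A (i + j)"
  using assms(2)
proof (induction i arbitrary: x)
  case 0
  have "y \<in> carrier G" using assms(3) set_power_carrier[OF assms(1)] by blast
  then show ?case using 0 assms(3) by simp
next
  case (Suc i)
  then obtain a b where ab: "x = a \<otimes> b" "a \<in> A" "b \<in> set_power A i" by auto
  have "a \<in> carrier G" "b \<in> carrier G" "y \<in> carrier G"
    using ab assms set_power_carrier[OF assms(1)] by blast+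
  then have "x \<otimes> y = a \<otimes> (b \<otimes> y)" using ab by (simp add: m_assoc)
  then show ?case using Suc.IH[OF ab(3)] ab(2) by auto
qed

lemma set_power_mono_exp:
  assumes "A \<subseteq> carrier G" "\<one> \<in> A" "i \<le> j" shows "set_power A i \<subseteq> set_power A j"
proof -
  have one: "\<one> \<in> set_power A n" for n by (induction n) (use assms in \<open>auto intro!: exI[of _ \<one>]\<close>)
  show ?thesis
  proof
    fix x assume x: "x \<in> set_power A i"
    have "x \<otimes> \<one> \<in> set_power A (i + (j - i))" by (rule set_power_add[OF assms(1) x one])
    then show "x \<in> set_power A j" using assms set_power_carrier[OF assms(1)] x by (auto simp: subset_iff)
  qed
qed

lemma set_power_refine:
  assumes C: "C \<subseteq> carrier G" and A: "A \<subseteq> set_power C L"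
  shows "set_power A j \<subseteq> set_power C (L * j)"
proof (induction j)
  case (Suc j)
  then show ?case using A set_power_add[OF C, of _ L _ "L * j"] by fastforce
qed simp

lemma set_power_one: "A \<subseteq> carrier G \<Longrightarrow> set_power A 1 = A"
  by (auto simp: subset_iff) (metis r_one)

lemma set_power_ball: "set_power (B m) p \<subseteq> B (m + s * int p)"
proof (induction p)
  case 0
  then show ?case using B_one by simp
next
  case (Suc p)
  have "a \<otimes> b \<in> B (m + s * int (Suc p))" if "a \<in> B m" "b \<in> B (m + s * int p)" for a b
  proof -
    have "a \<in> B (m + s * int p)" using that(1) B_mono[of m "m + s * int p"] s_nonneg by auto
    from B_mult[OF this that(2)] show ?thesis by (simp add: algebra_simps)
  qed
  with Suc show ?case by fastforce
qed

end

text \<open>Connectedness survives only as \<open>generated\<close>: a connected group is generated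
  by a neighbourhood of the identity, and compactness of \<open>B 1\<close> bounds the number of
  factors. The Hausdorff property survives as \<open>separated\<close>, and continuity of
  conjugation over a compact ball as \<open>B_conj\<close>.\<close>

locale self_similar_group = filtered_lc_group +
  fixes \<alpha> :: "'a \<Rightarrow> 'a"
  assumes alpha_iso: "\<alpha> \<in> iso G G"
    and alpha_B: "x \<in> carrier G \<Longrightarrow> \<alpha> x \<in> B (n - 1) \<longleftrightarrow> x \<in> B n"
    and B_conj: "\<exists>j. \<forall>z\<in>B n. \<forall>v\<in>B j. inv z \<otimes> v \<otimes> z \<in> B k"
    and generated: "\<exists>L. B 1 \<subseteq> set_power (B 0) L"
    and separated: "(\<And>n. x \<in> B n) \<Longrightarrow> x = \<one>"
    and nontrivial: "carrier G \<noteq> {\<one>}"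
begin

abbreviation iter :: "nat \<Rightarrow> 'a \<Rightarrow> 'a"
  where "iter k \<equiv> \<alpha> ^^ k"

lemma iter_iso: "iter k \<in> iso G G"
  by (rule funpow_iso[OF alpha_iso])

lemma iter_closed [simp]: "x \<in> carrier G \<Longrightarrow> iter k x \<in> carrier G"
  using iter_iso[of k] by (auto simp: iso_def hom_def)

lemma iter_mult: "x \<in> carrier G \<Longrightarrow> y \<in> carrier G \<Longrightarrow> iter k (x \<otimes> y) = iter k x \<otimes> iter k y"
  using iter_iso[of k] by (auto simp: iso_def hom_def)

lemma iter_one: "iter k \<one> = \<one>"
  using iter_iso[of k] hom_one is_group unfolding iso_def by blast

lemma iter_surj: assumes "y \<in> carrier G" obtains x where "x \<in> carrier G" "iter k x = y"
proof -
  have "iter k ` carrier G = carrier G" using iter_iso[of k] by (simp add: iso_def bij_betw_def)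
  with assms have "y \<in> iter k ` carrier G" by simp
  then show ?thesis by (rule imageE) (simp add: that)
qed

lemma iter_B: "x \<in> carrier G \<Longrightarrow> iter k x \<in> B (n - int k) \<longleftrightarrow> x \<in> B n"
proof (induction k arbitrary: n)
  case (Suc k)
  then show ?case using alpha_B[of "iter k x" "n - int k"] by (simp add: algebra_simps)
qed simp

lemma iter_set_power:
  "x \<in> carrier G \<Longrightarrow> iter k x \<in> set_power (B (n - int k)) L \<longleftrightarrow> x \<in> set_power (B n) L"
proof (induction L arbitrary: x)
  case 0
  have "inj_on (iter k) (carrier G)" using iter_iso[of k] by (simp add: iso_def bij_betw_def)
  then show ?case using 0 iter_one[of k] inj_onD[of "iter k" "carrier G" x \<one>] by auto
next
  case (Suc L)
  show ?case
  proof
    assume "x \<in> set_power (B n) (Suc L)"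
    then obtain a b where ab: "x = a \<otimes> b" "a \<in> B n" "b \<in> set_power (B n) L" by auto
    have c: "a \<in> carrier G" "b \<in> carrier G" using ab set_power_carrier[OF B_sub] B_sub by blast+
    have "iter k x = iter k a \<otimes> iter k b" "iter k a \<in> B (n - int k)" "iter k b \<in> set_power (B (n - int k)) L"
      using ab c iter_mult iter_B Suc.IH by auto
    then show "iter k x \<in> set_power (B (n - int k)) (Suc L)" by auto
  next
    assume "iter k x \<in> set_power (B (n - int k)) (Suc L)"
    then obtain a' b' where ab': "iter k x = a' \<otimes> b'" "a' \<in> B (n - int k)" "b' \<in> set_power (B (n - int k)) L" by auto
    have "a' \<in> carrier G" "b' \<in> carrier G" using ab' set_power_carrier[OF B_sub] B_sub by blast+
    then obtain a b where ab: "a \<in> carrier G" "iter k a = a'" "b \<in> carrier G" "iter k b = b'"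
      by (metis iter_surj)
    have "iter k (a \<otimes> b) = iter k x" using ab ab'(1) iter_mult by simp
    moreover have "inj_on (iter k) (carrier G)" using iter_iso[of k] by (simp add: iso_def bij_betw_def)
    ultimately have "a \<otimes> b = x" using ab Suc.prems by (auto dest: inj_onD)
    moreover have "a \<in> B n" "b \<in> set_power (B n) L" using ab ab' iter_B Suc.IH by auto
    ultimately show "x \<in> set_power (B n) (Suc L)" by auto
  qed
qed

text \<open>Powers of \<alpha> carry the inclusion at scale 0 to every scale: for
  \<open>j \<ge> 0\<close> the point is pushed forward to scale 0, otherwise it is pulled
  back.\<close>

lemma set_power_scale:
  assumes L: "B 1 \<subseteq> set_power (B 0) L" shows "B (j + 1) \<subseteq> set_power (B j) L"
proof
  fix x assume x: "x \<in> B (j + 1)"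
  show "x \<in> set_power (B j) L"
  proof (cases "j \<ge> 0")
    case True
    have "iter (nat j) x \<in> B 1" using iter_B[of x "nat j" "j + 1"] x B_carrier[OF x] True by simp
    then have "iter (nat j) x \<in> set_power (B (j - int (nat j))) L" using L True by auto
    then show ?thesis using iter_set_power[of x "nat j" j L] B_carrier[OF x] by simp
  next
    case False
    obtain y where y: "y \<in> carrier G" "iter (nat (-j)) y = x" using iter_surj B_carrier[OF x] by blast
    have "y \<in> B 1" using iter_B[of y "nat (-j)" 1] x y False by (simp add: algebra_simps)
    then have "y \<in> set_power (B 0) L" using L by blast
    then show ?thesis using iter_set_power[of y "nat (-j)" 0 L] y False by simp
  qed
qed

lemma generated_power: "\<exists>L>0. \<forall>m. B (m + int i) \<subseteq> set_power (B m) L"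
proof -
  obtain L0 where "B 1 \<subseteq> set_power (B 0) L0" using generated ..
  note L = set_power_scale[OF this]
  \<comment> \<open>\<open>Suc L0\<close> instead of \<open>L0\<close> guarantees that the resulting
    exponent is positive.\<close>
  have "B (m + int i) \<subseteq> set_power (B m) (Suc L0 ^ i)" for m
  proof (induction i)
    case 0
    then show ?case using set_power_one[OF B_sub] by simp
  next
    case (Suc i)
    have "B (m + int (Suc i)) \<subseteq> set_power (B (m + int i)) L0" using L[of "m + int i"] by (simp add: algebra_simps)
    also have "\<dots> \<subseteq> set_power (B (m + int i)) (Suc L0)"
      using set_power_mono_exp[OF B_sub B_one, of L0 "Suc L0"] by simp
    also have "\<dots> \<subseteq> set_power (B m) (Suc L0 ^ i * Suc L0)" by (rule set_power_refine[OF B_sub Suc])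
    finally show ?case by (simp only: power_Suc2)
  qed
  then show ?thesis by (intro exI[of _ "Suc L0 ^ i"]) simp
qed

lemma generated_general: obtains L where "L > 0" "B n \<subseteq> set_power (B m) L"
proof -
  obtain L where L: "L > 0" "\<forall>j. B (j + int (nat (n - m))) \<subseteq> set_power (B j) L"
    using generated_power[of "nat (n - m)"] by (elim exE conjE)
  have "B n \<subseteq> B (m + int (nat (n - m)))" by (rule B_mono) simp
  also have "\<dots> \<subseteq> set_power (B m) L" using L(2) by (rule spec)
  finally show ?thesis by (rule that[OF L(1)])
qed

text \<open>Otherwise self-similarity would make all balls equal, and a point lying in all of them
  is the identity. This is what bounds the length of the powers of a small ball that stay inside
  \<open>B 0\<close>.\<close>

lemma B1_not_B0: "\<not> B 1 \<subseteq> B 0"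
proof
  assume a: "B 1 \<subseteq> B 0"
  have "set_power (B j) 1 = B j" for j by (rule set_power_one[OF B_sub])
  with a have step: "B (j + 1) \<subseteq> B j" for j using set_power_scale[of 1 j] by simp
  have "x = \<one>" if "x \<in> carrier G" for x
  proof (rule separated)
    fix n
    obtain m where m: "x \<in> B m" using B_exhaust[OF \<open>x \<in> carrier G\<close>] ..
    have down: "x \<in> B (m - int i)" for i
    proof (induction i)
      case (Suc i)
      have "m - int i = (m - int (Suc i)) + 1" by simp
      then show ?case using step[of "m - int (Suc i)"] Suc by (metis subsetD)
    qed (use m in simp)
    have "B (m - int (nat (m - n))) \<subseteq> B n" by (rule B_mono) simp
    then show "x \<in> B n" using down by blast
  qed
  then have "carrier G = {\<one>}" by auto
  then show False using nontrivial by simp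
qed

end

section \<open>A homomorphism into the real numbers\<close>

locale self_similar_haar = self_similar_group +
  fixes \<theta> :: "'a \<Rightarrow> real" and I :: "('a \<Rightarrow> real) \<Rightarrow> real" and K :: real
  assumes bump_theta: "bump \<theta>" and supp_theta: "supp_in 0 \<theta>"
    and theta_le: "x \<in> carrier G \<Longrightarrow> \<theta> x \<le> K" and K_pos: "K > 0"
    and I_add: "test f \<Longrightarrow> test g \<Longrightarrow> I (\<lambda>x. f x + g x) = I f + I g"
    and I_scale: "test f \<Longrightarrow> I (\<lambda>x. c * f x) = c * I f"
    and I_nonneg: "test f \<Longrightarrow> (\<And>x. x \<in> carrier G \<Longrightarrow> 0 \<le> f x) \<Longrightarrow> 0 \<le> I f"
    and I_tr: "test f \<Longrightarrow> t \<in> carrier G \<Longrightarrow> I (tr t f) = I f"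
    and I_pos: "bump f \<Longrightarrow> 0 < I f"
begin

lemma test_theta: "test \<theta>" and theta_nonneg: "x \<in> carrier G \<Longrightarrow> 0 \<le> \<theta> x"
  using bump_theta by (auto simp: bump_def)

lemma I_diff: "test f \<Longrightarrow> test g \<Longrightarrow> I (\<lambda>x. f x - g x) = I f - I g"
  using I_add[of f "\<lambda>x. - 1 * g x"] I_scale[of g "- 1"] test_scale[of g "- 1"] by simp

lemma I_mono:
  assumes "test f" "test g" "\<And>x. x \<in> carrier G \<Longrightarrow> f x \<le> g x" shows "I f \<le> I g"
  using I_nonneg[OF test_diff[OF assms(2,1)]] I_diff[OF assms(2,1)] assms(3) by simp

lemma I_cong:
  assumes "test f" "test g" "\<And>x. x \<in> carrier G \<Longrightarrow> f x = g x" shows "I f = I g"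
  using I_mono[OF assms(1,2)] I_mono[OF assms(2,1)] assms(3) by (simp add: antisym)

lemma I_abs_le:
  assumes "test f" "test g" "\<And>x. x \<in> carrier G \<Longrightarrow> \<bar>f x\<bar> \<le> c * g x" shows "\<bar>I f\<bar> \<le> c * I g"
proof -
  have "I f \<le> I (\<lambda>x. c * g x)" 
    using assms(3) by (intro I_mono assms test_scale) (simp add: abs_le_iff)
  moreover have "I (\<lambda>x. - c * g x) \<le> I f"
    using assms(3) by (intro I_mono assms test_scale) (fastforce simp: abs_le_iff)
  ultimately show ?thesis using I_scale[OF assms(2), of c] I_scale[OF assms(2), of "- c"] by simp
qed

text \<open>The factor \<open>1 - j / M\<close> makes this function change by at most \<open>K / M\<close> under left translation
  by elements of \<^term>\<open>B (- int k)\<close>; it inherits the modulus of right uniform continuity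
  of \<^term>\<open>\<theta>\<close>, uniformly in \<open>M\<close> and \<open>k\<close>.\<close>

definition psi :: "nat \<Rightarrow> nat \<Rightarrow> 'a \<Rightarrow> real"
  where "psi M k x =
    (SUP (j, q)\<in>{(j, q). j \<le> M \<and> q \<in> set_power (B (- int k)) j}. (1 - real j / real M) * \<theta> (inv q \<otimes> x))"

lemma power_in_ball:
  assumes "set_power (B (- int k)) M \<subseteq> B 0" "j \<le> M" "q \<in> set_power (B (- int k)) j"
  shows "q \<in> B 0"
  using set_power_mono_exp[OF B_sub B_one assms(2)] assms by blast

context
  fixes M k :: nat
  assumes M: "M \<ge> 1" "set_power (B (- int k)) M \<subseteq> B 0"
begin

lemma psi_ge:
  assumes "x \<in> carrier G" "j \<le> M" "q \<in> set_power (B (- int k)) j"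
  shows "(1 - real j / real M) * \<theta> (inv q \<otimes> x) \<le> psi M k x"
proof -
  have "(1 - real j / real M) * \<theta> (inv q \<otimes> x) \<le> K"
    if "j \<le> M" "q \<in> set_power (B (- int k)) j" for j q
  proof -
    have "inv q \<otimes> x \<in> carrier G" using assms(1) power_in_ball[OF M(2) that] B_carrier by simp
    then have "(1 - real j / real M) * \<theta> (inv q \<otimes> x) \<le> 1 * K"
      using that M theta_le theta_nonneg K_pos by (intro mult_mono) auto
    then show ?thesis by simp
  qed
  then have "bdd_above ((\<lambda>(j, q). (1 - real j / real M) * \<theta> (inv q \<otimes> x)) ` {(j, q). j \<le> M \<and> q \<in> set_power (B (- int k)) j})"
    by (intro bdd_aboveI2[of _ _ K]) auto
  then show ?thesis
    unfolding psi_def using assms(2,3) by (intro cSUP_upper2[of _ _ "(j, q)"]) auto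
qed

lemma psi_le:
  assumes "\<And>j q. j \<le> M \<Longrightarrow> q \<in> set_power (B (- int k)) j \<Longrightarrow> (1 - real j / real M) * \<theta> (inv q \<otimes> x) \<le> c"
  shows "psi M k x \<le> c"
proof -
  have "{(j, q). j \<le> M \<and> q \<in> set_power (B (- int k)) j} \<noteq> {}" by (auto intro!: exI[of _ 0])
  then show ?thesis unfolding psi_def using assms by (intro cSUP_least) auto
qed

lemma psi_ge_theta: assumes "x \<in> carrier G" shows "\<theta> x \<le> psi M k x"
  using psi_ge[OF assms, of 0 \<one>] assms by simp

lemma psi_nonneg: "x \<in> carrier G \<Longrightarrow> 0 \<le> psi M k x"
  using psi_ge_theta[of x] theta_nonneg[of x] by simp

lemma psi_le_K: assumes "x \<in> carrier G" shows "psi M k x \<le> K"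
proof (rule psi_le)
  fix j q assume *: "j \<le> M" "q \<in> set_power (B (- int k)) j"
  have "inv q \<otimes> x \<in> carrier G" using assms(1) power_in_ball[OF M(2) *] B_carrier by simp
  then have "(1 - real j / real M) * \<theta> (inv q \<otimes> x) \<le> 1 * K"
    using * M theta_le theta_nonneg K_pos by (intro mult_mono) auto
  then show "(1 - real j / real M) * \<theta> (inv q \<otimes> x) \<le> K" by simp
qed

lemma psi_supp: "supp_in s (psi M k)"
  unfolding supp_in_def
proof
  fix x assume x: "x \<in> carrier G - B s"
  have "psi M k x \<le> 0"
  proof (rule psi_le)
    fix j q assume *: "j \<le> M" "q \<in> set_power (B (- int k)) j"
    have q: "q \<in> B 0" using power_in_ball[OF M(2) *] .
    have "inv q \<otimes> x \<notin> B 0"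
    proof
      assume "inv q \<otimes> x \<in> B 0"
      from B_mult[OF q this] show False using x B_carrier[OF q] by (simp add: m_assoc[symmetric])
    qed
    then have "\<theta> (inv q \<otimes> x) = 0" using supp_theta x B_carrier[OF q] by (auto simp: supp_in_def)
    then show "(1 - real j / real M) * \<theta> (inv q \<otimes> x) \<le> 0" by simp
  qed
  then show "psi M k x = 0" using psi_nonneg[of x] x by simp
qed

lemma psi_right_uniform: "right_uniform (psi M k)"
  unfolding right_uniform_def
proof (intro allI impI)
  fix e :: real assume "e > 0"
  then obtain i where i: "\<And>x v. x \<in> carrier G \<Longrightarrow> v \<in> B i \<Longrightarrow> \<bar>\<theta> (x \<otimes> v) - \<theta> x\<bar> \<le> e"
    using test_theta unfolding test_def right_uniform_def by meson
  have "psi M k (x \<otimes> v) \<le> psi M k x + e" if x: "x \<in> carrier G" and v: "v \<in> B i" for x v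
  proof (rule psi_le)
    fix j q assume *: "j \<le> M" "q \<in> set_power (B (- int k)) j"
    have q: "q \<in> carrier G" using power_in_ball[OF M(2) *] B_carrier by simp
    have "\<theta> (inv q \<otimes> (x \<otimes> v)) \<le> \<theta> (inv q \<otimes> x) + e"
      using i[of "inv q \<otimes> x" v] q x v B_carrier[OF v] by (simp add: m_assoc abs_le_iff)
    then have "(1 - real j / real M) * \<theta> (inv q \<otimes> (x \<otimes> v)) \<le> (1 - real j / real M) * (\<theta> (inv q \<otimes> x) + e)"
      using * M by (intro mult_left_mono) auto
    also have "\<dots> \<le> (1 - real j / real M) * \<theta> (inv q \<otimes> x) + e"
      using \<open>e > 0\<close> by (simp add: algebra_simps)
    also have "\<dots> \<le> psi M k x + e" using psi_ge[OF x *] by simp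
    finally show "(1 - real j / real M) * \<theta> (inv q \<otimes> (x \<otimes> v)) \<le> psi M k x + e" .
  qed
  note le = this
  have "\<bar>psi M k (x \<otimes> v) - psi M k x\<bar> \<le> e" if x: "x \<in> carrier G" and v: "v \<in> B i" for x v
  proof -
    have "psi M k ((x \<otimes> v) \<otimes> inv v) \<le> psi M k (x \<otimes> v) + e"
      using le[of "x \<otimes> v" "inv v"] x v B_carrier[OF v] B_inv[OF v] by simp
    moreover have "(x \<otimes> v) \<otimes> inv v = x" using x B_carrier[OF v] by (simp add: m_assoc)
    ultimately show ?thesis using le[OF x v] by (simp add: abs_le_iff)
  qed
  then show "\<exists>i. \<forall>x\<in>carrier G. \<forall>v\<in>B i. \<bar>psi M k (x \<otimes> v) - psi M k x\<bar> \<le> e" by blast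
qed

lemma test_psi: "test (psi M k)"
proof -
  have "\<bar>psi M k x\<bar> \<le> K" if "x \<in> carrier G" for x
    using psi_le_K[OF that] psi_nonneg[OF that] by simp
  then have "bdd (psi M k)" unfolding bdd_def by (intro exI[of _ K] ballI)
  then show ?thesis unfolding test_def using psi_right_uniform psi_supp by (intro conjI exI[of _ s])
qed

lemma psi_step:
  assumes h: "h \<in> B (- int k)" and x: "x \<in> carrier G"
  shows "\<bar>tr h (psi M k) x - psi M k x\<bar> \<le> K / M"
proof -
  have le: "psi M k (inv h \<otimes> x) \<le> psi M k x + K / M" if h: "h \<in> B (- int k)" and x: "x \<in> carrier G" for h x
  proof (rule psi_le)
    fix j q assume *: "j \<le> M" "q \<in> set_power (B (- int k)) j"
    have c: "q \<in> carrier G" "h \<in> carrier G" using power_in_ball[OF M(2) *] B_carrier h by blast+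
    show "(1 - real j / real M) * \<theta> (inv q \<otimes> (inv h \<otimes> x)) \<le> psi M k x + K / M"
    \<comment> \<open>At \<open>j = M\<close> the factor \<open>1 - j / M\<close> vanishes; for
      smaller \<open>j\<close> the element \<open>h\<close> is absorbed into a product of length
      \<open>Suc j\<close>, which is still admissible and costs only \<open>1 / M\<close> in the
      factor.\<close>
    proof (cases "j = M")
      case True
      then show ?thesis using psi_nonneg[OF x] K_pos M by simp
    next
      case False
      have "h \<otimes> q \<in> set_power (B (- int k)) (Suc j)" using h * by auto
      then have "(1 - real (Suc j) / real M) * \<theta> (inv (h \<otimes> q) \<otimes> x) \<le> psi M k x"
        using False * by (intro psi_ge x) auto
      moreover have eq: "inv (h \<otimes> q) \<otimes> x = inv q \<otimes> (inv h \<otimes> x)" using c x by (simp add: inv_mult_group m_assoc)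
      moreover have "\<theta> (inv q \<otimes> (inv h \<otimes> x)) / M \<le> K / M"
        using c x by (intro divide_right_mono theta_le) auto
      ultimately show ?thesis by (simp add: algebra_simps add_divide_distrib)
    qed
  qed
  have "psi M k (inv (inv h) \<otimes> (inv h \<otimes> x)) \<le> psi M k (inv h \<otimes> x) + K / M"
    using h x by (intro le B_inv) auto
  moreover have "inv (inv h) \<otimes> (inv h \<otimes> x) = x" using h x B_carrier[OF h] by (simp add: m_assoc[symmetric])
  ultimately show ?thesis using le[OF h x] by (simp add: tr_def abs_le_iff)
qed

lemma psi_steps:
  assumes "h \<in> set_power (B (- int k)) p" "x \<in> carrier G"
  shows "\<bar>tr h (psi M k) x - psi M k x\<bar> \<le> real p * (K / M)"
  using assms
proof (induction p arbitrary: h x)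
  case 0
  then show ?case by (simp add: tr_def)
next
  case (Suc p)
  then obtain a b where ab: "h = a \<otimes> b" "a \<in> B (- int k)" "b \<in> set_power (B (- int k)) p" by auto
  have c: "a \<in> carrier G" "b \<in> carrier G" using ab set_power_carrier[OF B_sub] B_sub by blast+
  have "tr h (psi M k) x = tr b (psi M k) (inv a \<otimes> x)"
    using c Suc.prems(2) ab(1) by (simp add: tr_def inv_mult_group m_assoc)
  moreover have "\<bar>tr b (psi M k) (inv a \<otimes> x) - psi M k (inv a \<otimes> x)\<bar> \<le> real p * (K / M)"
    using c Suc.prems(2) ab by (intro Suc.IH) auto
  moreover have "\<bar>psi M k (inv a \<otimes> x) - psi M k x\<bar> \<le> K / M"
    using psi_step[OF ab(2) Suc.prems(2)] by (simp add: tr_def)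
  moreover have "real (Suc p) * (K / M) = real p * (K / M) + K / M" by (simp add: algebra_simps add_divide_distrib)
  ultimately show ?case by linarith
qed

end

text \<open>\<^term>\<open>pairing f\<close> is the convolution of \<open>f\<close> with the inversion of \<^term>\<open>\<theta>\<close>.\<close>

definition pairing :: "('a \<Rightarrow> real) \<Rightarrow> 'a \<Rightarrow> real"
  where "pairing f w = I (\<lambda>y. f y * tr w \<theta> y)"

lemma pairing_test: "test f \<Longrightarrow> w \<in> carrier G \<Longrightarrow> test (\<lambda>y. f y * tr w \<theta> y)"
  by (intro test_mult test_tr test_theta)

lemma pairing_diff:
  "test f \<Longrightarrow> test g \<Longrightarrow> w \<in> carrier G \<Longrightarrow> pairing (\<lambda>x. f x - g x) w = pairing f w - pairing g w"
  unfolding pairing_def left_diff_distrib by (intro I_diff pairing_test)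

text \<open>Left invariance of the integral moves a translation of the function to the argument, so
  differences of \<open>phi\<close> can be computed on \<open>psik\<close>.\<close>

lemma pairing_tr:
  assumes "test f" "h \<in> carrier G" "w \<in> carrier G"
  shows "pairing (tr h f) w = pairing f (inv h \<otimes> w)"
proof -
  have "pairing (tr h f) w = I (tr h (\<lambda>y. f y * tr (inv h \<otimes> w) \<theta> y))"
    unfolding pairing_def
  proof (rule I_cong)
    fix y assume y: "y \<in> carrier G"
    have "inv (inv h \<otimes> w) \<otimes> (inv h \<otimes> y) = inv w \<otimes> (h \<otimes> inv h) \<otimes> y"
      using y assms by (simp only: inv_mult_group inv_closed inv_inv m_assoc m_closed)
    then show "tr h f y * tr w \<theta> y = tr h (\<lambda>y. f y * tr (inv h \<otimes> w) \<theta> y) y"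
      using y assms by (simp add: tr_def)
  qed (use assms in \<open>auto intro!: pairing_test test_tr\<close>)
  also have "\<dots> = pairing f (inv h \<otimes> w)"
    unfolding pairing_def using assms by (intro I_tr pairing_test) auto
  finally show ?thesis .
qed

lemma pairing_le:
  assumes "test f" "w \<in> carrier G" "\<And>x. x \<in> carrier G \<Longrightarrow> \<bar>f x\<bar> \<le> c"
  shows "\<bar>pairing f w\<bar> \<le> c * I \<theta>"
proof -
  have "\<bar>f x * tr w \<theta> x\<bar> \<le> c * tr w \<theta> x" if "x \<in> carrier G" for x
    using assms(2) assms(3)[OF that] that theta_nonneg[of "inv w \<otimes> x"] by (auto simp: abs_mult tr_def intro!: mult_right_mono)
  then have "\<bar>pairing f w\<bar> \<le> c * I (tr w \<theta>)"
    unfolding pairing_def using assms by (intro I_abs_le pairing_test test_tr test_theta)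
  then show ?thesis using I_tr[OF test_theta assms(2)] by simp
qed

text \<open>The ball \<open>B i\<close> depends only on \<open>n\<close> and \<open>e\<close>, and
  \<open>f\<close> enters only through its bound. This is essential because \<open>f\<close> will be
  a first difference of \<open>psik k\<close>, whose bound shrinks with \<open>k\<close>.\<close>

lemma pairing_uniform:
  assumes "e > 0"
  shows "\<exists>i. \<forall>f c x w. test f \<longrightarrow> supp_in n f \<longrightarrow> (\<forall>x\<in>carrier G. \<bar>f x\<bar> \<le> c) \<longrightarrow>
    x \<in> B i \<longrightarrow> w \<in> carrier G \<longrightarrow> \<bar>pairing f (inv x \<otimes> w) - pairing f w\<bar> \<le> c * e"
proof -
  obtain xs where xs: "\<forall>(c, t)\<in>set xs. 0 \<le> c \<and> t \<in> carrier G"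
    "\<And>x. x \<in> carrier G \<Longrightarrow> 0 \<le> cover_sum \<theta> xs x" "\<And>x. x \<in> B n \<Longrightarrow> 1 \<le> cover_sum \<theta> xs x"
    using cover_ball[OF bump_theta, where n = n] by blast
  \<comment> \<open>Being at least 1 on the ball that carries \<open>f\<close>, this function turns
    the pointwise bound on the integrand into a bound on its integral.\<close>
  define \<eta> where "\<eta> = cover_sum \<theta> xs"
  have \<eta>: "test \<eta>" unfolding \<eta>_def using xs(1) test_theta by (intro test_cover_sum)
  have I\<eta>: "0 \<le> I \<eta>" using I_nonneg[OF \<eta>] xs(2) by (simp add: \<eta>_def)
  define d where "d = e / (I \<eta> + 1)"
  have d: "d > 0" "d * I \<eta> \<le> e" using assms I\<eta> by (auto simp: d_def field_simps)
  obtain j where j: "\<And>x v. x \<in> carrier G \<Longrightarrow> v \<in> B j \<Longrightarrow> \<bar>\<theta> (x \<otimes> v) - \<theta> x\<bar> \<le> d"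
    using test_theta d(1) unfolding test_def right_uniform_def by meson
  obtain i where i: "\<And>z v. z \<in> B n \<Longrightarrow> v \<in> B i \<Longrightarrow> inv z \<otimes> v \<otimes> z \<in> B j" using B_conj by meson
  have "\<bar>pairing f (inv x \<otimes> w) - pairing f w\<bar> \<le> c * e"
    if f: "test f" and supp: "supp_in n f" and c: "\<And>x. x \<in> carrier G \<Longrightarrow> \<bar>f x\<bar> \<le> c"
      and x: "x \<in> B i" and w: "w \<in> carrier G" for f c x w
  proof -
    have xc: "x \<in> carrier G" using x B_carrier by blast
    have c0: "0 \<le> c" using c[OF one_closed] by linarith
    have xw: "inv x \<otimes> w \<in> carrier G" using xc w by simp
    have "\<bar>f y * tr (inv x \<otimes> w) \<theta> y - f y * tr w \<theta> y\<bar> \<le> c * d * \<eta> y" if y: "y \<in> carrier G" for y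
    proof (cases "y \<in> B n")
      case True
      \<comment> \<open>Left translation by \<open>x\<close> acts on the argument of
        \<open>\<theta>\<close> as right translation by a conjugate of \<open>x\<close>, which is
        small by the choice of \<open>i\<close>; right uniformity of \<open>\<theta>\<close> then
        applies.\<close>
      have "inv (inv x \<otimes> w) \<otimes> y = (inv w \<otimes> y) \<otimes> (inv y \<otimes> x \<otimes> y)"
      proof -
        have "(inv w \<otimes> y) \<otimes> (inv y \<otimes> x \<otimes> y) = inv w \<otimes> (y \<otimes> inv y) \<otimes> x \<otimes> y"
          using xc w y by (simp only: inv_closed m_assoc m_closed)
        then show ?thesis using xc w y by (simp add: inv_mult_group m_assoc)
      qed
      then have "\<bar>tr (inv x \<otimes> w) \<theta> y - tr w \<theta> y\<bar> \<le> d"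
        using j[of "inv w \<otimes> y" "inv y \<otimes> x \<otimes> y"] i[OF True x] w y by (simp add: tr_def)
      then have "\<bar>f y\<bar> * \<bar>tr (inv x \<otimes> w) \<theta> y - tr w \<theta> y\<bar> \<le> c * d"
        using c[OF y] c0 by (intro mult_mono) auto
      also have "c * d * 1 \<le> c * d * \<eta> y" using c0 d xs(3)[OF True] by (intro mult_left_mono) (auto simp: \<eta>_def)
      finally show ?thesis by (simp add: right_diff_distrib[symmetric] abs_mult)
    next
      case False
      then show ?thesis using supp y c0 d xs(2)[OF y] by (simp add: supp_in_def \<eta>_def)
    qed
    then have "\<bar>I (\<lambda>y. f y * tr (inv x \<otimes> w) \<theta> y - f y * tr w \<theta> y)\<bar> \<le> c * d * I \<eta>"
      by (intro I_abs_le \<eta> test_diff pairing_test f w xw)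
    also have "\<dots> \<le> c * e" using mult_left_mono[OF d(2) c0] by (simp add: mult.assoc)
    finally show ?thesis
      unfolding pairing_def using I_diff[OF pairing_test[OF f xw] pairing_test[OF f w]] by simp
  qed
  then show ?thesis by blast
qed

end

section \<open>The scales \<open>M k\<close> and the rescaled first differences\<close>

context self_similar_haar begin

definition M :: "nat \<Rightarrow> nat"
  where "M k = (GREATEST m. set_power (B (- int k)) m \<subseteq> B 0)"

text \<open>A power long enough to contain \<open>B 1\<close> is not inside \<open>B 0\<close>.
  Without such a bound the \<open>GREATEST\<close> in \<open>M\<close> would be unspecified.\<close>

lemma M_bounded: "\<exists>N. \<forall>m. set_power (B (- int k)) m \<subseteq> B 0 \<longrightarrow> m \<le> N"
proof -
  obtain N where N: "B 1 \<subseteq> set_power (B (- int k)) N" by (rule generated_general)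
  have "m \<le> N" if "set_power (B (- int k)) m \<subseteq> B 0" for m
  proof (rule ccontr)
    assume "\<not> m \<le> N"
    then have "set_power (B (- int k)) N \<subseteq> set_power (B (- int k)) m"
      by (intro set_power_mono_exp B_sub B_one) simp
    with N that B1_not_B0 show False by simp
  qed
  then show ?thesis by blast
qed

lemma M_power: "set_power (B (- int k)) (M k) \<subseteq> B 0"
proof -
  obtain N where N: "\<forall>m. set_power (B (- int k)) m \<subseteq> B 0 \<longrightarrow> m \<le> N" using M_bounded by blast
  have "set_power (B (- int k)) 0 \<subseteq> B 0" using B_one by simp
  then show ?thesis unfolding M_def by (rule GreatestI_nat) (use N in blast)
qed

lemma M_ge: "set_power (B (- int k)) m \<subseteq> B 0 \<Longrightarrow> m \<le> M k"
proof -
  obtain N where N: "\<forall>m. set_power (B (- int k)) m \<subseteq> B 0 \<longrightarrow> m \<le> N" using M_bounded by blast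
  assume "set_power (B (- int k)) m \<subseteq> B 0"
  then show ?thesis unfolding M_def by (rule Greatest_le_nat) (use N in blast)
qed

lemma M_pos: "1 \<le> M k"
  using set_power_one[OF B_sub, of "- int k"] B_mono[of "- int k" 0] by (intro M_ge) simp

text \<open>Elements of \<open>B (- int k)\<close> are products of \<open>L\<close> elements of the
  finer ball. If the finer scale allowed \<open>L * (M k + 1)\<close> factors inside
  \<open>B 0\<close>, the coarser one would allow \<open>M k + 1\<close>, against
  maximality.\<close>

lemma M_growth: "\<exists>L>0. \<forall>k. M (k + t) < L * (M k + 1)"
proof -
  obtain L where L: "L > 0" "\<forall>m. B (m + int t) \<subseteq> set_power (B m) L"
    using generated_power[of t] by (elim exE conjE)
  have "M (k + t) < L * (M k + 1)" for k
  proof (rule ccontr)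
    assume "\<not> M (k + t) < L * (M k + 1)"
    then have le: "L * (M k + 1) \<le> M (k + t)" by simp
    have "B (- int k) \<subseteq> set_power (B (- int (k + t))) L"
      using L(2)[rule_format, of "- int (k + t)"] by simp
    then have "set_power (B (- int k)) (M k + 1) \<subseteq> set_power (B (- int (k + t))) (L * (M k + 1))"
      by (rule set_power_refine[OF B_sub])
    also have "\<dots> \<subseteq> set_power (B (- int (k + t))) (M (k + t))"
      by (rule set_power_mono_exp[OF B_sub B_one le])
    also have "\<dots> \<subseteq> B 0" by (rule M_power)
    finally show False using M_ge[of k "M k + 1"] by simp
  qed
  with L(1) show ?thesis by blast
qed

text \<open>Maximality of \<open>M (k + t)\<close>, transported by \<open>iter t\<close>, which
  takes scale \<open>k\<close> to scale \<open>k + t\<close> and \<open>B (int t)\<close> to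
  \<open>B 0\<close>.\<close>

lemma M_escape: "\<not> set_power (B (- int k)) (M (k + t) + 1) \<subseteq> B (int t)"
proof
  assume a: "set_power (B (- int k)) (M (k + t) + 1) \<subseteq> B (int t)"
  have "x \<in> B 0" if x: "x \<in> set_power (B (- int (k + t))) (M (k + t) + 1)" for x
  proof -
    have "x \<in> carrier G" using x set_power_carrier[OF B_sub] by blast
    then obtain y where y: "y \<in> carrier G" "iter t y = x" by (rule iter_surj)
    have "y \<in> set_power (B (- int k)) (M (k + t) + 1)"
      using iter_set_power[OF y(1), of t "- int k" "M (k + t) + 1"] y(2) x by (simp add: algebra_simps)
    then have "y \<in> B (int t)" using a by blast
    then show ?thesis using iter_B[OF y(1), of t "int t"] y(2) by simp
  qed
  then have "M (k + t) + 1 \<le> M (k + t)" by (intro M_ge) blast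
  then show False by simp
qed

definition psik :: "nat \<Rightarrow> 'a \<Rightarrow> real" where "psik k = psi (M k) k"
definition phi :: "nat \<Rightarrow> 'a \<Rightarrow> real" where "phi k w = pairing (psik k) w"
definition C0 :: real where "C0 = K * I \<theta>"

lemma C0_nonneg: "0 \<le> C0"
  using K_pos I_pos[OF bump_theta] by (simp add: C0_def)

lemma test_psik: "test (psik k)"
  unfolding psik_def by (rule test_psi[OF M_pos M_power])

lemma phi_supp: assumes "w \<in> carrier G" "w \<notin> B (s + s)" shows "phi k w = 0"
proof -
  have "phi k w = I (\<lambda>_. 0)"
    unfolding phi_def pairing_def
  proof (rule I_cong[OF pairing_test[OF test_psik assms(1)] test_zero])
    fix y assume y: "y \<in> carrier G"
    show "psik k y * tr w \<theta> y = 0"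
    proof (rule ccontr)
      assume a: "psik k y * tr w \<theta> y \<noteq> 0"
      have "y \<in> B s" using a y psi_supp[OF M_pos[of k] M_power] by (auto simp: psik_def supp_in_def)
      moreover have "inv w \<otimes> y \<in> B 0" using a y assms(1) supp_theta by (auto simp: tr_def supp_in_def)
      then have "inv (inv w \<otimes> y) \<in> B s" using B_inv B_mono[OF s_nonneg] by blast
      ultimately have "y \<otimes> inv (inv w \<otimes> y) \<in> B (s + s)" by (rule B_mult)
      moreover have "y \<otimes> inv (inv w \<otimes> y) = w"
        using y assms(1) by (simp add: inv_mult_group m_assoc[symmetric])
      ultimately show False using assms(2) by simp
    qed
  qed
  then show ?thesis using I_scale[OF test_zero, of 0] by simp
qed

lemma phi_one: "I (\<lambda>x. \<theta> x * \<theta> x) \<le> phi k \<one>"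
  unfolding phi_def pairing_def
proof (rule I_mono)
  fix x assume x: "x \<in> carrier G"
  show "\<theta> x * \<theta> x \<le> psik k x * tr \<one> \<theta> x"
    using psi_ge_theta[OF M_pos[of k] M_power x] theta_nonneg[OF x] x
    by (simp add: psik_def tr_def mult_right_mono)
qed (auto intro!: test_mult test_theta test_psik test_tr)

lemma telescope:
  fixes f :: "'a \<Rightarrow> real"
  assumes A: "A \<subseteq> carrier G" and "p \<in> set_power A N"
    and le: "\<And>q w. q \<in> A \<Longrightarrow> w \<in> carrier G \<Longrightarrow> \<bar>f (q \<otimes> w) - f w\<bar> \<le> d"
  shows "\<bar>f p - f \<one>\<bar> \<le> real N * d"
  using assms(2)
proof (induction N arbitrary: p)
  case (Suc N)
  then obtain a b where ab: "p = a \<otimes> b" "a \<in> A" "b \<in> set_power A N" by auto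
  have "b \<in> carrier G" using ab set_power_carrier[OF A] by blast
  then have "\<bar>f p - f b\<bar> \<le> d" using le ab by simp
  moreover have "\<bar>f b - f \<one>\<bar> \<le> real N * d" using Suc.IH ab by simp
  moreover have "real (Suc N) * d = real N * d + d" by (simp add: algebra_simps)
  ultimately show ?case by linarith
qed simp

text \<open>Comparing the scale \<open>k\<close> with the scale \<open>k + t\<close> shows that \<^term>\<open>phi k\<close>, whose total
  variation along a chain of about \<^term>\<open>M k\<close> steps is bounded below, really moves by a multiple
  of \<open>1 / M k\<close> in some step.\<close>

lemma phi_moves:
  obtains c where "c > 0"
    "\<forall>k. \<exists>q\<in>B (- int k). \<exists>w\<in>carrier G. c / M k \<le> \<bar>phi k (inv q \<otimes> w) - phi k w\<bar>"
proof -
  \<comment> \<open>Leaving \<open>B (int t)\<close> means leaving \<open>B (s + s)\<close>, outside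
    which \<open>phi k\<close> vanishes.\<close>
  define t where "t = nat (s + s)"
  obtain L where L: "L > 0" "\<forall>k. M (k + t) < L * (M k + 1)" using M_growth[of t] by blast
  define c1 where "c1 = I (\<lambda>x. \<theta> x * \<theta> x)"
  have "bump (\<lambda>x. \<theta> x * \<theta> x)"
    using bump_theta test_mult[OF test_theta test_theta] by (simp add: bump_def)
  then have c1: "c1 > 0" unfolding c1_def by (rule I_pos)
  \<comment> \<open>A chain of at most \<open>2 * L * M k\<close> steps, each changing
    \<open>phi k\<close> by at most \<open>c / M k\<close>, changes it by at most
    \<open>c1 / 2\<close> in total, too little to fall from at least \<open>c1\<close> to 0.\<close>
  define c where "c = c1 / (4 * real L)"
  have c: "c > 0" using c1 L by (simp add: c_def)
  have "\<exists>q\<in>B (- int k). \<exists>w\<in>carrier G. c / M k \<le> \<bar>phi k (inv q \<otimes> w) - phi k w\<bar>" for k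
  proof (rule ccontr)
    assume neg: "\<not> ?thesis"
    obtain p where p: "p \<in> set_power (B (- int k)) (M (k + t) + 1)" "p \<notin> B (int t)"
      using M_escape[of k t] by blast
    have pc: "p \<in> carrier G" using p set_power_carrier[OF B_sub] by blast
    have "\<bar>phi k p - phi k \<one>\<bar> \<le> real (M (k + t) + 1) * (c / M k)"
    proof (rule telescope[OF B_sub p(1)])
      fix q w assume q: "q \<in> B (- int k)" and w: "w \<in> carrier G"
      have "\<not> c / M k \<le> \<bar>phi k (inv (inv q) \<otimes> w) - phi k w\<bar>" using neg B_inv[OF q] w by blast
      then show "\<bar>phi k (q \<otimes> w) - phi k w\<bar> \<le> c / M k" using B_carrier[OF q] by simp
    qed
    moreover have "p \<notin> B (s + s)" using p(2) s_nonneg by (simp add: t_def)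
    then have "phi k p = 0" using phi_supp pc by simp
    ultimately have "c1 \<le> real (M (k + t) + 1) * (c / M k)"
      using phi_one[of k] by (simp add: c1_def)
    also have "\<dots> \<le> real (2 * L * M k) * (c / M k)"
    proof (rule mult_right_mono)
      have "M (k + t) + 1 \<le> L * (M k + 1)" using L(2)[rule_format, of k] by simp
      also have "\<dots> \<le> L * (2 * M k)" using M_pos[of k] by (intro mult_le_mono2) simp
      finally show "real (M (k + t) + 1) \<le> real (2 * L * M k)" by (simp only: of_nat_le_iff mult_ac)
    qed (use c in simp)
    also have "\<dots> = c1 / 2" using L(1) M_pos[of k] by (simp add: c_def)
    finally show False using c1 by simp
  qed
  then show ?thesis by (intro that[OF c] allI)
qed

text \<open>The first difference of \<open>phi k\<close>, transported to the fixed group by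
  \<open>iter k\<close>. The base points \<open>w k\<close> are left free so that they can be placed
  later where \<open>phi k\<close> really moves.\<close>

definition lam :: "(nat \<Rightarrow> 'a) \<Rightarrow> nat \<Rightarrow> 'a \<Rightarrow> real"
  where "lam w k x = real (M k) * (phi k (inv (iter k x) \<otimes> w k) - phi k (w k))"

lemma phi_difference:
  assumes "h \<in> carrier G" "w \<in> carrier G"
  shows "phi k (inv h \<otimes> w) - phi k w = pairing (\<lambda>x. tr h (psik k) x - psik k x) w"
  using pairing_diff[OF test_tr[OF test_psik assms(1)] test_psik assms(2)] pairing_tr[OF test_psik assms]
  by (simp add: phi_def)

lemma iter_power:
  assumes "x \<in> set_power (B 0) p" shows "iter k x \<in> set_power (B (- int k)) p"
proof -
  have "x \<in> carrier G" using assms set_power_carrier[OF B_sub] by blast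
  then show ?thesis using iter_set_power[of x k 0 p] assms by simp
qed

lemma psik_steps:
  assumes "x \<in> set_power (B 0) p" "y \<in> carrier G"
  shows "\<bar>tr (iter k x) (psik k) y - psik k y\<bar> \<le> real p * (K / M k)"
  unfolding psik_def by (rule psi_steps[OF M_pos M_power iter_power[OF assms(1)] assms(2)])

text \<open>The factor \<open>M k\<close> cancels the Lipschitz constant \<open>K / M k\<close> of
  \<open>psik k\<close>, which leaves a bound independent of \<open>k\<close> and of the base
  points.\<close>

lemma lam_le:
  assumes w: "\<And>k. w k \<in> carrier G" and x: "x \<in> set_power (B 0) p"
  shows "\<bar>lam w k x\<bar> \<le> real p * C0"
proof -
  have "x \<in> carrier G" using x set_power_carrier[OF B_sub] by blast
  then have c: "iter k x \<in> carrier G" by simp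
  have "\<bar>pairing (\<lambda>y. tr (iter k x) (psik k) y - psik k y) (w k)\<bar> \<le> real p * (K / M k) * I \<theta>"
    by (intro pairing_le test_diff test_tr test_psik c w psik_steps x)
  note le = this
  have "\<bar>lam w k x\<bar> = M k * \<bar>pairing (\<lambda>y. tr (iter k x) (psik k) y - psik k y) (w k)\<bar>"
    unfolding lam_def phi_difference[OF c w] by (simp add: abs_mult)
  also have "\<dots> \<le> M k * (real p * (K / M k) * I \<theta>)"
    by (rule mult_left_mono[OF le]) simp
  also have "\<dots> = real p * C0" using M_pos[of k] by (simp add: C0_def)
  finally show ?thesis .
qed

text \<open>The failure of additivity is a second difference of \<^term>\<open>phi k\<close>. One difference falls on
  \<^term>\<open>psik k\<close> and costs \<open>1 / M k\<close>; moving the other one across the convolution puts it,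
  conjugated by elements of a bounded set, on the fixed function \<^term>\<open>\<theta>\<close>, where it tends
  to \<open>0\<close>.\<close>

lemma lam_almost_additive:
  assumes w: "\<And>k. w k \<in> carrier G" and "e > 0"
  shows "\<exists>k0. \<forall>k\<ge>k0. \<forall>x\<in>B n. \<forall>y\<in>B n. \<bar>lam w k (x \<otimes> y) - lam w k x - lam w k y\<bar> \<le> e"
proof -
  obtain p where p: "p > 0" "B n \<subseteq> set_power (B 0) p" by (rule generated_general)
  \<comment> \<open>The difference of \<open>psik k\<close> along y is bounded by
    \<open>p * K / M k\<close>; multiplied by \<open>d\<close> and by the factor \<open>M k\<close>
    of \<open>lam\<close> this gives exactly \<open>e\<close>.\<close>
  define d where "d = e / (real p * K)"
  have d: "d > 0" using \<open>e > 0\<close> p K_pos by (simp add: d_def)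
  obtain i where i: "\<forall>f c x w. test f \<longrightarrow> supp_in (s + s) f \<longrightarrow> (\<forall>x\<in>carrier G. \<bar>f x\<bar> \<le> c) \<longrightarrow>
      x \<in> B i \<longrightarrow> w \<in> carrier G \<longrightarrow> \<bar>pairing f (inv x \<otimes> w) - pairing f w\<bar> \<le> c * d"
    using pairing_uniform[OF d, of "s + s"] by (rule exE)
  have "\<bar>lam w k (x \<otimes> y) - lam w k x - lam w k y\<bar> \<le> e"
    \<comment> \<open>The bound \<open>n - i\<close> brings \<open>iter k x\<close> into
      \<open>B i\<close>, and the bound \<open>n\<close> brings \<open>iter k y\<close> into
      \<open>B 0\<close>, which controls the support of the translated
      \<open>psik k\<close>.\<close>
    if k: "k \<ge> nat (max n (n - i))" and x: "x \<in> B n" and y: "y \<in> B n" for k x y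
  proof -
    define g h where "g = iter k x" "h = iter k y"
    have xy: "x \<in> carrier G" "y \<in> carrier G" using x y B_carrier by blast+
    have gh: "g \<in> carrier G" "h \<in> carrier G" using xy by (auto simp: g_h_def)
    have ghB: "g \<in> B (n - int k)" "h \<in> B (n - int k)" using iter_B xy x y by (auto simp: g_h_def)
    have "B (n - int k) \<subseteq> B i" using k by (intro B_mono) auto
    then have gi: "g \<in> B i" using ghB by blast
    have "B (n - int k) \<subseteq> B 0" using k by (intro B_mono) auto
    then have h0: "h \<in> B 0" using ghB by blast
    define f where "f = (\<lambda>x. tr h (psik k) x - psik k x)"
    have psup: "supp_in s (psik k)" unfolding psik_def by (rule psi_supp[OF M_pos M_power])
    have "supp_in (s + s) (tr h (psik k))" by (rule supp_in_tr[OF psup h0]) (use s_nonneg in auto)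
    moreover have "supp_in (s + s) (psik k)" by (rule supp_in_mono[OF psup]) (use s_nonneg in auto)
    ultimately have fs: "supp_in (s + s) f" by (simp add: supp_in_def f_def)
    have ft: "test f" unfolding f_def by (intro test_diff test_tr test_psik gh)
    have "\<bar>pairing f (inv g \<otimes> w k) - pairing f (w k)\<bar> \<le> real p * (K / M k) * d"
    proof (rule i[rule_format, OF ft fs _ gi w])
      fix z assume "z \<in> carrier G"
      moreover have "y \<in> set_power (B 0) p" using p(2) y by blast
      ultimately show "\<bar>f z\<bar> \<le> real p * (K / M k)" unfolding f_def g_h_def by (intro psik_steps)
    qed
    moreover have "pairing f (inv g \<otimes> w k) = phi k (inv h \<otimes> (inv g \<otimes> w k)) - phi k (inv g \<otimes> w k)"
      unfolding f_def using gh w by (intro phi_difference[symmetric]) auto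
    moreover have "pairing f (w k) = phi k (inv h \<otimes> w k) - phi k (w k)"
      unfolding f_def using gh w by (intro phi_difference[symmetric]) auto
    moreover have "inv (iter k (x \<otimes> y)) \<otimes> w k = inv h \<otimes> (inv g \<otimes> w k)"
      using gh xy w[of k] iter_mult[OF xy, of k] by (simp add: g_h_def inv_mult_group m_assoc)
    then have "lam w k (x \<otimes> y) - lam w k x - lam w k y = M k * 
        ((phi k (inv h \<otimes> (inv g \<otimes> w k)) - phi k (inv g \<otimes> w k)) - (phi k (inv h \<otimes> w k) - phi k (w k)))"
      by (simp add: lam_def g_h_def algebra_simps)
    ultimately have "\<bar>lam w k (x \<otimes> y) - lam w k x - lam w k y\<bar> =
        M k * \<bar>pairing f (inv g \<otimes> w k) - pairing f (w k)\<bar>"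
      and le: "\<bar>pairing f (inv g \<otimes> w k) - pairing f (w k)\<bar> \<le> real p * (K / M k) * d"
      by (simp_all only: abs_mult abs_of_nat)
    note this(1)
    also have "M k * \<bar>pairing f (inv g \<otimes> w k) - pairing f (w k)\<bar> \<le> M k * (real p * (K / M k) * d)"
      by (rule mult_left_mono[OF le]) simp
    also have "\<dots> = e" using M_pos[of k] K_pos p by (simp add: d_def)
    finally show ?thesis .
  qed
  then show ?thesis by (intro exI[of _ "nat (max n (n - i))"]) blast
qed

lemma pow_in_B0: "\<exists>m. \<forall>x\<in>B m. \<forall>i\<le>n. x [^] (i :: nat) \<in> B 0"
proof -
  have "x [^] i \<in> B 0" if x: "x \<in> B (- (s * int n))" and i: "i \<le> n" for x i
  proof -
    have "x [^] i \<in> set_power (B (- (s * int n))) i" for i :: nat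
    proof (induction i)
      case (Suc i)
      have "x [^] Suc i = x \<otimes> x [^] i" by (rule nat_pow_Suc2[OF B_carrier[OF x]])
      then show ?case using Suc x by auto
    qed simp
    then have "x [^] i \<in> B (- (s * int n) + s * int i)" using set_power_ball by blast
    moreover have "s * int i \<le> s * int n" using i s_nonneg by (intro mult_left_mono) auto
    ultimately show ?thesis using B_mono[of "- (s * int n) + s * int i" 0] by auto
  qed
  then show ?thesis by blast
qed

text \<open>If the first \<open>n\<close> powers of \<open>x\<close> stay in \<open>B 0\<close>,
  then \<open>lam\<close> at \<open>x [^] n\<close> is bounded by \<open>C0\<close> and differs from
  \<open>n\<close> times its value at \<open>x\<close> by at most \<open>n * e / 2\<close>. With
  \<open>n\<close> large the value at \<open>x\<close> is at most \<open>e\<close>, for all large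
  \<open>k\<close> at once.\<close>

lemma lam_small:
  assumes w: "\<And>k. w k \<in> carrier G" and "e > 0"
  shows "\<exists>m k0. \<forall>k\<ge>k0. \<forall>x\<in>B m. \<bar>lam w k x\<bar> \<le> e"
proof -
  obtain n where n: "C0 / (e / 2) < real n" using reals_Archimedean2 by blast
  have "0 \<le> C0 / (e / 2)" using C0_nonneg \<open>e > 0\<close> by simp
  with n have n0: "n > 0" by linarith
  obtain m where m: "\<forall>x\<in>B m. \<forall>i\<le>n. x [^] (i :: nat) \<in> B 0" using pow_in_B0 by blast
  obtain k0 where k0: "\<forall>k\<ge>k0. \<forall>x\<in>B 0. \<forall>y\<in>B 0. \<bar>lam w k (x \<otimes> y) - lam w k x - lam w k y\<bar> \<le> e / 2"
    using lam_almost_additive[where w = w and e = "e / 2" and n = 0, OF w] \<open>e > 0\<close> by auto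
  have "\<bar>lam w k x\<bar> \<le> e" if k: "k \<ge> k0" and x: "x \<in> B m" for k x
  proof -
    have xc: "x \<in> carrier G" using x B_carrier by blast
    have "x [^] Suc 0 \<in> B 0" using bspec[OF m x, rule_format, of "Suc 0"] n0 by (simp only: Suc_le_eq)
    moreover have "x [^] Suc 0 = x" using xc by (simp only: nat_pow_Suc nat_pow_0 l_one)
    ultimately have x1: "x \<in> B 0" by simp
    have "\<bar>lam w k (x [^] i) - real i * lam w k x\<bar> \<le> real i * (e / 2)" if "i \<le> n" for i
      using that
    proof (induction i)
      case 0
      have "lam w k \<one> = 0" using w[of k] by (simp add: lam_def iter_one)
      then show ?case by simp
    next
      case (Suc i)
      have "x [^] i \<in> B 0" using m x Suc.prems by simp
      then have "\<bar>lam w k (x [^] i \<otimes> x) - lam w k (x [^] i) - lam w k x\<bar> \<le> e / 2" using k0 k x1 by blast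
      moreover have "real (Suc i) * lam w k x = real i * lam w k x + lam w k x"
        "real (Suc i) * (e / 2) = real i * (e / 2) + e / 2" by (simp_all add: algebra_simps)
      ultimately show ?case using Suc by (simp only: nat_pow_Suc) linarith
    qed
    from this[of n] have a: "\<bar>lam w k (x [^] n) - real n * lam w k x\<bar> \<le> real n * (e / 2)" by simp
    have "x [^] n \<in> set_power (B 0) 1" using m x set_power_one[OF B_sub, of 0] by simp
    from lam_le[where w = w, OF w this, of k] have "\<bar>lam w k (x [^] n)\<bar> \<le> C0" by simp
    also have "C0 \<le> real n * (e / 2)" using n \<open>e > 0\<close> by (simp add: field_simps)
    finally have b: "\<bar>lam w k (x [^] n)\<bar> \<le> real n * (e / 2)" .
    have "real n * \<bar>lam w k x\<bar> = \<bar>real n * lam w k x\<bar>" by (simp add: abs_mult)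
    then have "real n * \<bar>lam w k x\<bar> \<le> real n * (e / 2) + real n * (e / 2)"
      using a b by linarith
    then have "real n * \<bar>lam w k x\<bar> \<le> real n * e" by (simp add: algebra_simps)
    then show ?thesis using n0 by simp
  qed
  then show ?thesis by blast
qed

lemma real_hom_exists_haar:
  "\<exists>l :: 'a \<Rightarrow> real. (\<forall>x\<in>carrier G. \<forall>y\<in>carrier G. l (x \<otimes> y) = l x + l y) \<and>
     (\<exists>C. \<forall>x\<in>B 0. \<bar>l x\<bar> \<le> C) \<and> (\<exists>x\<in>carrier G. l x \<noteq> 0)"
proof -
  obtain c where c: "c > 0"
    "\<forall>k. \<exists>q\<in>B (- int k). \<exists>w\<in>carrier G. c / M k \<le> \<bar>phi k (inv q \<otimes> w) - phi k w\<bar>"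
    by (rule phi_moves)
  have "\<exists>q w. q \<in> B (- int k) \<and> w \<in> carrier G \<and> c / M k \<le> \<bar>phi k (inv q \<otimes> w) - phi k w\<bar>" for k
    using c(2) by blast
  then obtain q w where qw: "\<And>k. q k \<in> B (- int k)" "\<And>k. w k \<in> carrier G"
      "\<And>k. c / M k \<le> \<bar>phi k (inv (q k) \<otimes> w k) - phi k (w k)\<bar>"
    by metis
  note w = qw(2)
  \<comment> \<open>Pulled back by \<open>iter k\<close>, the step on which \<open>phi k\<close>
    moves becomes a point of \<open>B 0\<close>; it depends on \<open>k\<close>.\<close>
  have big: "\<exists>x\<in>B 0. c \<le> \<bar>lam w k x\<bar>" for k
  proof -
    obtain x where x: "x \<in> carrier G" "iter k x = q k" using iter_surj[OF B_carrier[OF qw(1)]] by blast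
    have "x \<in> B 0" using iter_B[OF x(1), of k 0] x(2) qw(1)[of k] by simp
    moreover have "c \<le> \<bar>lam w k x\<bar>"
      using qw(3)[of k] M_pos[of k] by (simp add: lam_def x(2) abs_mult pos_divide_le_eq mult.commute)
    ultimately show ?thesis by blast
  qed
  obtain F where F: "F \<noteq> bot" "F \<le> sequentially" "\<And>x :: nat \<Rightarrow> real. Bseq x \<Longrightarrow> (x \<longlongrightarrow> Lim F x) F"
    using generalized_limit_filter by blast
  have ev: "eventually P F" if "\<And>k. k \<ge> N \<Longrightarrow> P k" for P and N :: nat
    using that F(2) eventually_sequentially filter_leD by blast
  define l where "l = (\<lambda>x. Lim F (\<lambda>k. lam w k x))"
  have lim: "((\<lambda>k. lam w k x) \<longlongrightarrow> l x) F" if "x \<in> carrier G" for x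
    unfolding l_def
  proof (rule F(3))
    obtain n where "x \<in> B n" using B_exhaust[OF \<open>x \<in> carrier G\<close>] ..
    moreover obtain p where "B n \<subseteq> set_power (B 0) p" by (rule generated_general)
    ultimately have "x \<in> set_power (B 0) p" by blast
    from lam_le[where w = w, OF w this] show "Bseq (\<lambda>k. lam w k x)" by (intro BseqI'[of _ "real p * C0"]) simp
  qed
  have hom: "l (x \<otimes> y) = l x + l y" if x: "x \<in> carrier G" and y: "y \<in> carrier G" for x y
  proof -
    obtain n1 n2 where "x \<in> B n1" "y \<in> B n2" using B_exhaust x y by meson
    then have n: "x \<in> B (max n1 n2)" "y \<in> B (max n1 n2)" using B_mono by (meson max.cobounded1 max.cobounded2 subsetD)+
    have lim2: "((\<lambda>k. \<bar>lam w k (x \<otimes> y) - lam w k x - lam w k y\<bar>) \<longlongrightarrow> \<bar>l (x \<otimes> y) - l x - l y\<bar>) F"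
      by (intro tendsto_intros lim) (use x y in auto)
    have "\<bar>l (x \<otimes> y) - l x - l y\<bar> \<le> 0 + e" if "e > 0" for e
    proof -
      obtain k0 where "\<forall>k\<ge>k0. \<forall>x\<in>B (max n1 n2). \<forall>y\<in>B (max n1 n2). \<bar>lam w k (x \<otimes> y) - lam w k x - lam w k y\<bar> \<le> e"
        using lam_almost_additive[where w = w, OF w \<open>e > 0\<close>] by blast
      then have "eventually (\<lambda>k. \<bar>lam w k (x \<otimes> y) - lam w k x - lam w k y\<bar> \<le> e) F"
        using n by (intro ev[of k0]) blast
      then show ?thesis using tendsto_upperbound[OF lim2 _ F(1)] by simp
    qed
    then have "\<bar>l (x \<otimes> y) - l x - l y\<bar> \<le> 0" by (rule field_le_epsilon)
    then show ?thesis by simp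
  qed
  have bdd: "\<bar>l x\<bar> \<le> C0" if x: "x \<in> B 0" for x
  proof -
    have "x \<in> set_power (B 0) 1" using x set_power_one[OF B_sub, of 0] by simp
    from lam_le[where w = w, OF w this] have "\<bar>lam w k x\<bar> \<le> C0" for k by simp
    then show ?thesis
      using tendsto_upperbound[OF tendsto_rabs[OF lim[OF B_carrier[OF x]]] _ F(1), of C0] by simp
  qed
  \<comment> \<open>The point at which \<open>lam\<close> exceeds \<open>c\<close> varies with
    \<open>k\<close>, so pointwise convergence to 0 is not yet a contradiction. It is approximated
    by a point of a fixed finite net; the value at the net point, the value at the small remainder
    and the additivity defect are each at most \<open>c / 4\<close>.\<close>
  have "\<exists>x\<in>carrier G. l x \<noteq> 0"
  proof (rule ccontr)
    assume "\<not> (\<exists>x\<in>carrier G. l x \<noteq> 0)"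
    then have l0: "l x = 0" if "x \<in> carrier G" for x using that by blast
    have quarter: "0 < c / 4" using c(1) by simp
    obtain m k1 where mk: "\<forall>k\<ge>k1. \<forall>x\<in>B m. \<bar>lam w k x\<bar> \<le> c / 4"
      using lam_small[where w = w and e = "c / 4", OF w quarter] by (elim exE)
    \<comment> \<open>The bound \<open>m\<close> makes the remainder small for \<open>lam\<close>;
      the bounds 0 and \<open>s\<close> place the net point and the remainder in \<open>B s\<close>,
      where the additivity estimate is available.\<close>
    define m' where "m' = min m 0"
    have "m' \<le> m" "m' \<le> 0" "m' \<le> s" using s_nonneg by (auto simp: m'_def)
    then have m': "B m' \<subseteq> B m" "B m' \<subseteq> B 0" "B m' \<subseteq> B s" by (simp_all add: B_mono)
    obtain S where S: "finite S" "S \<subseteq> carrier G" "\<forall>x\<in>B 0. \<exists>t\<in>S. inv t \<otimes> x \<in> B m'"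
      using B_totally_bounded[of 0 m'] by blast
    obtain k2 where k2: "\<forall>k\<ge>k2. \<forall>x\<in>B s. \<forall>y\<in>B s. \<bar>lam w k (x \<otimes> y) - lam w k x - lam w k y\<bar> \<le> c / 4"
      using lam_almost_additive[where w = w and e = "c / 4" and n = s, OF w quarter] by (elim exE)
    have "eventually (\<lambda>k. \<forall>t\<in>S. \<bar>lam w k t\<bar> < c / 4) F"
    proof (rule eventually_ball_finite[OF S(1)], rule ballI)
      fix t assume "t \<in> S"
      then have "t \<in> carrier G" using S by blast
      from lim[OF this] l0[OF this] have "((\<lambda>k. lam w k t) \<longlongrightarrow> 0) F" by simp
      then show "eventually (\<lambda>k. \<bar>lam w k t\<bar> < c / 4) F"
        using c(1) by (auto simp: tendsto_iff dist_real_def dest!: spec[of _ "c / 4"])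
    qed
    moreover have "eventually (\<lambda>k. k \<ge> max k1 k2) F" by (rule ev)
    ultimately have "eventually (\<lambda>k. (\<forall>t\<in>S. \<bar>lam w k t\<bar> < c / 4) \<and> k \<ge> max k1 k2) F"
      by (rule eventually_conj)
    then obtain k where k: "\<forall>t\<in>S. \<bar>lam w k t\<bar> < c / 4" "k \<ge> max k1 k2"
      using F(1) eventually_happens' by blast
    obtain x where x: "x \<in> B 0" "c \<le> \<bar>lam w k x\<bar>" using big by blast
    obtain t where t: "t \<in> S" "inv t \<otimes> x \<in> B m'" using S(3) x(1) by blast
    have tc: "t \<in> carrier G" using t S by blast
    have xc: "x \<in> carrier G" using x B_carrier by blast
    have "x \<otimes> inv (inv t \<otimes> x) \<in> B (0 + s)"
      using m'(2) t(2) by (intro B_mult x(1) B_inv) blast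
    moreover have "x \<otimes> inv (inv t \<otimes> x) = t" using tc xc by (simp add: inv_mult_group m_assoc[symmetric])
    ultimately have ts: "t \<in> B s" by simp
    have "inv t \<otimes> x \<in> B s" using t(2) m'(3) by blast
    then have "\<bar>lam w k (t \<otimes> (inv t \<otimes> x)) - lam w k t - lam w k (inv t \<otimes> x)\<bar> \<le> c / 4"
      using k2 k(2) ts by auto
    moreover have "t \<otimes> (inv t \<otimes> x) = x" using tc xc by (simp add: m_assoc[symmetric])
    ultimately have "\<bar>lam w k x - lam w k t - lam w k (inv t \<otimes> x)\<bar> \<le> c / 4" by (simp only:)
    moreover have "\<bar>lam w k (inv t \<otimes> x)\<bar> \<le> c / 4" using mk k(2) m'(1) t(2) by auto
    moreover have "\<bar>lam w k t\<bar> < c / 4" using k(1) t(1) by blast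
    ultimately show False using x(2) c(1) by linarith
  qed
  with hom bdd show ?thesis by blast
qed

end

theorem (in self_similar_group) real_hom_exists:
  obtains l :: "'a \<Rightarrow> real" and C where
    "\<And>x y. x \<in> carrier G \<Longrightarrow> y \<in> carrier G \<Longrightarrow> l (x \<otimes> y) = l x + l y"
    "\<And>x. x \<in> B 0 \<Longrightarrow> \<bar>l x\<bar> \<le> C"
    "\<exists>x\<in>carrier G. l x \<noteq> 0"
proof -
  obtain \<theta> where th: "bump \<theta>" "supp_in 0 \<theta>" using bump_exists by blast
  obtain K where K: "K > 0" "\<And>x. x \<in> carrier G \<Longrightarrow> \<bar>\<theta> x\<bar> \<le> K" using test_bound[OF bump_test[OF th(1)]] by blast
  obtain I where I: 
    "\<forall>f g. test f \<longrightarrow> test g \<longrightarrow> I (\<lambda>x. f x + g x) = I f + I g"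
    "\<forall>c f. test f \<longrightarrow> I (\<lambda>x. c * f x) = c * I f"
    "\<forall>f. test f \<longrightarrow> (\<forall>x\<in>carrier G. 0 \<le> f x) \<longrightarrow> 0 \<le> I f"
    "\<forall>t f. test f \<longrightarrow> t \<in> carrier G \<longrightarrow> I (tr t f) = I f"
    "\<forall>f. bump f \<longrightarrow> 0 < I f"
    using haar_integral[OF th(1)] by (elim exE conjE)
  interpret self_similar_haar G B s \<alpha> \<theta> I K
    using th K I by unfold_locales (auto simp: abs_le_iff)
  show ?thesis using real_hom_exists_haar that by blast
qed

section \<open>Eigenhomomorphisms\<close>

text \<open>The linear functional on polynomials that sends X^i to \<open>a i\<close>;
  multiplication by X becomes the shift of the sequence.\<close>

definition poly_pairing :: "(nat \<Rightarrow> complex) \<Rightarrow> complex poly \<Rightarrow> complex"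
  where "poly_pairing a p = (\<Sum>i\<le>degree p. coeff p i * a i)"

lemma poly_pairing_altdef:
  assumes "degree p \<le> n" shows "poly_pairing a p = (\<Sum>i\<le>n. coeff p i * a i)"
  unfolding poly_pairing_def using assms
  by (intro sum.mono_neutral_left) (auto simp: coeff_eq_0)

lemma poly_pairing_add: "poly_pairing a (p + q) = poly_pairing a p + poly_pairing a q"
proof -
  define n where "n = max (degree p) (degree q)"
  have "degree p \<le> n" "degree q \<le> n" "degree (p + q) \<le> n"
    by (auto simp: n_def degree_add_le_max)
  then show ?thesis by (simp add: poly_pairing_altdef sum.distrib[symmetric] algebra_simps)
qed

lemma poly_pairing_smult: "poly_pairing a (smult c p) = c * poly_pairing a p"
  by (subst poly_pairing_altdef[of _ "degree p"]) (auto simp: poly_pairing_def sum_distrib_left mult.assoc)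

lemma poly_pairing_shift: "poly_pairing a (pCons 0 p) = poly_pairing (\<lambda>i. a (Suc i)) p"
  by (subst poly_pairing_altdef[of _ "Suc (degree p)"])
     (auto simp: poly_pairing_def sum.atMost_Suc_shift degree_pCons_le simp del: sum.atMost_Suc)

text \<open>Two polynomials of different degrees that kill \<open>T\<close> have a combination that
  also kills \<open>a\<close>. The degree bound \<open>N\<close> lets the second be chosen of larger
  degree than the first, so the combination is nonzero.\<close>

lemma poly_pairing_kill:
  assumes "finite T"
  shows "\<exists>p. p \<noteq> 0 \<and> N \<le> degree p \<and> (\<forall>a\<in>T. poly_pairing a p = 0)"
  using assms
proof (induction T arbitrary: N rule: finite_induct)
  case empty
  show ?case by (intro exI[of _ "monom 1 N"]) (simp add: degree_monom_eq)
next
  case (insert a T)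
  obtain p where p: "p \<noteq> 0" "N \<le> degree p" "\<forall>a\<in>T. poly_pairing a p = 0" using insert.IH by blast
  obtain q where q: "q \<noteq> 0" "Suc (degree p) \<le> degree q" "\<forall>a\<in>T. poly_pairing a q = 0" using insert.IH by blast
  show ?case
  proof (cases "poly_pairing a p = 0")
    case True
    with p show ?thesis by blast
  next
    case False
    define r where "r = smult (poly_pairing a q) p + smult (- poly_pairing a p) q"
    have "degree (smult (poly_pairing a q) p) < degree (smult (- poly_pairing a p) q)"
      using False q(2) le_less_trans[OF degree_smult_le[of "poly_pairing a q" p], of "degree q"] by simp
    then have "degree r = degree (smult (- poly_pairing a p) q)"
      unfolding r_def by (rule degree_add_eq_right)
    then have "degree r = degree q" using False by simp
    then have "N \<le> degree r" "r \<noteq> 0" using p q by auto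
    moreover have "\<forall>b\<in>insert a T. poly_pairing b r = 0"
      using p q by (simp add: r_def poly_pairing_add poly_pairing_smult del: smult_minus_left)
    ultimately show ?thesis by blast
  qed
qed

context self_similar_group begin

definition complex_hom :: "('a \<Rightarrow> complex) \<Rightarrow> bool"
  where "complex_hom f \<longleftrightarrow> (\<forall>x\<in>carrier G. \<forall>y\<in>carrier G. f (x \<otimes> y) = f x + f y) \<and>
    (\<exists>C. \<forall>x\<in>B 0. norm (f x) \<le> C)"

lemma complex_hom_mult: "complex_hom f \<Longrightarrow> x \<in> carrier G \<Longrightarrow> y \<in> carrier G \<Longrightarrow> f (x \<otimes> y) = f x + f y"
  by (simp add: complex_hom_def)

lemma complex_hom_one: "complex_hom f \<Longrightarrow> f \<one> = 0"
  using complex_hom_mult[of f \<one> \<one>] by simp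

lemma complex_hom_inv: "complex_hom f \<Longrightarrow> x \<in> carrier G \<Longrightarrow> f (inv x) = - f x"
  using complex_hom_mult[of f "inv x" x] complex_hom_one[of f] by (simp add: eq_neg_iff_add_eq_0)

text \<open>Squaring raises the ball index by at most \<open>s\<close> and doubles the value of
  \<open>f\<close>.\<close>

lemma complex_hom_halve:
  assumes "complex_hom f" "\<And>x. x \<in> B 0 \<Longrightarrow> norm (f x) \<le> C" "x \<in> B (- (s * int n))"
  shows "norm (f x) \<le> C / 2 ^ n"
  using assms(3)
proof (induction n arbitrary: x)
  case (Suc n)
  have xc: "x \<in> carrier G" using Suc.prems B_carrier by blast
  have "x \<otimes> x \<in> B (- (s * int n))" using B_mult[OF Suc.prems Suc.prems] by (simp add: algebra_simps)
  from Suc.IH[OF this] have "norm (f x + f x) \<le> C / 2 ^ n"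
    using complex_hom_mult[OF assms(1) xc xc] by simp
  then show ?case by (simp add: mult_2[symmetric] norm_mult field_simps)
qed (use assms(2) in simp)

lemma complex_hom_continuous:
  assumes "complex_hom f" "e > 0" shows "\<exists>m. \<forall>x\<in>B m. norm (f x) \<le> e"
proof -
  obtain C where C: "\<And>x. x \<in> B 0 \<Longrightarrow> norm (f x) \<le> C" using assms(1) by (auto simp: complex_hom_def)
  obtain n where n: "C / e < 2 ^ n" using real_arch_pow[of 2 "C / e"] by auto
  have "norm (f x) \<le> e" if "x \<in> B (- (s * int n))" for x
  proof -
    have "norm (f x) \<le> C / 2 ^ n" using complex_hom_halve[OF assms(1) C that] .
    also have "\<dots> \<le> e" using n assms(2) by (simp add: field_simps)
    finally show ?thesis .
  qed
  then show ?thesis by blast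
qed

text \<open>Since \<open>\<bar>f\<bar>\<close> is at most half as large on \<open>B (- s)\<close> as on \<open>B 0\<close>, a bounded homomorphism is
  determined by its values on a finite set. Hence these homomorphisms form a finite-dimensional
  space.\<close>

lemma complex_hom_zero:
  assumes f: "complex_hom f" and S: "\<forall>x\<in>B 0. \<exists>t\<in>S. inv t \<otimes> x \<in> B (- s)" "S \<subseteq> carrier G"
    and 0: "\<And>t. t \<in> S \<Longrightarrow> f t = 0" and x: "x \<in> carrier G"
  shows "f x = 0"
proof -
  obtain C where C: "\<And>x. x \<in> B 0 \<Longrightarrow> norm (f x) \<le> C" using f by (auto simp: complex_hom_def)
  have le: "norm (f x) \<le> C / 2 ^ n" if "x \<in> B 0" for n x
    using that
  proof (induction n arbitrary: x)
    case (Suc n)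
    obtain t where t: "t \<in> S" "inv t \<otimes> x \<in> B (- s)" using S Suc.prems by blast
    have c: "t \<in> carrier G" "x \<in> carrier G" using t S Suc.prems B_carrier by blast+
    have "norm (f (inv t \<otimes> x)) \<le> C / 2 ^ n / 2 ^ 1"
      by (rule complex_hom_halve[OF f Suc.IH]) (use t in simp_all)
    moreover have "f (inv t \<otimes> x) = f x" 
      using complex_hom_mult[OF f, of "inv t" x] complex_hom_inv[OF f c(1)] 0[OF t(1)] c by simp
    ultimately show ?case by (simp add: mult.commute)
  qed (use C in simp)
  have z: "f x = 0" if "x \<in> B 0" for x
  proof -
    have "(\<lambda>n. C * (1 / 2) ^ n) \<longlonglongrightarrow> C * 0" by (intro tendsto_intros LIMSEQ_power_zero) simp
    then have "(\<lambda>n. C / 2 ^ n) \<longlonglongrightarrow> 0" by (simp add: power_divide)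
    then have "norm (f x) \<le> 0" by (rule tendsto_lowerbound) (use le[OF that] in auto)
    then show ?thesis by simp
  qed
  have z2: "f x = 0" if "x \<in> set_power (B 0) p" for p x
    using that
  proof (induction p arbitrary: x)
    case (Suc p)
    then obtain a b where ab: "x = a \<otimes> b" "a \<in> B 0" "b \<in> set_power (B 0) p" by auto
    have "a \<in> carrier G" "b \<in> carrier G" using ab set_power_carrier[OF B_sub] B_sub by blast+
    then show ?case using complex_hom_mult[OF f] z[OF ab(2)] Suc.IH[OF ab(3)] ab(1) by simp
  qed (use complex_hom_one[OF f] in simp)
  obtain n where "x \<in> B n" using B_exhaust[OF x] ..
  moreover obtain p where "B n \<subseteq> set_power (B 0) p" by (rule generated_general)
  ultimately show ?thesis using z2 by blast
qed

text \<open>Polynomials act on \<open>l\<close> through composition with \<alpha>, and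
  \<open>S p\<close> is the result. A polynomial killing \<open>l\<close> along a finite net kills
  it everywhere; for one of least degree with a root \<open>z\<close>, the quotient by X - z yields
  a nonzero eigenvector with eigenvalue \<open>z\<close>.\<close>

theorem eigen_hom:
  "\<exists>f z. complex_hom f \<and> (\<exists>x\<in>carrier G. f x \<noteq> 0) \<and> (\<forall>x\<in>carrier G. f (\<alpha> x) = z * f x) \<and>
    z \<noteq> 0 \<and> norm z < 1 \<and> (z \<in> \<real> \<longrightarrow> (\<forall>x\<in>carrier G. f x \<in> \<real>))"
proof -
  obtain l C where l: "\<And>x y. x \<in> carrier G \<Longrightarrow> y \<in> carrier G \<Longrightarrow> l (x \<otimes> y) = l x + l y"
    and C: "\<And>x. x \<in> B 0 \<Longrightarrow> \<bar>l x\<bar> \<le> C" and ne: "\<exists>x\<in>carrier G. l x \<noteq> (0 :: real)"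
    using real_hom_exists by metis
  define S where "S = (\<lambda>p x. poly_pairing (\<lambda>i. of_real (l (iter i x))) p)"
  have S_hom: "complex_hom (S p)" for p
    unfolding complex_hom_def
  proof (intro conjI ballI exI)
    fix x y assume "x \<in> carrier G" "y \<in> carrier G"
    then show "S p (x \<otimes> y) = S p x + S p y"
      by (simp add: S_def poly_pairing_def iter_mult l algebra_simps sum.distrib)
  next
    fix x assume x: "x \<in> B 0"
    have "norm (S p x) \<le> (\<Sum>i\<le>degree p. norm (coeff p i * of_real (l (iter i x))))"
      unfolding S_def poly_pairing_def by (rule norm_sum)
    also have "\<dots> \<le> (\<Sum>i\<le>degree p. norm (coeff p i) * C)"
    proof (rule sum_mono)
      fix i
      have "iter i x \<in> B (0 - int i)" using iter_B[of x i 0] x B_carrier[OF x] by simp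
      then have "iter i x \<in> B 0" using B_mono[of "0 - int i" 0] by auto
      then show "norm (coeff p i * of_real (l (iter i x))) \<le> norm (coeff p i) * C"
        using C by (simp add: norm_mult mult_left_mono)
    qed
    finally show "norm (S p x) \<le> (\<Sum>i\<le>degree p. norm (coeff p i) * C)" .
  qed
  obtain T where T: "finite T" "T \<subseteq> carrier G" "\<forall>x\<in>B 0. \<exists>t\<in>T. inv t \<otimes> x \<in> B (- s)"
    using B_totally_bounded[of 0 "- s"] by blast
  obtain p0 where p0: "p0 \<noteq> 0" "\<forall>a\<in>(\<lambda>t i. complex_of_real (l (iter i t))) ` T. poly_pairing a p0 = 0"
    using poly_pairing_kill[of "(\<lambda>t i. complex_of_real (l (iter i t))) ` T" 0] T(1) by blast
  have "S p0 x = 0" if "x \<in> carrier G" for x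
    using p0(2) by (intro complex_hom_zero[OF S_hom T(3,2) _ that]) (simp add: S_def)
  then have "p0 \<noteq> 0 \<and> (\<forall>x\<in>carrier G. S p0 x = 0)" using p0(1) by simp
  from ex_has_least_nat[of "\<lambda>p. p \<noteq> 0 \<and> (\<forall>x\<in>carrier G. S p x = 0)", OF this, of degree]
  obtain p where p: "p \<noteq> 0" "\<And>x. x \<in> carrier G \<Longrightarrow> S p x = 0"
    and minimal: "\<And>q. q \<noteq> 0 \<and> (\<forall>x\<in>carrier G. S q x = 0) \<Longrightarrow> degree p \<le> degree q" by blast
  have "degree p \<noteq> 0"
  proof
    assume "degree p = 0"
    then obtain c where "p = [:c:]" by (metis degree_eq_zeroE)
    moreover obtain x where "x \<in> carrier G" "l x \<noteq> 0" using ne by blast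
    ultimately show False using p(1) p(2)[of x] by (simp add: S_def poly_pairing_def)
  qed
  then obtain z where z: "poly p z = 0"
    using fundamental_theorem_of_algebra[of p] constant_degree[of p] by auto
  then obtain r where r: "p = [:- z, 1:] * r" by (auto simp: poly_eq_0_iff_dvd dvd_def)
  have r0: "r \<noteq> 0" using r p(1) by auto
  have "degree p = degree [:- z, 1:] + degree r" unfolding r using r0 by (intro degree_mult_eq) auto
  then have "degree r < degree p" by simp
  then have Sr: "\<exists>x\<in>carrier G. S r x \<noteq> 0" using minimal[of r] r0 by force
  have eig: "S r (\<alpha> x) = z * S r x" if x: "x \<in> carrier G" for x
  proof -
    \<comment> \<open>Multiplication by X corresponds to composition with \<alpha>, so the vanishing
      of \<open>S p\<close> is the eigenvalue equation for \<open>S r\<close>.\<close>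
    have "p = pCons 0 r + smult (- z) r" using r by simp
    then have "S p x = poly_pairing (\<lambda>i. of_real (l (iter (Suc i) x))) r + - z * S r x"
      by (simp only: S_def poly_pairing_add poly_pairing_shift poly_pairing_smult)
    also have "(\<lambda>i. iter (Suc i) x) = (\<lambda>i. iter i (\<alpha> x))" by (simp add: funpow_swap1)
    then have "poly_pairing (\<lambda>i. of_real (l (iter (Suc i) x))) r = S r (\<alpha> x)"
      by (simp add: S_def fun_eq_iff)
    finally show ?thesis using p(2)[OF x] by simp
  qed
  obtain f where f: "complex_hom f" "\<exists>x\<in>carrier G. f x \<noteq> 0" "\<And>x. x \<in> carrier G \<Longrightarrow> f (\<alpha> x) = z * f x"
    "z \<in> \<real> \<Longrightarrow> \<forall>x\<in>carrier G. f x \<in> \<real>"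
  proof (cases "z \<in> \<real>")
    case False
    then show ?thesis using that[of "S r"] S_hom Sr eig by simp
  next
    case True
    then have im: "Im z = 0" by (simp add: complex_is_Real_iff)
    obtain D where D: "\<And>x. x \<in> B 0 \<Longrightarrow> norm (S r x) \<le> D" using S_hom[of r] unfolding complex_hom_def by blast
    \<comment> \<open>For real \<open>z\<close> the real and imaginary parts satisfy the eigenvalue
      equation separately, and at least one of them is nonzero.\<close>
    have "complex_hom (\<lambda>x. of_real (Re (S r x)))" "complex_hom (\<lambda>x. of_real (Im (S r x)))"
      unfolding complex_hom_def using D order_trans[OF abs_Re_le_cmod] order_trans[OF abs_Im_le_cmod]
      by (auto simp: complex_hom_mult[OF S_hom] intro!: exI[of _ D])
    moreover obtain x where "x \<in> carrier G" "S r x \<noteq> 0" using Sr by blast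
    then have "(\<exists>x\<in>carrier G. of_real (Re (S r x)) \<noteq> (0 :: complex)) \<or>
        (\<exists>x\<in>carrier G. of_real (Im (S r x)) \<noteq> (0 :: complex))"
      by (auto simp: complex_eq_iff)
    moreover have "of_real (Re (S r (\<alpha> x))) = z * of_real (Re (S r x))" 
        "of_real (Im (S r (\<alpha> x))) = z * of_real (Im (S r x))" if "x \<in> carrier G" for x
      using eig[OF that] im by (simp_all add: complex_eq_iff)
    ultimately show ?thesis
      using that[of "\<lambda>x. of_real (Re (S r x))"] that[of "\<lambda>x. of_real (Im (S r x))"] by auto
  qed
  have iter_f: "f (iter n x) = z ^ n * f x" if "x \<in> carrier G" for n x
    by (induction n) (use that f(3) in simp_all)
  obtain x0 where x0: "x0 \<in> carrier G" "f x0 \<noteq> 0" using f(2) by blast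
  have "z \<noteq> 0"
  proof
    assume "z = 0"
    obtain y where "y \<in> carrier G" "iter 1 y = x0" using iter_surj[OF x0(1)] by blast
    with f(3)[of y] \<open>z = 0\<close> x0(2) show False by simp
  qed
  moreover have "norm z < 1"
  proof (rule ccontr)
    \<comment> \<open>The values at the iterates of \<open>x0\<close> would never drop below
      \<open>norm (f x0)\<close>, although the iterates enter a ball on which f is at most half as
      large.\<close>
    assume "\<not> norm z < 1"
    obtain m where m: "\<forall>x\<in>B m. norm (f x) \<le> norm (f x0) / 2"
      using complex_hom_continuous[OF f(1), of "norm (f x0) / 2"] x0(2) by auto
    obtain n where n: "x0 \<in> B n" using B_exhaust[OF x0(1)] ..
    have "iter (nat (n - m)) x0 \<in> B (n - int (nat (n - m)))" using iter_B[OF x0(1)] n by blast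
    moreover have "B (n - int (nat (n - m))) \<subseteq> B (max m n)" by (rule B_mono) simp
    moreover have "iter (nat (n - m)) x0 \<in> B m"
    proof -
      have "B (n - int (nat (n - m))) \<subseteq> B m" by (rule B_mono) simp
      then show ?thesis using calculation(1) by blast
    qed
    ultimately have "norm (f (iter (nat (n - m)) x0)) \<le> norm (f x0) / 2" using m by blast
    moreover have "1 \<le> norm z ^ nat (n - m)" using \<open>\<not> norm z < 1\<close> by (intro one_le_power) simp
    then have "norm (f x0) \<le> norm z ^ nat (n - m) * norm (f x0)" by (simp add: mult_le_cancel_right1)
    ultimately show False using x0 iter_f[OF x0(1)] by (simp add: norm_mult norm_power)
  qed
  ultimately show ?thesis using f by blast
qed

end

section \<open>The filtration of a contraction group\<close>

context topological_group begin

lemma continuous_mult: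
  assumes "continuous_map X T f" "continuous_map X T g"
  shows "continuous_map X T (\<lambda>x. f x \<otimes> g x)"
  using continuous_map_compose[OF continuous_map_pairedI[OF assms] continuous_map_mult]
  by (simp add: comp_def)

lemma continuous_inv:
  assumes "continuous_map X T f" shows "continuous_map X T (\<lambda>x. inv (f x))"
  using continuous_map_compose[OF assms continuous_map_inv] by (simp add: comp_def)

lemma continuous_translate: "a \<in> carrier G \<Longrightarrow> continuous_map T T (\<lambda>x. a \<otimes> x)"
  using continuous_mult[of T "\<lambda>_. a" "\<lambda>x. x"] by (simp add: topspace_eq_carrier)

lemma openin_translate:
  assumes "openin T W" "a \<in> carrier G" shows "openin T {x \<in> carrier G. a \<otimes> x \<in> W}"
  using openin_continuous_map_preimage[OF continuous_translate[OF assms(2)] assms(1)]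
  by (simp add: topspace_eq_carrier)

lemma neighbourhood_product:
  assumes "openin T W" "\<one> \<in> W"
  shows "\<exists>V. openin T V \<and> \<one> \<in> V \<and> (\<forall>x\<in>V. \<forall>y\<in>V. x \<otimes> y \<in> W \<and> inv x \<otimes> y \<in> W)"
proof -
  let ?P = "prod_topology T T"
  have "continuous_map ?P T (\<lambda>p. inv (fst p) \<otimes> snd p)" "continuous_map ?P T (\<lambda>p. fst p \<otimes> snd p)"
    by (intro continuous_mult continuous_inv continuous_map_fst continuous_map_snd)+
  then have o: "openin ?P {p \<in> topspace ?P. inv (fst p) \<otimes> snd p \<in> W}"
    "openin ?P {p \<in> topspace ?P. fst p \<otimes> snd p \<in> W}"
    using openin_continuous_map_preimage assms(1) by blast+
  define Q where "Q = {p \<in> topspace ?P. inv (fst p) \<otimes> snd p \<in> W} \<inter> {p \<in> topspace ?P. fst p \<otimes> snd p \<in> W}"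
  have Q: "openin ?P Q" using o unfolding Q_def by (rule openin_Int)
  have "(\<one>, \<one>) \<in> Q" using assms by (simp add: Q_def topspace_eq_carrier)
  from Q[unfolded openin_prod_topology_alt, rule_format, OF this]
  obtain V1 V2 where V: "openin T V1" "openin T V2" "\<one> \<in> V1" "\<one> \<in> V2" "V1 \<times> V2 \<subseteq> Q"
    by (elim exE conjE) 
  show ?thesis
  proof (intro exI[of _ "V1 \<inter> V2"] conjI ballI)
    show "openin T (V1 \<inter> V2)" "\<one> \<in> V1 \<inter> V2" using V by auto
    fix x y assume "x \<in> V1 \<inter> V2" "y \<in> V1 \<inter> V2"
    then have "(x, y) \<in> Q" using V(5) by blast
    then show "x \<otimes> y \<in> W" "inv x \<otimes> y \<in> W" by (simp_all add: Q_def)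
  qed
qed

lemma compact_cover_translates:
  assumes K: "compactin T K" and V: "\<And>t. t \<in> K \<Longrightarrow> openin T (V t) \<and> \<one> \<in> V t"
  shows "\<exists>S. finite S \<and> S \<subseteq> K \<and> (\<forall>x\<in>K. \<exists>t\<in>S. inv t \<otimes> x \<in> V t)"
proof -
  have KG: "K \<subseteq> carrier G" using compactin_subset_topspace[OF K] by (simp add: topspace_eq_carrier)
  define N where "N = (\<lambda>t. {x \<in> carrier G. inv t \<otimes> x \<in> V t})"
  have o: "openin T (N t)" if "t \<in> K" for t
    unfolding N_def using V[OF that] KG that by (intro openin_translate) auto
  have sub: "K \<subseteq> \<Union> (N ` K)"
  proof
    fix t assume t: "t \<in> K"
    then have "t \<in> N t" using V[OF t] KG by (auto simp: N_def)
    with t show "t \<in> \<Union> (N ` K)" by blast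
  qed
  have "\<forall>X\<in>N ` K. openin T X" using o by blast
  then have "\<exists>\<F>. finite \<F> \<and> \<F> \<subseteq> N ` K \<and> K \<subseteq> \<Union> \<F>"
    by (intro compactinD[OF K _ sub]) (rule bspec)
  then obtain \<F> where F: "finite \<F>" "\<F> \<subseteq> N ` K" "K \<subseteq> \<Union> \<F>"
    by (elim exE conjE)
  obtain S where S: "S \<subseteq> K" "finite S" "\<F> = N ` S" using finite_subset_image[OF F(1,2)] by blast
  show ?thesis
  proof (intro exI[of _ S] conjI ballI S)
    fix x assume "x \<in> K"
    then obtain t where "t \<in> S" "x \<in> N t" using F(3) S(3) by blast
    then show "\<exists>t\<in>S. inv t \<otimes> x \<in> V t" by (auto simp: N_def)
  qed
qed

end

section \<open>Uniform contraction on compact sets\<close>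

context lc_contraction_group begin

abbreviation iter :: "nat \<Rightarrow> 'a \<Rightarrow> 'a" where "iter k \<equiv> \<alpha> ^^ k"

lemma iter_iso: "iter k \<in> iso G G"
  by (rule funpow_iso[OF automorphism])

lemma iter_closed [simp]: "x \<in> carrier G \<Longrightarrow> iter k x \<in> carrier G"
  using iter_iso[of k] by (auto simp: iso_def hom_def)

lemma iter_mult: "x \<in> carrier G \<Longrightarrow> y \<in> carrier G \<Longrightarrow> iter k (x \<otimes> y) = iter k x \<otimes> iter k y"
  using iter_iso[of k] by (auto simp: iso_def hom_def)

lemma iter_inj: "inj_on (iter k) (carrier G)" and iter_image: "iter k ` carrier G = carrier G"
  using iter_iso[of k] by (auto simp: iso_def bij_betw_def)

lemma iter_hom: "group_hom G G (iter k)"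
  using iter_iso[of k] by (intro group_hom.intro group_hom_axioms.intro is_group) (auto simp: iso_def)

lemma iter_inv: "x \<in> carrier G \<Longrightarrow> iter k (inv x) = inv (iter k x)"
  by (rule group_hom.hom_inv[OF iter_hom])

lemma iter_one: "iter k \<one> = \<one>"
  by (rule group_hom.hom_one[OF iter_hom])

lemma iter_homeo: "homeomorphic_map T T (iter k)"
proof (induction k)
  case 0
  have "iter 0 = id" by (simp add: fun_eq_iff)
  then show ?case by (simp only: homeomorphic_map_id)
next
  case (Suc k)
  then show ?case using homeomorphic_map_compose[OF Suc bicontinuous] by (simp add: comp_def)
qed

lemma iter_continuous: "continuous_map T T (iter k)"
  using iter_homeo homeomorphic_imp_continuous_map by blast

lemma regular: "regular_space T"
  using locally_compact_Hausdorff_imp_regular_space locally_compact Hausdorff by blast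

text \<open>Baire's theorem upgrades pointwise contraction: some set of points whose iterates stay
  in \<open>C\<close> from time \<open>n\<close> on has an interior point, and dividing by the
  iterates of that point moves the uniformity to the identity.\<close>

lemma contraction_uniform_nbhd:
  assumes W: "openin T W" "\<one> \<in> W"
  shows "\<exists>V n. openin T V \<and> \<one> \<in> V \<and> (\<forall>k\<ge>n. \<forall>v\<in>V. iter k v \<in> W)"
proof -
  obtain V' where V': "openin T V'" "\<one> \<in> V'" "\<forall>x\<in>V'. \<forall>y\<in>V'. x \<otimes> y \<in> W \<and> inv x \<otimes> y \<in> W"
    using neighbourhood_product[OF W] by (elim exE conjE)
  from regular have "neighbourhood_base_of (closedin T) T" by (simp only: neighbourhood_base_of_closedin)
  from this[unfolded neighbourhood_base_of, rule_format, OF conjI[OF V'(1,2)]]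
  obtain O' C where OC: "openin T O'" "closedin T C" "\<one> \<in> O'" "O' \<subseteq> C" "C \<subseteq> V'"
    by (elim exE conjE)
  \<comment> \<open>Regularity supplied a closed \<open>C\<close> between the neighbourhoods so that
    these sets are closed; pointwise contraction makes them exhaust the group.\<close>
  define F where "F = (\<lambda>n. {x \<in> carrier G. \<forall>k\<ge>n. iter k x \<in> C})"
  have F_closed: "closedin T (F n)" for n
  proof -
    have "F n = (\<Inter>k\<in>{n..}. {x \<in> topspace T. iter k x \<in> C})"
      by (auto simp: F_def topspace_eq_carrier)
    moreover have "closedin T (\<Inter>k\<in>{n..}. {x \<in> topspace T. iter k x \<in> C})"
      by (intro closedin_INT closedin_continuous_map_preimage[OF iter_continuous OC(2)]) auto
    ultimately show ?thesis by simp
  qed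
  have "\<exists>n. x \<in> F n" if "x \<in> carrier G" for x
  proof -
    have "eventually (\<lambda>n. iter n x \<in> O') sequentially"
      using contractive[OF that] OC(1,3) by (simp add: limitin_def)
    then obtain n where "\<And>k. k \<ge> n \<Longrightarrow> iter k x \<in> O'" by (auto simp: eventually_sequentially)
    then have "x \<in> F n" using OC(4) that by (auto simp: F_def)
    then show ?thesis ..
  qed
  then have UF: "\<Union> (range F) = topspace T" by (auto simp: F_def topspace_eq_carrier)
  have "\<exists>n. T interior_of (F n) \<noteq> {}"
  proof (rule ccontr)
    assume "\<not> ?thesis"
    then have "T interior_of \<Union> (range F) = {}"
      using regular locally_compact F_closed by (intro Baire_category_alt) auto
    then have "carrier G = {}" using UF interior_of_topspace[of T] by (simp add: topspace_eq_carrier)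
    then show False using one_closed by simp
  qed
  then obtain n x0 where x0: "x0 \<in> T interior_of (F n)" by blast
  define P where "P = T interior_of (F n)"
  have P: "openin T P" "x0 \<in> P" "P \<subseteq> F n" unfolding P_def using x0 interior_of_subset[of T "F n"] by simp_all
  have x0c: "x0 \<in> carrier G" using P by (auto simp: F_def)
  show ?thesis
  proof (intro exI[of _ "{x \<in> carrier G. x0 \<otimes> x \<in> P}"] exI[of _ n] conjI allI impI ballI)
    show "openin T {x \<in> carrier G. x0 \<otimes> x \<in> P}" by (rule openin_translate[OF P(1) x0c])
    show "\<one> \<in> {x \<in> carrier G. x0 \<otimes> x \<in> P}" using P(2) x0c by simp
    fix k v assume k: "n \<le> k" and v: "v \<in> {x \<in> carrier G. x0 \<otimes> x \<in> P}"
    have "iter k x0 \<in> V'" "iter k (x0 \<otimes> v) \<in> V'" using P v k OC(5) by (auto simp: F_def)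
    then have "inv (iter k x0) \<otimes> iter k (x0 \<otimes> v) \<in> W" using V'(3) by blast
    then show "iter k v \<in> W" using v x0c by (simp add: iter_mult m_assoc[symmetric])
  qed
qed

text \<open>Finitely many translates of the neighbourhood just found cover \<open>K\<close>; the
  finitely many translating elements contract at a common time.\<close>

lemma contraction_uniform:
  assumes K: "compactin T K" and W: "openin T W" "\<one> \<in> W"
  shows "\<exists>n. \<forall>k\<ge>n. \<forall>x\<in>K. iter k x \<in> W"
proof -
  obtain W' where W': "openin T W'" "\<one> \<in> W'" "\<forall>x\<in>W'. \<forall>y\<in>W'. x \<otimes> y \<in> W \<and> inv x \<otimes> y \<in> W"
    using neighbourhood_product[OF W] by (elim exE conjE)
  obtain V n where V: "openin T V" "\<one> \<in> V" "\<forall>k\<ge>n. \<forall>v\<in>V. iter k v \<in> W'"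
    using contraction_uniform_nbhd[OF W'(1,2)] by (elim exE conjE)
  have KG: "K \<subseteq> carrier G" using compactin_subset_topspace[OF K] by (simp add: topspace_eq_carrier)
  have "\<exists>S. finite S \<and> S \<subseteq> K \<and> (\<forall>x\<in>K. \<exists>t\<in>S. inv t \<otimes> x \<in> V)"
    by (rule compact_cover_translates[OF K]) (use V in simp)
  then obtain S where S: "finite S" "S \<subseteq> K" "\<forall>x\<in>K. \<exists>t\<in>S. inv t \<otimes> x \<in> V"
    by (elim exE conjE)
  have "\<exists>n. \<forall>k\<ge>n. iter k t \<in> W'" if "t \<in> carrier G" for t
    using contractive[OF that] W'(1,2) unfolding limitin_def eventually_sequentially by blast
  then have "\<forall>t\<in>carrier G. \<exists>n. \<forall>k\<ge>n. iter k t \<in> W'" by (rule ballI)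
  from bchoice[OF this] obtain m where m: "\<forall>t\<in>carrier G. \<forall>k\<ge>m t. iter k t \<in> W'" by (elim exE)
  have "finite (m ` S)" using S by simp
  then obtain N where N: "\<And>t. t \<in> S \<Longrightarrow> m t \<le> N" by (metis finite_nat_set_iff_bounded_le imageI)
  show ?thesis
  proof (intro exI[of _ "max n N"] allI impI ballI)
    fix k x assume k: "max n N \<le> k" and x: "x \<in> K"
    obtain t where t: "t \<in> S" "inv t \<otimes> x \<in> V" using bspec[OF S(3) x] by blast
    have c: "t \<in> carrier G" "x \<in> carrier G" using t S x KG by blast+
    have "iter k t \<in> W'" using N[OF t(1)] k m c by simp
    moreover have "iter k (inv t \<otimes> x) \<in> W'" using t k V(3) by simp
    ultimately have "iter k t \<otimes> iter k (inv t \<otimes> x) \<in> W" using W'(3) by blast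
    then have "iter k (t \<otimes> (inv t \<otimes> x)) \<in> W" using c by (simp add: iter_mult)
    then show "iter k x \<in> W" using c by (simp add: m_assoc[symmetric])
  qed
qed

text \<open>Start from a symmetric compact neighbourhood \<open>K\<close> and take the union of its
  first iterates. From time \<open>n\<close> on every iterate of \<open>K\<close> lies in
  \<open>P\<close>, so applying \<alpha> to the last member of the union lands in \<open>P\<close>,
  hence in the union.\<close>

lemma absorbing_neighbourhood_exists:
  "\<exists>U P. compactin T U \<and> openin T P \<and> \<one> \<in> P \<and> P \<subseteq> U \<and>
    (\<forall>x\<in>U. inv x \<in> U) \<and> (\<forall>x\<in>U. \<alpha> x \<in> U)"
proof -
  obtain O0 K0 where OK: "openin T O0" "compactin T K0" "\<one> \<in> O0" "O0 \<subseteq> K0"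
    using locally_compact[unfolded locally_compact_space_def topspace_eq_carrier, rule_format, OF one_closed]
    by (elim exE conjE)
  define K where "K = {x \<in> topspace T. inv x \<in> K0} \<inter> K0"
  have K: "compactin T K"
    unfolding K_def using OK(2) compactin_imp_closedin[OF Hausdorff OK(2)]
    by (intro closed_Int_compactin closedin_continuous_map_preimage[OF continuous_map_inv]) auto
  define P where "P = {x \<in> topspace T. inv x \<in> O0} \<inter> O0"
  have P: "openin T P" unfolding P_def using OK(1)
    by (intro openin_Int openin_continuous_map_preimage[OF continuous_map_inv]) auto
  have P1: "\<one> \<in> P" using OK by (simp add: P_def topspace_eq_carrier)
  have PK: "P \<subseteq> K" using OK(4) by (auto simp: P_def K_def)
  obtain n where n: "\<forall>k\<ge>n. \<forall>x\<in>K. iter k x \<in> P" using contraction_uniform[OF K P P1] by (elim exE)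
  define U where "U = (\<Union>i\<in>{..n}. iter i ` K)"
  have "compactin T U" unfolding U_def
    by (intro compactin_Union) (auto intro: image_compactin[OF K iter_continuous])
  moreover have "P \<subseteq> U" using PK by (force simp: U_def)
  moreover have "inv x \<in> U" if x: "x \<in> U" for x
  proof -
    obtain i y where iy: "i \<le> n" "y \<in> K" "x = iter i y" using x by (auto simp: U_def)
    have yc: "y \<in> carrier G" using iy by (auto simp: K_def topspace_eq_carrier)
    have "inv y \<in> K" using iy(2) by (auto simp: K_def topspace_eq_carrier)
    moreover have "inv x = iter i (inv y)" using iy yc by (simp add: iter_inv)
    ultimately show ?thesis using iy(1) by (auto simp: U_def)
  qed
  moreover have "\<alpha> x \<in> U" if x: "x \<in> U" for x
  proof -
    obtain i y where iy: "i \<le> n" "y \<in> K" "x = iter i y" using x by (auto simp: U_def)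
    show ?thesis
    proof (cases "i = n")
      case True
      have "iter (Suc n) y \<in> P" using iy n by (simp del: funpow.simps)
      then have "\<alpha> x \<in> P" using iy True by simp
      then show ?thesis using \<open>P \<subseteq> U\<close> by blast
    next
      case False
      then have "Suc i \<le> n" "\<alpha> x = iter (Suc i) y" using iy by auto
      then show ?thesis using iy(2) unfolding U_def by blast
    qed
  qed
  ultimately show ?thesis using P P1 by (intro exI[of _ U] exI[of _ P]) simp
qed

end

section \<open>The balls of an absorbing neighbourhood\<close>

locale absorbing_neighbourhood = lc_contraction_group +
  fixes U P
  assumes U_compact: "compactin T U" and P_open: "openin T P" and P_one: "\<one> \<in> P" and P_U: "P \<subseteq> U"
    and U_inv: "x \<in> U \<Longrightarrow> inv x \<in> U" and U_alpha: "x \<in> U \<Longrightarrow> \<alpha> x \<in> U"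
begin

text \<open>As \<open>nat\<close> truncates at 0, at least one of the two exponents is 0: the set is
  a preimage of \<open>U\<close> for \<open>n \<ge> 0\<close> and an image of \<open>U\<close> for
  \<open>n \<le> 0\<close>. This avoids inverting \<alpha>.\<close>

definition B :: "int \<Rightarrow> 'a set"
  where "B n = {x \<in> carrier G. iter (nat n) x \<in> iter (nat (- n)) ` U}"

lemma U_sub: "U \<subseteq> carrier G"
  using compactin_subset_topspace[OF U_compact] by (simp add: topspace_eq_carrier)

lemma B_nonneg: "n \<ge> 0 \<Longrightarrow> B n = {x \<in> carrier G. iter (nat n) x \<in> U}"
  by (simp add: B_def)

lemma B_nonpos: "B (- int k) = iter k ` U"
  using U_sub by (auto simp: B_def)

lemma B_zero: "B 0 = U"
  using U_sub by (auto simp: B_def)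

lemma B_alpha: 
  assumes x: "x \<in> carrier G" shows "\<alpha> x \<in> B (n - 1) \<longleftrightarrow> x \<in> B n"
proof (cases "n \<ge> 1")
  case True
  then have "nat n = Suc (nat (n - 1))" by simp
  then show ?thesis using x iter_closed[OF x, of 1] True by (simp add: B_nonneg funpow_swap1)
next
  case False
  define k where "k = nat (- n)"
  have n: "n = - int k" "n - 1 = - int (Suc k)" using False by (auto simp: k_def)
  have "\<alpha> x \<in> iter (Suc k) ` U \<longleftrightarrow> x \<in> iter k ` U"
  proof
    assume "\<alpha> x \<in> iter (Suc k) ` U"
    then obtain u where u: "u \<in> U" "iter 1 x = iter 1 (iter k u)" by auto
    have "u \<in> carrier G" using u U_sub by blast
    then have "x = iter k u" using x by (intro inj_onD[OF iter_inj[of 1] u(2)]) simp_all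
    then show "x \<in> iter k ` U" using u by blast
  next
    assume "x \<in> iter k ` U"
    then obtain u where u: "u \<in> U" "x = iter k u" by blast
    then have "\<alpha> x = iter (Suc k) u" by simp
    with u(1) show "\<alpha> x \<in> iter (Suc k) ` U" by (simp only: imageI)
  qed
  then show ?thesis unfolding n(2) B_nonpos unfolding n(1) B_nonpos .
qed

lemma B_iter: "x \<in> carrier G \<Longrightarrow> iter k x \<in> B (n - int k) \<longleftrightarrow> x \<in> B n"
proof (induction k arbitrary: n)
  case (Suc k)
  then show ?case using B_alpha[of "iter k x" "n - int k"] by (simp add: algebra_simps)
qed simp

lemma B_sub: "B n \<subseteq> carrier G" by (auto simp: B_def)

lemma B_step: "B n \<subseteq> B (n + 1)"
proof (cases "n \<ge> 0")
  case True
  then have "nat (n + 1) = Suc (nat n)" by simp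
  then show ?thesis using True U_alpha by (auto simp: B_nonneg)
next
  case False
  define k where "k = nat (- n - 1)"
  have n: "n = - int (Suc k)" "n + 1 = - int k" using False by (auto simp: k_def)
  have "iter (Suc k) u \<in> iter k ` U" if "u \<in> U" for u
    using U_alpha[OF that] by (simp add: funpow_Suc_right del: funpow.simps)
  then show ?thesis unfolding n(2) B_nonpos unfolding n(1) B_nonpos by blast
qed

lemma B_mono: assumes "m \<le> n" shows "B m \<subseteq> B n"
proof -
  have "B m \<subseteq> B (m + int k)" for k
  proof (induction k)
    case (Suc k)
    then show ?case using B_step[of "m + int k"] by (auto simp: algebra_simps)
  qed simp
  from this[of "nat (n - m)"] assms show ?thesis by simp
qed

lemma B_compact: "compactin T (B n)"
proof (cases "n \<ge> 0")
  case True
  have "iter (nat n) ` B n = U"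
  proof -
    have "u \<in> iter (nat n) ` B n" if "u \<in> U" for u
    proof -
      obtain x where "x \<in> carrier G" "u = iter (nat n) x" using iter_image[of "nat n"] U_sub \<open>u \<in> U\<close> by blast
      then show ?thesis using that True by (auto simp: B_nonneg)
    qed
    then show ?thesis using True by (auto simp: B_nonneg)
  qed
  then show ?thesis
    using homeomorphic_map_compactness[OF iter_homeo, of "B n" "nat n"] U_compact B_sub
    by (simp add: topspace_eq_carrier)
next
  case False
  then have "B n = iter (nat (- n)) ` U" using B_nonpos[of "nat (- n)"] by simp
  then show ?thesis using image_compactin[OF U_compact iter_continuous] by simp
qed

lemma B_neighbourhood: obtains W where "openin T W" "\<one> \<in> W" "W \<subseteq> B n"
proof (cases "n \<ge> 0")
  case True
  have "P \<subseteq> B n" using P_U B_zero B_mono[OF True] by blast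
  with P_open P_one that show ?thesis by blast
next
  case False
  define k where "k = nat (- n)"
  have n: "n = - int k" using False by (simp add: k_def)
  have "openin T (iter k ` P)"
    using homeomorphic_map_openness[OF iter_homeo openin_subset[OF P_open], of k] P_open by blast
  moreover have "\<one> \<in> iter k ` P" using P_one iter_one[of k] by (metis imageI)
  moreover have "iter k ` P \<subseteq> B n" unfolding n B_nonpos using P_U by blast
  ultimately show ?thesis using that by blast
qed

lemma B_absorbs: assumes "compactin T K" obtains n :: nat where "K \<subseteq> B (int n)"
proof -
  obtain n where n: "\<forall>k\<ge>n. \<forall>x\<in>K. iter k x \<in> P"
    using contraction_uniform[OF assms P_open P_one] by (elim exE)
  have "K \<subseteq> carrier G" using compactin_subset_topspace[OF assms] by (simp add: topspace_eq_carrier)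
  then have "K \<subseteq> B (int n)" using n[rule_format, of n] P_U by (auto simp: B_nonneg)
  then show ?thesis by (rule that)
qed

lemma B_small: assumes "openin T W" "\<one> \<in> W" obtains k :: nat where "B (- int k) \<subseteq> W"
proof -
  obtain n where n: "\<forall>k\<ge>n. \<forall>x\<in>U. iter k x \<in> W"
    using contraction_uniform[OF U_compact assms] by (elim exE)
  then have "B (- int n) \<subseteq> W" by (auto simp: B_nonpos)
  then show ?thesis by (rule that)
qed

lemma B_one: "\<one> \<in> B n"
  using B_neighbourhood[of n] by blast

lemma B_inv: assumes "x \<in> B n" shows "inv x \<in> B n"
proof (cases "n \<ge> 0")
  case True
  then show ?thesis using assms U_inv by (auto simp: B_nonneg iter_inv)
next
  case False
  define k where "k = nat (- n)"
  have n: "n = - int k" using False by (simp add: k_def)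
  obtain u where u: "u \<in> U" "x = iter k u" using assms by (auto simp: n B_nonpos)
  then have "inv x = iter k (inv u)" using U_sub iter_inv by auto
  then show ?thesis using u U_inv by (auto simp: n B_nonpos)
qed

text \<open>The product set of \<open>U\<close> with itself is compact, hence lies in some
  \<open>B (int s)\<close>; iterating \<alpha> carries this one inclusion, with the same
  \<open>s\<close>, to all scales.\<close>

lemma B_mult_exists: "\<exists>s\<ge>0. \<forall>n. \<forall>x\<in>B n. \<forall>y\<in>B n. x \<otimes> y \<in> B (n + s)"
proof -
  have "compactin T ((\<lambda>(x, y). x \<otimes> y) ` (U \<times> U))"
    using U_compact by (intro image_compactin[OF _ continuous_map_mult]) (simp add: compactin_Times)
  then obtain s :: nat where s: "(\<lambda>(x, y). x \<otimes> y) ` (U \<times> U) \<subseteq> B (int s)" by (rule B_absorbs)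
  then have s0: "x \<otimes> y \<in> B (int s)" if "x \<in> U" "y \<in> U" for x y using that by auto
  have "x \<otimes> y \<in> B (n + int s)" if x: "x \<in> B n" and y: "y \<in> B n" for n x y
  proof (cases "n \<ge> 0")
    case True
    have c: "x \<in> carrier G" "y \<in> carrier G" using x y B_sub by blast+
    have "iter (nat n) x \<in> U" "iter (nat n) y \<in> U" using x y True by (simp_all add: B_nonneg)
    then have "iter (nat n) (x \<otimes> y) \<in> B (int s)" using s0 c by (simp add: iter_mult)
    then show ?thesis using B_iter[of "x \<otimes> y" "nat n" "n + int s"] c True by (simp add: algebra_simps)
  next
    case False
    define k where "k = nat (- n)"
    have n: "n = - int k" using False by (simp add: k_def)
    obtain u v where uv: "u \<in> U" "x = iter k u" "v \<in> U" "y = iter k v" using x y by (auto simp: n B_nonpos)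
    have c: "u \<in> carrier G" "v \<in> carrier G" using uv U_sub by blast+
    have "iter k (u \<otimes> v) \<in> B (int s - int k)" using B_iter[of "u \<otimes> v" k "int s"] s0 uv c by simp
    then show ?thesis using uv c by (simp add: n iter_mult algebra_simps)
  qed
  then show ?thesis by (intro exI[of _ "int s"]) simp
qed

lemma B_exhausts: assumes "x \<in> carrier G" shows "\<exists>n. x \<in> B n"
proof -
  have "compactin T {x}" using assms by (simp add: topspace_eq_carrier)
  then obtain n :: nat where "{x} \<subseteq> B (int n)" by (rule B_absorbs)
  then show ?thesis by blast
qed

lemma B_tot_bounded: "\<exists>S. finite S \<and> S \<subseteq> carrier G \<and> (\<forall>x\<in>B n. \<exists>t\<in>S. inv t \<otimes> x \<in> B k)"
proof -
  obtain W where W: "openin T W" "\<one> \<in> W" "W \<subseteq> B k" by (rule B_neighbourhood)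
  have "\<exists>S. finite S \<and> S \<subseteq> B n \<and> (\<forall>x\<in>B n. \<exists>t\<in>S. inv t \<otimes> x \<in> W)"
    by (rule compact_cover_translates[OF B_compact]) (use W in simp)
  then obtain S where S: "finite S" "S \<subseteq> B n" "\<forall>x\<in>B n. \<exists>t\<in>S. inv t \<otimes> x \<in> W"
    by (elim exE conjE)
  have "S \<subseteq> carrier G" using S(2) B_sub[of n] by (rule order_trans)
  with S W(3) show ?thesis by (intro exI[of _ S]) fast
qed

text \<open>Conjugation sends \<open>B n\<close> times the identity to the identity, and the tube
  lemma over the compact set \<open>B n\<close> gives a uniform neighbourhood.\<close>

lemma B_conjugation: "\<exists>j. \<forall>z\<in>B n. \<forall>v\<in>B j. inv z \<otimes> v \<otimes> z \<in> B k"
proof -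
  let ?P = "prod_topology T T"
  obtain W where W: "openin T W" "\<one> \<in> W" "W \<subseteq> B k" by (rule B_neighbourhood)
  have "continuous_map ?P T (\<lambda>p. inv (fst p) \<otimes> snd p \<otimes> fst p)"
    by (intro continuous_mult continuous_inv continuous_map_fst continuous_map_snd)
  then have o: "openin ?P {p \<in> topspace ?P. inv (fst p) \<otimes> snd p \<otimes> fst p \<in> W}"
    using openin_continuous_map_preimage W(1) by blast
  have "B n \<times> {\<one>} \<subseteq> {p \<in> topspace ?P. inv (fst p) \<otimes> snd p \<otimes> fst p \<in> W}"
    using B_sub W(2) by (auto simp: topspace_eq_carrier subset_iff)
  from tube_lemma_left[OF o B_compact _ this] obtain X V where XV: "openin T V" "B n \<subseteq> X" "\<one> \<in> V"
    "X \<times> V \<subseteq> {p \<in> topspace ?P. inv (fst p) \<otimes> snd p \<otimes> fst p \<in> W}"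
    using one_closed by (auto simp: topspace_eq_carrier)
  obtain j :: nat where j: "B (- int j) \<subseteq> V" using B_small[OF XV(1,3)] by blast
  have "inv z \<otimes> v \<otimes> z \<in> B k" if "z \<in> B n" "v \<in> B (- int j)" for z v
  proof -
    have "(z, v) \<in> X \<times> V" using that XV(2) j by blast
    then have "inv z \<otimes> v \<otimes> z \<in> W" using XV(4) by fastforce
    then show ?thesis using W(3) by blast
  qed
  then show ?thesis by blast
qed

lemma B_separated: assumes "\<And>n. x \<in> B n" shows "x = \<one>"
proof (rule ccontr)
  assume "x \<noteq> \<one>"
  moreover have "x \<in> topspace T" "\<one> \<in> topspace T" using assms[of 0] B_sub by (auto simp: topspace_eq_carrier)
  ultimately obtain V W where VW: "openin T V" "openin T W" "x \<in> V" "\<one> \<in> W" "disjnt V W"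
    using Hausdorff unfolding Hausdorff_space_def by metis
  obtain k :: nat where "B (- int k) \<subseteq> W" using B_small[OF VW(2,4)] by blast
  with assms[of "- int k"] VW show False by (auto simp: disjnt_def)
qed

lemma filtered: "\<exists>s. filtered_group G B s"
proof -
  obtain s where "s \<ge> 0" "\<forall>n. \<forall>x\<in>B n. \<forall>y\<in>B n. x \<otimes> y \<in> B (n + s)" using B_mult_exists by blast
  then have "filtered_group G B s"
    using B_sub B_mono B_one B_inv B_exhausts B_tot_bounded by unfold_locales simp_all
  then show ?thesis ..
qed

text \<open>Complete regularity supplies the bump. Its uniformity over the whole group needs only a
  compact ball, because the support is bounded.\<close>

lemma filtered_lc:
  assumes "filtered_group G B s" shows "filtered_lc_group G B s"
proof -
  interpret fg: filtered_group G B s by fact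
  let ?Q = "prod_topology T T"
  have "\<exists>g. fg.bump g \<and> fg.supp_in n g" for n
  proof -
    obtain W where W: "openin T W" "\<one> \<in> W" "W \<subseteq> B n" by (rule B_neighbourhood)
    have "completely_regular_space T"
      using locally_compact_regular_imp_completely_regular_space locally_compact regular by blast
    moreover have "closedin T (carrier G - W)" using W(1) by (simp add: topspace_eq_carrier[symmetric] closedin_diff)
    ultimately obtain f where f: "continuous_map T (top_of_set {0..1}) f" "f \<one> = 0" "f ` (carrier G - W) \<subseteq> {1 :: real}"
      using W(2) unfolding completely_regular_space_def topspace_eq_carrier by (metis DiffD2 DiffI one_closed)
    have fr: "continuous_map T euclideanreal f" and f01: "x \<in> carrier G \<Longrightarrow> 0 \<le> f x \<and> f x \<le> 1" for x
      using f(1) by (auto simp: continuous_map_in_subtopology topspace_eq_carrier Pi_iff image_subset_iff)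
    define g where "g = (\<lambda>x. 1 - f x)"
    have gr: "continuous_map T euclideanreal g" unfolding g_def by (intro continuous_intros fr)
    have supp: "fg.supp_in n g" using f(3) W(3) by (auto simp: fg.supp_in_def g_def)
    have "fg.bdd g" unfolding fg.bdd_def g_def using f01 by (intro exI[of _ 1]) (auto simp: abs_le_iff)
    moreover have "fg.right_uniform g"
      unfolding fg.right_uniform_def
    proof (intro allI impI)
      fix e :: real assume e: "e > 0"
      let ?h = "\<lambda>p. g (fst p \<otimes> snd p) - g (fst p)"
      have "continuous_map ?Q T (\<lambda>p. fst p \<otimes> snd p)"
        by (intro continuous_mult continuous_map_fst continuous_map_snd)
      then have "continuous_map ?Q euclideanreal (\<lambda>p. g (fst p \<otimes> snd p))" 
        using continuous_map_compose[OF _ gr] by (fastforce simp: comp_def)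
      moreover have "continuous_map ?Q euclideanreal (\<lambda>p. g (fst p))"
        using continuous_map_compose[OF continuous_map_fst gr] by (simp add: comp_def)
      ultimately have "continuous_map ?Q euclideanreal ?h" by (rule continuous_map_diff)
      then have o: "openin ?Q {p \<in> topspace ?Q. ?h p \<in> {- e<..<e}}"
        by (rule openin_continuous_map_preimage) simp
      \<comment> \<open>Outside this ball, for \<open>v\<close> in \<open>B (max n 0)\<close>,
        neither \<open>x\<close> nor \<open>x \<otimes> v\<close> lies in \<open>B n\<close>, so the
        increment is 0; on it the tube lemma applies.\<close>
      define D where "D = B (max n 0 + s)"
      have "D \<times> {\<one>} \<subseteq> {p \<in> topspace ?Q. ?h p \<in> {- e<..<e}}"
        using B_sub e by (auto simp: topspace_eq_carrier subset_iff D_def)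
      from tube_lemma_left[OF o B_compact[of "max n 0 + s", folded D_def] _ this]
      obtain X V where XV: "openin T V" "D \<subseteq> X" "\<one> \<in> V" "X \<times> V \<subseteq> {p \<in> topspace ?Q. ?h p \<in> {- e<..<e}}"
        using one_closed by (auto simp: topspace_eq_carrier)
      obtain j :: nat where j: "B (- int j) \<subseteq> V" using B_small[OF XV(1,3)] by blast
      have "\<bar>g (x \<otimes> v) - g x\<bar> \<le> e" if x: "x \<in> carrier G" and v: "v \<in> B (- int j)" for x v
      proof (cases "x \<in> D")
        case True
        then have "(x, v) \<in> X \<times> V" using v XV(2) j by blast
        then show ?thesis using XV(4) by fastforce
      next
        case False
        have "B (- int j) \<subseteq> B (max n 0)" by (rule B_mono) simp
        then have v0: "v \<in> B (max n 0)" using v by blast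
        have vc: "v \<in> carrier G" using v B_sub by blast
        have "B n \<subseteq> D" unfolding D_def by (rule B_mono) (use fg.s_nonneg in simp)
        then have "x \<notin> B n" using False by blast
        moreover have "x \<otimes> v \<notin> B n"
        proof
          assume "x \<otimes> v \<in> B n"
          moreover have "B n \<subseteq> B (max n 0)" by (rule B_mono) simp
          ultimately have "x \<otimes> v \<in> B (max n 0)" by blast
          from fg.B_mult[OF this B_inv[OF v0]] have "x \<in> D" using x vc by (simp add: D_def m_assoc)
          with False show False by blast
        qed
        ultimately show ?thesis using supp x vc e by (simp add: fg.supp_in_def)
      qed
      then show "\<exists>k. \<forall>x\<in>carrier G. \<forall>v\<in>B k. \<bar>g (x \<otimes> v) - g x\<bar> \<le> e" by blast
    qed
    ultimately have "fg.bump g"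
      using supp f01 f(2) by (auto simp: fg.bump_def fg.test_def g_def)
    with supp show ?thesis by blast
  qed
  then show ?thesis by unfold_locales
qed

text \<open>The subgroup generated by \<open>U\<close> is open, since it absorbs translates of
  \<open>P\<close>, and so is its complement; connectedness makes it the whole group.\<close>

lemma self_similar:
  assumes conn: "connected_space T" and nontriv: "carrier G \<noteq> {\<one>}"
  shows "\<exists>s. self_similar_group G B s \<alpha>"
proof -
  obtain s where "filtered_group G B s" using filtered by blast
  then interpret fl: filtered_lc_group G B s by (rule filtered_lc)
  have pc: "fl.set_power U p \<subseteq> carrier G" for p by (rule fl.set_power_carrier[OF U_sub])
  define H where "H = (\<Union>p. fl.set_power U p)"
  have H_mult: "x \<otimes> u \<in> fl.set_power U (Suc p)" if "x \<in> fl.set_power U p" "u \<in> U" for x u p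
  proof -
    have "u \<in> fl.set_power U 1" unfolding fl.set_power_one[OF U_sub] by fact
    from fl.set_power_add[OF U_sub that(1) this] show ?thesis by (simp only: Suc_eq_plus1)
  qed
  have H_mult2: "x \<otimes> u \<in> H" if "x \<in> H" "u \<in> U" for x u
    using that H_mult unfolding H_def by blast
  have "openin T H"
  proof (subst openin_subopen, rule ballI)
    fix x assume x: "x \<in> H"
    then have xc: "x \<in> carrier G" using pc unfolding H_def by blast
    have "y \<in> H" if "y \<in> carrier G" "inv x \<otimes> y \<in> P" for y
    proof -
      have "x \<otimes> (inv x \<otimes> y) \<in> H" using that P_U by (intro H_mult2 x) blast
      then show ?thesis using xc that by (simp add: m_assoc[symmetric])
    qed
    then show "\<exists>V. openin T V \<and> x \<in> V \<and> V \<subseteq> H"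
      using openin_translate[OF P_open, of "inv x"] xc P_one
      by (intro exI[of _ "{y \<in> carrier G. inv x \<otimes> y \<in> P}"]) auto
  qed
  moreover have "openin T (topspace T - H)"
  proof (subst openin_subopen, rule ballI)
    fix x assume x: "x \<in> topspace T - H"
    then have xc: "x \<in> carrier G" by (simp add: topspace_eq_carrier)
    have "y \<notin> H" if "y \<in> carrier G" "inv x \<otimes> y \<in> P" for y
    proof
      assume "y \<in> H"
      moreover have "inv (inv x \<otimes> y) \<in> U" using that P_U U_inv by blast
      ultimately have "y \<otimes> inv (inv x \<otimes> y) \<in> H" by (rule H_mult2)
      then show False using x xc that by (simp add: inv_mult_group m_assoc[symmetric])
    qed
    then show "\<exists>V. openin T V \<and> x \<in> V \<and> V \<subseteq> topspace T - H"
      using openin_translate[OF P_open, of "inv x"] xc P_one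
      by (intro exI[of _ "{y \<in> carrier G. inv x \<otimes> y \<in> P}"]) (auto simp: topspace_eq_carrier)
  qed
  moreover have "H \<subseteq> topspace T" unfolding H_def topspace_eq_carrier using pc by blast
  ultimately have "closedin T H" by (simp add: closedin_def)
  with \<open>openin T H\<close> conn have "H = {} \<or> H = topspace T" by (simp add: connected_space_clopen_in)
  moreover have "\<one> \<in> fl.set_power U 0" by simp
  then have "\<one> \<in> H" unfolding H_def by (rule UN_I[OF UNIV_I])
  ultimately have HG: "H = carrier G" by (auto simp: topspace_eq_carrier)
  \<comment> \<open>Finitely many translates of \<open>P\<close> cover \<open>B 1\<close>; the
    longest word needed for the translating elements, plus one factor from \<open>U\<close>, bounds
    all words.\<close>
  have "\<exists>S. finite S \<and> S \<subseteq> B 1 \<and> (\<forall>x\<in>B 1. \<exists>t\<in>S. inv t \<otimes> x \<in> P)"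
    by (rule compact_cover_translates[OF B_compact]) (use P_open P_one in simp)
  then obtain S where S: "finite S" "S \<subseteq> B 1" "\<forall>x\<in>B 1. \<exists>t\<in>S. inv t \<otimes> x \<in> P"
    by (elim exE conjE)
  have "\<exists>p. t \<in> fl.set_power U p" if "t \<in> carrier G" for t using that unfolding HG[symmetric] H_def by blast
  then have "\<forall>t\<in>carrier G. \<exists>p. t \<in> fl.set_power U p" by (rule ballI)
  from bchoice[OF this] obtain q where q: "\<forall>t\<in>carrier G. t \<in> fl.set_power U (q t)" by (elim exE)
  have "finite (q ` S)" using S by simp
  then obtain N where N: "\<And>t. t \<in> S \<Longrightarrow> q t \<le> N" by (metis finite_nat_set_iff_bounded_le imageI)
  have "B 1 \<subseteq> fl.set_power (B 0) (Suc N)"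
  proof
    fix x assume x: "x \<in> B 1"
    obtain t where t: "t \<in> S" "inv t \<otimes> x \<in> P" using bspec[OF S(3) x] by blast
    have c: "t \<in> carrier G" "x \<in> carrier G" using t S x B_sub by blast+
    have "t \<in> fl.set_power U N"
      using bspec[OF q c(1)] fl.set_power_mono_exp[OF U_sub, of "q t" N] N[OF t(1)] P_one P_U by blast
    from H_mult[OF this, of "inv t \<otimes> x"] have "t \<otimes> (inv t \<otimes> x) \<in> fl.set_power U (Suc N)" using t(2) P_U by blast
    then show "x \<in> fl.set_power (B 0) (Suc N)" using c by (simp add: B_zero m_assoc[symmetric])
  qed
  then have "self_similar_group G B s \<alpha>"
    using automorphism B_alpha B_conjugation B_separated nontriv by unfold_locales blast+
  then show ?thesis ..
qed

end

section \<open>The model groups\<close>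

text \<open>The models of the connected simple contraction groups: \<open>z\<close> acts on \<open>\<real>\<close> if it is real, and
  on \<open>\<complex>\<close> otherwise.\<close>

definition spiral_carrier :: "complex \<Rightarrow> complex set"
  where "spiral_carrier z = (if z \<in> \<real> then \<real> else UNIV)"

definition spiral_group :: "complex \<Rightarrow> complex monoid"
  where "spiral_group z = \<lparr>carrier = spiral_carrier z, mult = (+), one = 0\<rparr>"

definition spiral_topology :: "complex \<Rightarrow> complex topology"
  where "spiral_topology z = top_of_set (spiral_carrier z)"

lemma spiral_carrier_add: "x \<in> spiral_carrier z \<Longrightarrow> y \<in> spiral_carrier z \<Longrightarrow> x + y \<in> spiral_carrier z"
  and spiral_carrier_uminus: "x \<in> spiral_carrier z \<Longrightarrow> - x \<in> spiral_carrier z"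
  and spiral_carrier_zero: "0 \<in> spiral_carrier z"
  and spiral_carrier_mult: "x \<in> spiral_carrier z \<Longrightarrow> z * x \<in> spiral_carrier z"
  and spiral_carrier_scale: "x \<in> spiral_carrier z \<Longrightarrow> of_real t * x \<in> spiral_carrier z"
  and spiral_carrier_real: "of_real t \<in> spiral_carrier z"
  by (auto simp: spiral_carrier_def)

lemma closed_spiral_carrier: "closed (spiral_carrier z)"
  by (simp add: spiral_carrier_def closed_complex_Reals)

lemma convex_spiral_carrier: "convex (spiral_carrier z)"
proof -
  have "u *\<^sub>R x + v *\<^sub>R y \<in> spiral_carrier z" if "x \<in> spiral_carrier z" "y \<in> spiral_carrier z" for x y u v
    unfolding scaleR_conv_of_real by (intro spiral_carrier_add spiral_carrier_scale that)
  then show ?thesis by (auto simp: convex_def)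
qed

lemma int_multiple_closed:
  fixes N :: "complex set"
  assumes 0: "0 \<in> N" and diff: "\<And>x y. x \<in> N \<Longrightarrow> y \<in> N \<Longrightarrow> x - y \<in> N" and x: "x \<in> N"
  shows "of_int k * x \<in> N"
proof -
  have neg: "- y \<in> N" if "y \<in> N" for y using diff[OF 0 that] by simp
  have "of_nat n * x \<in> N" for n
  proof (induction n)
    case (Suc n)
    then show ?case using diff[OF Suc neg[OF x]] by (simp add: algebra_simps)
  qed (simp add: 0)
  note nat = this
  show ?thesis
  proof (cases k rule: int_cases2)
    case (nonneg n)
    with nat[of n] show ?thesis by simp
  next
    case (nonpos n)
    with neg[OF nat[of n]] show ?thesis by simp
  qed
qed

text \<open>The line is spanned by an accumulation point of the directions of the small elements.\<close>

lemma closed_subgroup_line: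
  fixes N :: "complex set"
  assumes cl: "closed N" and 0: "0 \<in> N" and diff: "\<And>x y. x \<in> N \<Longrightarrow> y \<in> N \<Longrightarrow> x - y \<in> N"
    and x: "\<And>n. x n \<in> N" "\<And>n. x n \<noteq> 0" "x \<longlonglongrightarrow> 0"
  shows "\<exists>v. v \<noteq> 0 \<and> (\<forall>t. of_real t * v \<in> N)"
proof -
  define u where "u = (\<lambda>n. x n / of_real (norm (x n)))"
  have "u n \<in> sphere 0 1" for n using x(2) by (simp add: u_def norm_divide)
  then obtain v r where v: "v \<in> sphere 0 1" "strict_mono r" "(u \<circ> r) \<longlonglongrightarrow> v"
    using compact_sphere[of "0 :: complex" 1] unfolding compact_def by (metis (no_types, lifting))
  have "of_real t * v \<in> N" for t
  proof -
    define e where "e = (\<lambda>n. norm (x (r n)))"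
    have e: "e n > 0" for n using x(2) by (simp add: e_def)
    have e0: "e \<longlonglongrightarrow> 0"
      using LIMSEQ_subseq_LIMSEQ[OF tendsto_norm[OF x(3)] v(2)] by (simp add: e_def comp_def)
    \<comment> \<open>The greatest integer multiple of \<open>e n\<close> not exceeding
      \<open>t\<close>. Then \<open>a n\<close> times the unit direction \<open>u (r n)\<close> is
      an integer multiple of \<open>x (r n)\<close>, hence in \<open>N\<close>, and it converges to
      \<open>t\<close> times \<open>v\<close>.\<close>
    define a where "a = (\<lambda>n. of_int \<lfloor>t / e n\<rfloor> * e n)"
    have "a \<longlonglongrightarrow> t"
    proof (rule LIMSEQ_I)
      fix d :: real assume "d > 0"
      then obtain n0 where n0: "\<And>n. n \<ge> n0 \<Longrightarrow> e n < d"
        using e0 e by (fastforce simp: LIMSEQ_def dist_real_def)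
      have "norm (a n - t) < d" if "n \<ge> n0" for n
      proof -
        have "of_int \<lfloor>t / e n\<rfloor> \<le> t / e n" "t / e n < of_int \<lfloor>t / e n\<rfloor> + 1" by linarith+
        then have "of_int \<lfloor>t / e n\<rfloor> * e n \<le> t" "t < (of_int \<lfloor>t / e n\<rfloor> + 1) * e n"
          by (simp_all only: pos_le_divide_eq[OF e] pos_divide_less_eq[OF e])
        then have "a n \<le> t" "t < a n + e n" by (simp_all add: a_def distrib_right)
        then show ?thesis using n0[OF that] by simp
      qed
      then show "\<exists>n0. \<forall>n\<ge>n0. norm (a n - t) < d" by blast
    qed
    then have "(\<lambda>n. of_real (a n) * u (r n)) \<longlonglongrightarrow> of_real t * v"
      using v(3) unfolding comp_def by (intro tendsto_intros)
    moreover have "of_real (a n) * u (r n) \<in> N" for n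
    proof -
      have "of_real (a n) * u (r n) = of_int \<lfloor>t / e n\<rfloor> * x (r n)"
        using x(2)[of "r n"] by (simp add: a_def u_def e_def)
      then show ?thesis using int_multiple_closed[OF 0 diff x(1)] by simp
    qed
    ultimately show ?thesis using closed_sequentially[OF cl] by (metis (no_types, lifting))
  qed
  moreover have "v \<noteq> 0" using v(1) by auto
  ultimately show ?thesis by blast
qed

text \<open>The elements \<open>z ^ n * x0\<close> shrink to 0, so \<open>N\<close> contains a real
  line. For real \<open>z\<close> the line is everything; otherwise the line and its image under
  \<open>z\<close> span the plane.\<close>

lemma closed_subgroup_spiral:
  assumes z: "z \<noteq> 0" "norm z < 1"
    and N: "N \<subseteq> spiral_carrier z" and cl: "closed N" and 0: "0 \<in> N"
    and diff: "\<And>x y. x \<in> N \<Longrightarrow> y \<in> N \<Longrightarrow> x - y \<in> N"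
    and mult: "\<And>x. x \<in> N \<Longrightarrow> z * x \<in> N" and ne: "N \<noteq> {0}"
  shows "N = spiral_carrier z"
proof -
  obtain x0 where x0: "x0 \<in> N" "x0 \<noteq> 0" using 0 ne by blast
  have "z ^ n * x0 \<in> N" for n
  proof (induction n)
    case (Suc n)
    from mult[OF this] show ?case by (simp add: mult.assoc)
  qed (use x0 in simp)
  moreover have "(\<lambda>n. z ^ n * x0) \<longlonglongrightarrow> 0" 
    using tendsto_mult_right[OF LIMSEQ_power_zero[OF z(2)], of x0] by simp
  ultimately obtain v where v: "v \<noteq> 0" "\<And>t. of_real t * v \<in> N"
    using closed_subgroup_line[OF cl 0 diff, of "\<lambda>n. z ^ n * x0"] x0 z(1) by auto
  show ?thesis
  proof (cases "z \<in> \<real>")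
    case True
    have "v \<in> N" using v(2)[of 1] by simp
    then obtain b where b: "v = of_real b" using N True by (auto simp: spiral_carrier_def elim!: Reals_cases)
    have "w \<in> N" if w: "w \<in> spiral_carrier z" for w
    proof -
      obtain a where "w = of_real a" using w True by (auto simp: spiral_carrier_def elim!: Reals_cases)
      then have "w = of_real (a / b) * v" using b v(1) by simp
      with v(2)[of "a / b"] show ?thesis by (simp only:)
    qed
    with N show ?thesis by blast
  next
    case False
    then have im: "Im z \<noteq> 0" by (simp add: complex_is_Real_iff)
    have "w \<in> N" for w
    proof -
      \<comment> \<open>\<open>a\<close> and \<open>b\<close> are the real coordinates of
        \<open>w / v\<close> in the basis 1, \<open>z\<close>.\<close>
      define b where "b = Im (w / v) / Im z"
      define a where "a = Re (w / v) - b * Re z"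
      have "w / v = of_real a + of_real b * z" using im by (simp add: complex_eq_iff a_def b_def)
      then have "w = of_real a * v - z * (of_real (- b) * v)" using v(1) by (simp add: field_simps)
      with diff[OF v(2)[of a] mult[OF v(2)[of "- b"]]] show ?thesis by (simp only:)
    qed
    then show ?thesis using False by (auto simp: spiral_carrier_def)
  qed
qed

theorem spiral_contraction_group:
  assumes z: "z \<noteq> 0" "norm z < 1"
  shows "simple_lc_contraction_group (spiral_group z) (spiral_topology z) ((*) z)"
    and "connected_space (spiral_topology z)"
proof -
  let ?G = "spiral_group z" and ?T = "spiral_topology z"
  have sel [simp]: "carrier ?G = spiral_carrier z" "mult ?G = (+)" "one ?G = 0" "topspace ?T = spiral_carrier z"
    by (auto simp: spiral_group_def spiral_topology_def)
  interpret group ?G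
    by (rule groupI) (auto intro: spiral_carrier_add spiral_carrier_zero
        intro!: bexI[of _ "- x" for x] spiral_carrier_uminus)
  have inv [simp]: "inv\<^bsub>?G\<^esub> x = - x" if "x \<in> spiral_carrier z" for x
    by (rule inv_equality) (use that in \<open>auto intro: spiral_carrier_uminus\<close>)
  have bij: "bij_betw ((*) z) (spiral_carrier z) (spiral_carrier z)"
  proof (rule bij_betw_imageI)
    show "inj_on ((*) z) (spiral_carrier z)" using z(1) by (auto simp: inj_on_def)
    have "w \<in> (*) z ` spiral_carrier z" if "w \<in> spiral_carrier z" for w
      using that z(1) by (intro image_eqI[of _ _ "w / z"]) (auto simp: spiral_carrier_def)
    then show "(*) z ` spiral_carrier z = spiral_carrier z" using spiral_carrier_mult by auto
  qed
  have cm: "continuous_map ?T ?T ((*) w)" if "\<And>x. x \<in> spiral_carrier z \<Longrightarrow> w * x \<in> spiral_carrier z" for w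
    using that unfolding spiral_topology_def
    by (auto simp: continuous_map_in_subtopology continuous_map_iff_continuous intro!: continuous_intros)
  have iter: "((*) z ^^ n) x = z ^ n * x" for n x by (induction n) auto
  show "simple_lc_contraction_group ?G ?T ((*) z)"
  proof unfold_locales
    show "topspace ?T = carrier ?G" by simp
    show "continuous_map (prod_topology ?T ?T) ?T (\<lambda>(x, y). x \<otimes>\<^bsub>?G\<^esub> y)"
    proof -
      have "prod_topology ?T ?T = top_of_set (spiral_carrier z \<times> spiral_carrier z)"
        by (simp only: spiral_topology_def prod_topology_subtopology_eu)
      then show ?thesis
        unfolding spiral_topology_def
        by (auto simp: continuous_map_in_subtopology continuous_map_iff_continuous case_prod_beta
            intro!: continuous_intros spiral_carrier_add)
    qed
    show "continuous_map ?T ?T (\<lambda>x. inv\<^bsub>?G\<^esub> x)"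
    proof (rule continuous_map_eq)
      show "continuous_map ?T ?T ((*) (- 1))" by (rule cm) (simp add: spiral_carrier_uminus)
    qed simp
    show "Hausdorff_space ?T" unfolding spiral_topology_def
      by (intro Hausdorff_space_subtopology Hausdorff_space_euclidean)
    show "locally_compact_space ?T" unfolding spiral_topology_def
      using closed_spiral_carrier by (intro locally_compact_space_closed_subset locally_compact_space_euclidean) simp
    show "(*) z \<in> iso ?G ?G"
      using bij by (auto simp: iso_def hom_def distrib_left spiral_carrier_mult)
    show "homeomorphic_map ?T ?T ((*) z)"
      unfolding homeomorphic_map_maps
    proof (intro exI)
      have "w * inverse z \<in> spiral_carrier z" if "w \<in> spiral_carrier z" for w
        using that by (auto simp: spiral_carrier_def)
      then show "homeomorphic_maps ?T ?T ((*) z) ((*) (inverse z))"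
        using z(1) spiral_carrier_mult unfolding homeomorphic_maps_def
        by (intro conjI cm) (auto simp: mult.commute)
    qed
    show "limitin ?T (\<lambda>n. ((*) z ^^ n) x) \<one>\<^bsub>?G\<^esub> sequentially" if "x \<in> carrier ?G" for x
    proof -
      have "z ^ n * x \<in> spiral_carrier z" for n
        by (induction n) (use that spiral_carrier_mult in \<open>auto simp: mult.assoc\<close>)
      moreover have "(\<lambda>n. z ^ n * x) \<longlonglongrightarrow> 0" 
        using tendsto_mult_right[OF LIMSEQ_power_zero[OF z(2)], of x] by simp
      ultimately show ?thesis
        unfolding spiral_topology_def limitin_subtopology by (simp add: iter spiral_carrier_zero)
    qed
    show "carrier ?G \<noteq> {\<one>\<^bsub>?G\<^esub>}"
    proof
      assume "carrier ?G = {\<one>\<^bsub>?G\<^esub>}"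
      then have "spiral_carrier z = {0}" by simp
      with spiral_carrier_real[of 1 z] show False by simp
    qed
    show "N = {\<one>\<^bsub>?G\<^esub>} \<or> N = carrier ?G"
      if N: "N \<lhd> ?G" "closedin ?T N" "(*) z ` N = N" for N
    proof -
      interpret N: normal N ?G by fact
      have sub: "N \<subseteq> spiral_carrier z" using N.subset by simp
      have cl: "closed N"
        by (rule closedin_closed_trans[OF N(2)[unfolded spiral_topology_def] closed_spiral_carrier])
      have diff: "x - y \<in> N" if "x \<in> N" "y \<in> N" for x y
      proof -
        have "inv\<^bsub>?G\<^esub> y = - y" using sub that(2) by (intro inv) blast
        then show ?thesis using N.m_closed[OF that(1) N.m_inv_closed[OF that(2)]] by simp
      qed
      have mult: "z * x \<in> N" if "x \<in> N" for x using imageI[OF that, of "(*) z"] N(3) by simp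
      have "0 \<in> N" using N.one_closed by simp
      show ?thesis
        using closed_subgroup_spiral[OF z sub cl \<open>0 \<in> N\<close> diff mult] by (cases "N = {0}") simp_all
    qed
  qed
  show "connected_space ?T"
    using convex_connected[OF convex_spiral_carrier, of z]
    by (simp add: spiral_topology_def connectedin_iff_connected[symmetric] connectedin_def)
qed

section \<open>Identification of the connected simple groups with the models\<close>

context lc_contraction_group begin

lemma continuous_complex_hom:
  assumes hom: "\<And>x y. x \<in> carrier G \<Longrightarrow> y \<in> carrier G \<Longrightarrow> f (x \<otimes> y) = f x + (f y :: complex)"
    and small: "\<And>e. e > 0 \<Longrightarrow> \<exists>W. openin T W \<and> \<one> \<in> W \<and> (\<forall>x\<in>W. norm (f x) < e)"
  shows "continuous_map T euclidean f"
  unfolding continuous_map_def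
proof (intro conjI allI impI)
  fix V :: "complex set" assume "openin euclidean V"
  then have V: "open V" by simp
  show "openin T {x \<in> topspace T. f x \<in> V}"
  proof (subst openin_subopen, rule ballI)
    fix x assume x: "x \<in> {x \<in> topspace T. f x \<in> V}"
    then have xc: "x \<in> carrier G" by (simp add: topspace_eq_carrier)
    obtain e where e: "e > 0" "ball (f x) e \<subseteq> V" using V x by (auto simp: open_contains_ball)
    obtain W where W: "openin T W" "\<one> \<in> W" "\<forall>x\<in>W. norm (f x) < e"
      using small[OF e(1)] by (elim exE conjE)
    have "f y \<in> V" if y: "y \<in> carrier G" "inv x \<otimes> y \<in> W" for y
    proof -
      have "f (x \<otimes> (inv x \<otimes> y)) = f x + f (inv x \<otimes> y)" using xc y by (intro hom) auto
      moreover have "x \<otimes> (inv x \<otimes> y) = y" using xc y by (simp add: m_assoc[symmetric])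
      ultimately have "f y \<in> ball (f x) e" using W(3) y(2) by (simp add: dist_norm)
      with e(2) show ?thesis by blast
    qed
    then show "\<exists>X. openin T X \<and> x \<in> X \<and> X \<subseteq> {x \<in> topspace T. f x \<in> V}"
      using openin_translate[OF W(1), of "inv x"] xc W(2)
      by (intro exI[of _ "{y \<in> carrier G. inv x \<otimes> y \<in> W}"]) (auto simp: topspace_eq_carrier)
  qed
qed simp

end

context simple_lc_contraction_group begin

lemma invariant_hom_injective:
  assumes hom: "\<And>x y. x \<in> carrier G \<Longrightarrow> y \<in> carrier G \<Longrightarrow> f (x \<otimes> y) = f x + (f y :: complex)"
    and cont: "continuous_map T euclidean f"
    and eig: "\<And>x. x \<in> carrier G \<Longrightarrow> f (\<alpha> x) = z * f x" and z: "z \<noteq> 0"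
    and ne: "x0 \<in> carrier G" "f x0 \<noteq> 0"
  shows "inj_on f (carrier G)"
proof -
  define N where "N = {x \<in> carrier G. f x = 0}"
  have f1: "f \<one> = 0" using hom[of \<one> \<one>] by simp
  have finv: "f (inv x) = - f x" if "x \<in> carrier G" for x
    using hom[of "inv x" x] that f1 by (simp add: eq_neg_iff_add_eq_0)
  have "subgroup N G"
    by (rule subgroupI) (auto simp: N_def f1 finv hom intro: exI[of _ \<one>])
  then have "N \<lhd> G" by (rule normal_invI) (auto simp: N_def hom finv)
  moreover have "closedin T N"
    using closedin_continuous_map_preimage[OF cont, of "{0}"] by (simp add: N_def topspace_eq_carrier)
  moreover have "\<alpha> ` N = N"
  proof
    show "\<alpha> ` N \<subseteq> N" using iter_closed[of _ 1] by (auto simp: N_def eig)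
    show "N \<subseteq> \<alpha> ` N"
    proof
      fix y assume y: "y \<in> N"
      then obtain x where x: "x \<in> carrier G" "y = \<alpha> x" using iter_image[of 1] by (auto simp: N_def)
      then show "y \<in> \<alpha> ` N" using y eig z by (auto simp: N_def)
    qed
  qed
  ultimately have "N = {\<one>}" using simple[of N] ne by (auto simp: N_def)
  show ?thesis
  proof (rule inj_onI)
    fix x y assume xy: "x \<in> carrier G" "y \<in> carrier G" "f x = f y"
    then have "x \<otimes> inv y \<in> N" by (simp add: N_def hom finv)
    then have "x \<otimes> inv y = \<one>" using \<open>N = {\<one>}\<close> by simp
    then show "x = y" using xy inv_equality[of x "inv y"] by simp
  qed
qed

theorem connected_iso_spiral:
  assumes conn: "connected_space T"
  shows "\<exists>f z. z \<noteq> 0 \<and> norm z < 1 \<and>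
    contraction_group_isomorphism G T \<alpha> (spiral_group z) (spiral_topology z) ((*) z) f"
proof -
  obtain U P where UP: "compactin T U" "openin T P" "\<one> \<in> P" "P \<subseteq> U" 
      "\<forall>x\<in>U. inv x \<in> U" "\<forall>x\<in>U. \<alpha> x \<in> U"
    using absorbing_neighbourhood_exists by (elim exE conjE)
  interpret ab: absorbing_neighbourhood G T \<alpha> U P using UP by unfold_locales simp_all
  define B where "B = ab.B"
  obtain s where "self_similar_group G ab.B s \<alpha>" using ab.self_similar[OF conn nontrivial] ..
  then interpret ss: self_similar_group G B s \<alpha> by (simp add: B_def)
  obtain f z where f: "ss.complex_hom f" and ne: "\<exists>x\<in>carrier G. f x \<noteq> 0"
    and eig: "\<forall>x\<in>carrier G. f (\<alpha> x) = z * f x" and z: "z \<noteq> 0" "norm z < 1"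
    and real: "z \<in> \<real> \<longrightarrow> (\<forall>x\<in>carrier G. f x \<in> \<real>)"
    using ss.eigen_hom by (elim exE conjE)
  note hom = ss.complex_hom_mult[OF f]
  have cont: "continuous_map T euclidean f"
  proof (rule continuous_complex_hom[OF hom])
    fix e :: real assume "e > 0"
    then have "e / 2 > 0" by simp
    from ss.complex_hom_continuous[OF f this] obtain m where m: "\<forall>x\<in>B m. norm (f x) \<le> e / 2" ..
    obtain W where W: "openin T W" "\<one> \<in> W" "W \<subseteq> B m" using ab.B_neighbourhood[of m] unfolding B_def .
    have "norm (f x) < e" if "x \<in> W" for x
    proof -
      have "norm (f x) \<le> e / 2" using m W(3) that by blast
      then show ?thesis using \<open>e > 0\<close> by simp
    qed
    with W show "\<exists>W. openin T W \<and> \<one> \<in> W \<and> (\<forall>x\<in>W. norm (f x) < e)" by blast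
  qed simp_all
  obtain x0 where x0: "x0 \<in> carrier G" "f x0 \<noteq> 0" using ne by blast
  have inj: "inj_on f (carrier G)"
    by (rule invariant_hom_injective[OF hom cont _ z(1) x0]) (use eig in simp_all)
  have f1: "f \<one> = 0" by (rule ss.complex_hom_one[OF f])
  have iter_f: "f (iter n x) = z ^ n * f x" if "x \<in> carrier G" for n x
    by (induction n) (use that eig in simp_all)
  have compf: "compact (f ` D)" if "compactin T D" for D
    using image_compactin[OF that cont] by simp
  \<comment> \<open>A compact set avoiding the identity, so by injectivity f is bounded away from 0
    on it. It contains the shell between \<open>B 0\<close> and \<open>B 1\<close>, to which points
    outside \<open>B 0\<close> can be brought by iterating \<alpha>.\<close>
  define D where "D = B 1 - P"
  have "compactin T D"
  proof -
    have "D = (topspace T - P) \<inter> B 1" using ab.B_sub by (auto simp: D_def B_def topspace_eq_carrier)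
    then show ?thesis using UP(2) ab.B_compact[of 1] by (simp add: B_def closed_Int_compactin closedin_diff)
  qed
  then have "closed (f ` D)" by (intro compact_imp_closed compf)
  moreover have "0 \<notin> f ` D"
  proof
    assume "0 \<in> f ` D"
    then obtain x where x: "x \<in> D" "f x = 0" by auto
    then have "x \<in> carrier G" using ab.B_sub by (auto simp: D_def B_def)
    then have "x = \<one>" using inj_onD[OF inj, of x \<one>] x(2) f1 by simp
    with x(1) UP(3) show False by (simp add: D_def)
  qed
  ultimately have "\<exists>c>0. \<forall>w\<in>f ` D. c \<le> dist 0 w" by (rule separate_point_closed)
  then obtain c where c: "c > 0" "\<forall>w\<in>f ` D. c \<le> dist 0 w" by (elim exE conjE)
  have P0: "P \<subseteq> B 0" using UP(4) by (simp add: B_def ab.B_zero)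
  \<comment> \<open>Take the first \<open>n\<close> with \<open>x\<close> in
    \<open>B (int n)\<close>. Then \<open>iter (n - 1) x\<close> lies in the shell, where f is at
    least \<open>c\<close>, and its value is \<open>f x\<close> times
    \<open>z ^ (n - 1)\<close>.\<close>
  have large: "c / norm z ^ m \<le> norm (f x)" if x: "x \<in> carrier G" "x \<notin> B (int m)" for x m
  proof -
    obtain n1 where n1: "x \<in> B n1" using ss.B_exhaust[OF x(1)] ..
    have ex: "x \<in> B (int (nat n1))" using ss.B_mono[of n1 "int (nat n1)"] n1 by auto
    define n where "n = (LEAST n. x \<in> B (int n))"
    have n: "x \<in> B (int n)" unfolding n_def by (rule LeastI[of "\<lambda>n. x \<in> B (int n)", OF ex])
    have "\<not> n \<le> m" using ss.B_mono[of "int n" "int m"] n x(2) by auto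
    then obtain j where j: "n = Suc j" "m \<le> j" by (cases n) auto
    have "x \<notin> B (int j)" using not_less_Least[of j "\<lambda>n. x \<in> B (int n)"] j by (simp add: n_def)
    then have "iter j x \<notin> B (int j - int j)" using ss.iter_B[OF x(1)] by blast
    moreover have "iter j x \<in> B (int n - int j)" using ss.iter_B[OF x(1)] n by blast
    ultimately have "iter j x \<in> D" using j(1) P0 by (auto simp: D_def)
    then have "c \<le> dist 0 (f (iter j x))" by (intro bspec[OF c(2)] imageI)
    then have "c \<le> norm z ^ j * norm (f x)" using iter_f[OF x(1)] by (simp add: norm_mult norm_power)
    also have "\<dots> \<le> norm z ^ m * norm (f x)"
      using j(2) z(2) by (intro mult_right_mono power_decreasing) auto
    finally show ?thesis using z(1) by (simp add: field_simps)
  qed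
  \<comment> \<open>The same estimate after pulling back by \<open>iter k\<close>. It says that the
    inverse of f is continuous at 0, which gives openness of f.\<close>
  have small: "x \<in> B (- int k)" if x: "x \<in> carrier G" "norm (f x) < norm z ^ k * c" for x k
  proof (rule ccontr)
    assume a: "x \<notin> B (- int k)"
    obtain y where y: "y \<in> carrier G" "x = iter k y" using x(1) iter_image[of k] by blast
    have "y \<notin> B (int 0)" using ss.iter_B[OF y(1), of k 0] a y(2) by simp
    from large[OF y(1) this] have "norm z ^ k * c \<le> norm z ^ k * norm (f y)" by (intro mult_left_mono) auto
    then show False using x(2) y iter_f[OF y(1)] by (simp add: norm_mult norm_power)
  qed
  define N where "N = f ` carrier G"
  have Nsub: "N \<subseteq> spiral_carrier z" using real by (auto simp: N_def spiral_carrier_def)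
  have Nclosed: "closed N"
    unfolding closed_sequential_limits
  proof (intro allI impI)
    fix y w assume a: "(\<forall>n. y n \<in> N) \<and> y \<longlonglongrightarrow> w"
    then have "Bseq y" by (intro convergent_imp_Bseq) (auto simp: convergent_def)
    then obtain R where R: "\<And>n. norm (y n) \<le> R" by (auto simp: Bseq_def)
    obtain m where m: "R / c < (1 / norm z) ^ m"
      using real_arch_pow[of "1 / norm z" "R / c"] z by auto
    have Rm: "R < c / norm z ^ m" using m c(1) by (simp add: field_simps)
    \<comment> \<open>Properness: bounded values come from one compact ball, whose image is closed
      and therefore contains the limit.\<close>
    have yB: "y n \<in> f ` B (int m)" for n
    proof -
      obtain x where x: "x \<in> carrier G" "y n = f x" using a by (auto simp: N_def)
      have "x \<in> B (int m)"
      proof (rule ccontr)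
        assume "x \<notin> B (int m)"
        from large[OF x(1) this] R[of n] Rm x(2) show False by simp
      qed
      then show ?thesis using x(2) by blast
    qed
    have "closed (f ` B (int m))" unfolding B_def by (intro compact_imp_closed compf ab.B_compact)
    from closed_sequentially[OF this, of y w] yB a have "w \<in> f ` B (int m)" by blast
    then show "w \<in> N" using ab.B_sub by (auto simp: N_def B_def)
  qed
  have N0: "0 \<in> N" unfolding N_def by (rule image_eqI[of _ _ \<one>]) (simp_all add: f1)
  have Ndiff: "x - y \<in> N" if xy: "x \<in> N" "y \<in> N" for x y
  proof -
    obtain u v where uv: "u \<in> carrier G" "v \<in> carrier G" "x = f u" "y = f v" using xy by (auto simp: N_def)
    then have "x - y = f (u \<otimes> inv v)" by (simp add: hom ss.complex_hom_inv[OF f])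
    then show ?thesis using uv by (simp add: N_def)
  qed
  have Nmult: "z * x \<in> N" if x: "x \<in> N" for x
  proof -
    obtain u where u: "u \<in> carrier G" "x = f u" using x by (auto simp: N_def)
    then have "z * x = f (\<alpha> u)" "\<alpha> u \<in> carrier G" using eig iter_closed[OF u(1), of 1] by auto
    then show ?thesis by (simp add: N_def)
  qed
  have "f x0 \<in> N" using x0 by (simp add: N_def)
  then have "N \<noteq> {0}" using x0(2) by blast
  then have NK: "f ` carrier G = spiral_carrier z"
    using closed_subgroup_spiral[OF z Nsub Nclosed N0 Ndiff Nmult] by (simp add: N_def)
  have "homeomorphic_map T (spiral_topology z) f"
  proof (rule bijective_open_imp_homeomorphic_map)
    show "continuous_map T (spiral_topology z) f"
      using cont NK by (auto simp: spiral_topology_def continuous_map_in_subtopology topspace_eq_carrier)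
    show "f ` topspace T = topspace (spiral_topology z)" using NK by (simp add: topspace_eq_carrier spiral_topology_def)
    show "inj_on f (topspace T)" using inj by (simp add: topspace_eq_carrier)
    show "open_map T (spiral_topology z) f"
      unfolding open_map_def
    proof (intro allI impI)
      fix W assume W: "openin T W"
      then have WG: "W \<subseteq> carrier G" using openin_subset topspace_eq_carrier by blast
      have "\<exists>e>0. \<forall>y'\<in>spiral_carrier z. dist y' y < e \<longrightarrow> y' \<in> f ` W" if y: "y \<in> f ` W" for y
      proof -
        obtain x where x: "x \<in> W" "y = f x" using y by blast
        then have xc: "x \<in> carrier G" using WG by blast
        have "openin T {v \<in> carrier G. x \<otimes> v \<in> W}" by (rule openin_translate[OF W xc])
        moreover have "\<one> \<in> {v \<in> carrier G. x \<otimes> v \<in> W}" using x xc by simp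
        ultimately obtain k :: nat where k: "B (- int k) \<subseteq> {v \<in> carrier G. x \<otimes> v \<in> W}"
          using ab.B_small unfolding B_def by blast
        have "y' \<in> f ` W" if y': "y' \<in> spiral_carrier z" "dist y' y < norm z ^ k * c" for y'
        proof -
          obtain x' where x': "x' \<in> carrier G" "y' = f x'" using y'(1) NK by blast
          have "f (inv x \<otimes> x') = y' - y" using x x' xc by (simp add: hom ss.complex_hom_inv[OF f])
          then have "inv x \<otimes> x' \<in> B (- int k)" using y'(2) x' xc by (intro small) (auto simp: dist_norm)
          then have "x \<otimes> (inv x \<otimes> x') \<in> W" using k by blast
          then have "x' \<in> W" using xc x' by (simp add: m_assoc[symmetric])
          then show ?thesis using x'(2) by blast
        qed
        then show ?thesis using c(1) z(1) by (intro exI[of _ "norm z ^ k * c"]) simp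
      qed
      then show "openin (spiral_topology z) (f ` W)"
        unfolding spiral_topology_def openin_euclidean_subtopology_iff using WG NK by blast
    qed
  qed
  moreover have "f \<in> iso G (spiral_group z)"
    using inj NK by (auto simp: iso_def hom_def bij_betw_def spiral_group_def hom)
  ultimately have "contraction_group_isomorphism G T \<alpha> (spiral_group z) (spiral_topology z) ((*) z) f"
    using eig by (simp add: contraction_group_isomorphism_def)
  with z show ?thesis by blast
qed

end

section \<open>The identity component\<close>

context simple_lc_contraction_group begin

theorem connected_or_totally_disconnected: "connected_space T \<or> totally_disconnected_space T"
proof -
  define C where "C = connected_component_of_set T \<one>"
  have oneT: "\<one> \<in> topspace T" by (simp add: topspace_eq_carrier)
  have C1: "\<one> \<in> C" using oneT by (simp add: C_def connected_component_of_refl)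
  have CG: "C \<subseteq> carrier G" using connected_component_of_subset_topspace[of T \<one>] by (simp add: C_def topspace_eq_carrier)
  have Cconn: "connectedin T C" by (simp add: C_def connectedin_connected_component_of)
  \<comment> \<open>All the stability properties of \<open>C\<close> (under division, conjugation,
    \<alpha> and its inverse) are instances of this, as is the comparison with the components of
    other points.\<close>
  have into: "g ` S \<subseteq> C" if "continuous_map T T g" "connectedin T S" "x \<in> S" "g x = \<one>" for g S x
  proof -
    have "connectedin T (g ` S)" using connectedin_continuous_map_image that by blast
    moreover have "\<one> \<in> g ` S" using that by (metis imageI)
    ultimately show ?thesis unfolding C_def by (rule connected_component_of_maximal)
  qed
  have div: "inv a \<otimes> b \<in> C" if "a \<in> C" "b \<in> C" for a b
    using into[OF continuous_translate[of "inv a"] Cconn that(1)] that CG by (auto simp: subset_iff)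
  have Cinv: "inv a \<in> C" if "a \<in> C" for a using div[OF that C1] that CG by (simp add: subset_iff)
  have "subgroup C G"
  proof (rule subgroupI)
    fix a b assume ab: "a \<in> C" "b \<in> C"
    show "inv a \<in> C" using Cinv ab by blast
    have "inv (inv a) \<otimes> b \<in> C" using div Cinv ab by blast
    then show "a \<otimes> b \<in> C" using ab CG by (simp add: subset_iff)
  qed (use CG C1 in auto)
  then have "C \<lhd> G"
  proof (rule normal_invI)
    fix x h assume x: "x \<in> carrier G" and h: "h \<in> C"
    have "continuous_map T T (\<lambda>y. x \<otimes> y \<otimes> inv x)"
      by (intro continuous_mult) (use x in \<open>simp_all add: topspace_eq_carrier\<close>)
    from into[OF this Cconn C1] show "x \<otimes> h \<otimes> inv x \<in> C" using x h by auto
  qed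
  moreover have "closedin T C" by (simp add: C_def closedin_connected_component_of)
  moreover have "\<alpha> ` C = C"
  proof
    have a1: "\<alpha> \<one> = \<one>" using iter_one[of 1] by simp
    show "\<alpha> ` C \<subseteq> C"
      by (rule into[of \<alpha>, OF homeomorphic_imp_continuous_map[OF bicontinuous] Cconn C1 a1])
    obtain g where g: "homeomorphic_maps T T \<alpha> g" using bicontinuous homeomorphic_map_maps by blast
    then have g1: "g \<one> = \<one>" using a1 oneT unfolding homeomorphic_maps_def by metis
    have "continuous_map T T g" using g by (simp add: homeomorphic_maps_def)
    then have gC: "g ` C \<subseteq> C" using Cconn C1 g1 by (rule into)
    show "C \<subseteq> \<alpha> ` C"
    proof
      fix x assume x: "x \<in> C"
      then have "x = \<alpha> (g x)" using g CG by (auto simp: homeomorphic_maps_def topspace_eq_carrier)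
      then show "x \<in> \<alpha> ` C" using gC x by blast
    qed
  qed
  ultimately consider "C = {\<one>}" | "C = carrier G" using simple[of C] by blast
  then show ?thesis
  proof cases
    case 1
    have "connected_component_of_set T x = {x}" if "x \<in> topspace T" for x
    proof
      have xc: "x \<in> carrier G" using that by (simp add: topspace_eq_carrier)
      have xx: "x \<in> connected_component_of_set T x" using that by (simp add: connected_component_of_refl)
      then show "{x} \<subseteq> connected_component_of_set T x" by simp
      have "(\<lambda>y. inv x \<otimes> y) ` connected_component_of_set T x \<subseteq> C"
        using xc by (intro into[OF continuous_translate connectedin_connected_component_of xx]) auto
      moreover have "connected_component_of_set T x \<subseteq> carrier G"
        using connected_component_of_subset_topspace[of T x] by (simp add: topspace_eq_carrier)
      ultimately have "y = x" if "y \<in> connected_component_of_set T x" for y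
        using that 1 xc by (metis (no_types, lifting) image_subset_iff inv_closed inv_inv inv_equality singletonD subsetD inv_solve_left r_one one_closed)
      then show "connected_component_of_set T x \<subseteq> {x}" by blast
    qed
    then show ?thesis by (simp add: totally_disconnected_space_def)
  next
    case 2
    then show ?thesis using Cconn topspace_eq_carrier connectedin_topspace by metis
  qed
qed

end

section \<open>Transport of structure\<close>

lemma (in group) iso_cong:
  assumes "h \<in> iso G H" "\<And>x. x \<in> carrier G \<Longrightarrow> h x = k x" shows "k \<in> iso G H"
proof -
  have "bij_betw k (carrier G) (carrier H)"
    using assms bij_betw_cong[of "carrier G" h k] by (simp add: iso_def)
  moreover have "k \<in> hom G H"
    using assms(1) by (auto simp: iso_def hom_def Pi_iff assms(2)[symmetric])
  ultimately show ?thesis by (simp add: iso_def)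
qed

lemma contraction_group_isomorphism_trans:
  assumes "contraction_group_isomorphism G S \<alpha> H T \<beta> \<phi>" "contraction_group_isomorphism H T \<beta> K U \<gamma> \<psi>"
  shows "contraction_group_isomorphism G S \<alpha> K U \<gamma> (\<psi> \<circ> \<phi>)"
proof -
  have "\<phi> x \<in> carrier H" if "x \<in> carrier G" for x
    using assms(1) that by (auto simp: contraction_group_isomorphism_def iso_def bij_betw_def)
  then show ?thesis
    using assms unfolding contraction_group_isomorphism_def
    by (auto intro: iso_set_trans homeomorphic_map_compose)
qed

text \<open>The continuous inverse \<psi> and the algebraic inverse \<open>inv_into\<close> agree on
  the carrier, so one map has both properties. It is returned with \<open>homeomorphic_maps\<close>
  because the transport below needs it as the inverse of \<phi>.\<close>

lemma contraction_group_isomorphism_sym: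
  assumes G: "group G" and top: "topspace S = carrier G" and \<alpha>: "\<alpha> ` carrier G \<subseteq> carrier G"
    and iso: "contraction_group_isomorphism G S \<alpha> H T \<beta> \<phi>"
  shows "\<exists>\<psi>. contraction_group_isomorphism H T \<beta> G S \<alpha> \<psi> \<and> homeomorphic_maps S T \<phi> \<psi>"
proof -
  have \<phi>: "\<phi> \<in> iso G H" "homeomorphic_map S T \<phi>" "\<And>x. x \<in> carrier G \<Longrightarrow> \<beta> (\<phi> x) = \<phi> (\<alpha> x)"
    using iso by (auto simp: contraction_group_isomorphism_def)
  obtain \<psi> where \<psi>: "homeomorphic_maps S T \<phi> \<psi>" using \<phi>(2) homeomorphic_map_maps by blast
  have im: "\<phi> ` carrier G = carrier H" "inj_on \<phi> (carrier G)" using \<phi>(1) by (auto simp: iso_def bij_betw_def)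
  have \<psi>\<phi>: "\<psi> (\<phi> x) = x" if "x \<in> carrier G" for x using \<psi> that top by (simp add: homeomorphic_maps_def)
  have inv: "inv_into (carrier G) \<phi> \<in> iso H G" by (rule group.iso_set_sym[OF G \<phi>(1)])
  have eq: "\<psi> y = inv_into (carrier G) \<phi> y" if "y \<in> carrier H" for y
    using that im(1) \<psi>\<phi> inv_into_f_f[OF im(2)] by force
  have "bij_betw \<psi> (carrier H) (carrier G)"
    using inv bij_betw_cong[of "carrier H" \<psi>, OF eq] by (simp add: iso_def)
  moreover have "\<psi> \<in> hom H G"
  proof (rule homI)
    show "\<psi> x \<in> carrier G" if "x \<in> carrier H" for x using that im(1) \<psi>\<phi> by force
    fix x y assume "x \<in> carrier H" "y \<in> carrier H"
    then obtain u v where uv: "u \<in> carrier G" "v \<in> carrier G" "x = \<phi> u" "y = \<phi> v" using im(1) by blast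
    have "u \<otimes>\<^bsub>G\<^esub> v \<in> carrier G" using uv G by (simp add: group.is_monoid monoid.m_closed)
    moreover have "x \<otimes>\<^bsub>H\<^esub> y = \<phi> (u \<otimes>\<^bsub>G\<^esub> v)" using \<phi>(1) uv by (simp add: iso_def hom_def)
    ultimately show "\<psi> (x \<otimes>\<^bsub>H\<^esub> y) = \<psi> x \<otimes>\<^bsub>G\<^esub> \<psi> y" using uv \<psi>\<phi> by simp
  qed
  ultimately have "\<psi> \<in> iso H G" by (simp add: iso_def)
  moreover have "homeomorphic_map T S \<psi>" using \<psi> by (simp add: homeomorphic_maps_map)
  moreover have "\<alpha> (\<psi> y) = \<psi> (\<beta> y)" if y: "y \<in> carrier H" for y
  proof -
    obtain x where x: "x \<in> carrier G" "y = \<phi> x" using y im(1) by blast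
    then have "\<alpha> x \<in> carrier G" using \<alpha> by blast
    then show ?thesis using x \<phi>(3) \<psi>\<phi> by simp
  qed
  ultimately have "contraction_group_isomorphism H T \<beta> G S \<alpha> \<psi>"
    by (simp add: contraction_group_isomorphism_def)
  with \<psi> show ?thesis by (intro exI conjI)
qed

text \<open>Little is assumed about the source, so that the quotients of the polynomial ring inherit
  all topological properties from the models: each operation is the one of \<open>H\<close>
  conjugated by \<phi>.\<close>

lemma simple_lc_contraction_group_transport:
  assumes G: "group G" and top: "topspace S = carrier G" and \<alpha>: "\<alpha> ` carrier G \<subseteq> carrier G"
    and iso: "contraction_group_isomorphism G S \<alpha> H T \<beta> \<phi>"
    and H: "simple_lc_contraction_group H T \<beta>"
  shows "simple_lc_contraction_group G S \<alpha>"
proof -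
  interpret H: simple_lc_contraction_group H T \<beta> by fact
  interpret G: group G by fact
  have \<phi>: "\<phi> \<in> iso G H" "homeomorphic_map S T \<phi>" "\<And>x. x \<in> carrier G \<Longrightarrow> \<beta> (\<phi> x) = \<phi> (\<alpha> x)"
    using iso by (auto simp: contraction_group_isomorphism_def)
  obtain \<psi> where \<psi>iso: "contraction_group_isomorphism H T \<beta> G S \<alpha> \<psi>" and \<psi>: "homeomorphic_maps S T \<phi> \<psi>"
    using contraction_group_isomorphism_sym[OF G top \<alpha> iso] by (elim exE conjE)
  have im: "\<phi> ` carrier G = carrier H" and inj: "inj_on \<phi> (carrier G)" using \<phi>(1) by (auto simp: iso_def bij_betw_def)
  have \<phi>c: "\<phi> x \<in> carrier H" if "x \<in> carrier G" for x using im that by blast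
  have \<phi>m: "\<phi> (x \<otimes>\<^bsub>G\<^esub> y) = \<phi> x \<otimes>\<^bsub>H\<^esub> \<phi> y" if "x \<in> carrier G" "y \<in> carrier G" for x y
    using \<phi>(1) that by (auto simp: iso_def hom_def)
  interpret gh: group_hom G H \<phi>
    using \<phi>(1) by unfold_locales (auto simp: iso_def)
  have \<psi>\<phi>: "\<psi> (\<phi> x) = x" if "x \<in> carrier G" for x using \<psi> that top by (simp add: homeomorphic_maps_def)
  have \<psi>mult: "\<psi> (\<phi> x \<otimes>\<^bsub>H\<^esub> \<phi> y) = x \<otimes>\<^bsub>G\<^esub> y" if "x \<in> carrier G" "y \<in> carrier G" for x y
    using \<psi>\<phi>[of "x \<otimes>\<^bsub>G\<^esub> y"] that by simp
  have \<psi>inv: "\<psi> (inv\<^bsub>H\<^esub> \<phi> x) = inv\<^bsub>G\<^esub> x" if "x \<in> carrier G" for x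
    using \<psi>\<phi>[of "inv\<^bsub>G\<^esub> x"] that by simp
  have c\<phi>: "continuous_map S T \<phi>" and c\<psi>: "continuous_map T S \<psi>" using \<psi> by (auto simp: homeomorphic_maps_def)
  have sp: "S homeomorphic_space T" using \<psi> homeomorphic_space_def by blast
  have \<alpha>c: "\<alpha> x \<in> carrier G" if "x \<in> carrier G" for x using \<alpha> that by blast
  have \<alpha>n: "(\<alpha> ^^ n) x \<in> carrier G" "\<phi> ((\<alpha> ^^ n) x) = (\<beta> ^^ n) (\<phi> x)" if "x \<in> carrier G" for n x
    by (induction n) (use that \<alpha>c \<phi>(3)[symmetric] in auto)
  have \<alpha>eq: "\<psi> (\<beta> (\<phi> x)) = \<alpha> x" if "x \<in> carrier G" for x using \<phi>(3)[OF that] \<psi>\<phi>[OF \<alpha>c[OF that]] by simp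
  have \<psi>h: "\<psi> \<in> iso H G" "homeomorphic_map T S \<psi>" using \<psi>iso by (auto simp: contraction_group_isomorphism_def)
  show ?thesis
  proof unfold_locales
    show "topspace S = carrier G" by fact
    let ?P = "prod_topology S S"
    show "continuous_map ?P S (\<lambda>(x, y). x \<otimes>\<^bsub>G\<^esub> y)"
    proof (rule continuous_map_eq)
      have "continuous_map ?P T (\<lambda>p. \<phi> (fst p) \<otimes>\<^bsub>H\<^esub> \<phi> (snd p))"
        using continuous_map_compose[OF continuous_map_fst c\<phi>] continuous_map_compose[OF continuous_map_snd c\<phi>]
        by (intro H.continuous_mult) (simp_all add: comp_def)
      then show "continuous_map ?P S (\<psi> \<circ> (\<lambda>p. \<phi> (fst p) \<otimes>\<^bsub>H\<^esub> \<phi> (snd p)))"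
        by (rule continuous_map_compose[OF _ c\<psi>])
      fix p assume "p \<in> topspace ?P"
      then have "fst p \<in> carrier G" "snd p \<in> carrier G" by (auto simp: top)
      then show "(\<psi> \<circ> (\<lambda>p. \<phi> (fst p) \<otimes>\<^bsub>H\<^esub> \<phi> (snd p))) p = (case p of (x, y) \<Rightarrow> x \<otimes>\<^bsub>G\<^esub> y)"
        by (simp add: case_prod_beta \<psi>mult)
    qed
    show "continuous_map S S (\<lambda>x. inv\<^bsub>G\<^esub> x)"
    proof (rule continuous_map_eq)
      show "continuous_map S S (\<psi> \<circ> (\<lambda>x. inv\<^bsub>H\<^esub> \<phi> x))"
        by (rule continuous_map_compose[OF H.continuous_inv[OF c\<phi>] c\<psi>])
    qed (simp add: top \<psi>inv)
    show "Hausdorff_space S" using H.Hausdorff homeomorphic_Hausdorff_space[OF sp] by blast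
    show "locally_compact_space S" using H.locally_compact homeomorphic_locally_compact_space[OF sp] by blast
    show "\<alpha> \<in> iso G G"
    proof (rule G.iso_cong)
      show "\<psi> \<circ> (\<beta> \<circ> \<phi>) \<in> iso G G"
        by (rule iso_set_trans[OF iso_set_trans[OF \<phi>(1) H.automorphism] \<psi>h(1)])
    qed (simp add: \<alpha>eq)
    show "homeomorphic_map S S \<alpha>"
    proof (rule homeomorphic_map_eq)
      show "homeomorphic_map S S (\<psi> \<circ> (\<beta> \<circ> \<phi>))"
        by (rule homeomorphic_map_compose[OF homeomorphic_map_compose[OF \<phi>(2) H.bicontinuous] \<psi>h(2)])
    qed (simp add: \<alpha>eq top)
    show "limitin S (\<lambda>n. (\<alpha> ^^ n) x) \<one>\<^bsub>G\<^esub> sequentially" if "x \<in> carrier G" for x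
    proof -
      have "limitin S (\<psi> \<circ> (\<lambda>n. (\<beta> ^^ n) (\<phi> x))) (\<psi> \<one>\<^bsub>H\<^esub>) sequentially"
        by (rule continuous_map_limit[OF c\<psi> H.contractive[OF \<phi>c[OF that]]])
      moreover have "\<psi> \<circ> (\<lambda>n. (\<beta> ^^ n) (\<phi> x)) = (\<lambda>n. (\<alpha> ^^ n) x)"
        using \<alpha>n[OF that] \<psi>\<phi> by (simp add: fun_eq_iff flip: \<alpha>n(2)[OF that])
      moreover have "\<psi> \<one>\<^bsub>H\<^esub> = \<one>\<^bsub>G\<^esub>" using \<psi>\<phi>[OF G.one_closed] by simp
      ultimately show ?thesis by simp
    qed
    show "carrier G \<noteq> {\<one>\<^bsub>G\<^esub>}" using H.nontrivial im by auto
    show "N = {\<one>\<^bsub>G\<^esub>} \<or> N = carrier G" if N: "N \<lhd> G" "closedin S N" "\<alpha> ` N = N" for N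
    proof -
      interpret N: normal N G by fact
      have NG: "N \<subseteq> carrier G" by (rule N.subset)
      have "subgroup (\<phi> ` N) H" by (rule gh.subgroup_img_is_subgroup[OF N.is_subgroup])
      then have "\<phi> ` N \<lhd> H"
      proof (rule H.normal_invI)
        fix y h assume "y \<in> carrier H" "h \<in> \<phi> ` N"
        then obtain x k where xk: "x \<in> carrier G" "y = \<phi> x" "k \<in> N" "h = \<phi> k" using im by blast
        then have eq: "y \<otimes>\<^bsub>H\<^esub> h \<otimes>\<^bsub>H\<^esub> inv\<^bsub>H\<^esub> y = \<phi> (x \<otimes>\<^bsub>G\<^esub> k \<otimes>\<^bsub>G\<^esub> inv\<^bsub>G\<^esub> x)" using NG by auto
        then show "y \<otimes>\<^bsub>H\<^esub> h \<otimes>\<^bsub>H\<^esub> inv\<^bsub>H\<^esub> y \<in> \<phi> ` N"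
          unfolding eq by (intro imageI N.inv_op_closed2 xk)
      qed
      moreover have "closedin T (\<phi> ` N)"
        using homeomorphic_map_closedness[OF \<phi>(2), of N] N(2) NG top by simp
      moreover have "\<beta> ` \<phi> ` N = \<phi> ` N"
      proof -
        have "\<beta> ` \<phi> ` N = \<phi> ` \<alpha> ` N" using \<phi>(3) NG by (force simp: image_image)
        then show ?thesis using N(3) by simp
      qed
      ultimately have "\<phi> ` N = {\<one>\<^bsub>H\<^esub>} \<or> \<phi> ` N = carrier H" by (rule H.simple)
      moreover have "N = {\<one>\<^bsub>G\<^esub>}" if "\<phi> ` N = {\<one>\<^bsub>H\<^esub>}"
      proof -
        have "x = \<one>\<^bsub>G\<^esub>" if "x \<in> N" for x
          using \<open>\<phi> ` N = {\<one>\<^bsub>H\<^esub>}\<close> that inj_onD[OF inj, of x "\<one>\<^bsub>G\<^esub>"] NG by auto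
        then show ?thesis using N.one_closed by blast
      qed
      moreover have "N = carrier G" if "\<phi> ` N = carrier H"
        using that im inj NG by (metis inj_on_image_eq_iff order_refl)
      ultimately show ?thesis by blast
    qed
  qed
qed

section \<open>Quotients of the polynomial ring\<close>

definition real_eval :: "complex \<Rightarrow> real poly \<Rightarrow> complex"
  where "real_eval z p = poly (map_poly of_real p) z"

lemma real_eval_pCons [simp]: "real_eval z (pCons a p) = of_real a + z * real_eval z p"
  by (simp add: real_eval_def map_poly_pCons)

lemma real_eval_0 [simp]: "real_eval z 0 = 0"
  by (simp add: real_eval_def)

lemma real_eval_1 [simp]: "real_eval z 1 = 1"
  by (simp add: one_pCons)

lemma real_eval_add [simp]: "real_eval z (p + q) = real_eval z p + real_eval z q"
  by (induction p q rule: poly_induct2) (simp_all add: algebra_simps)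

lemma real_eval_smult [simp]: "real_eval z (smult c p) = of_real c * real_eval z p"
  by (induction p) (simp_all add: algebra_simps)

lemma real_eval_mult [simp]: "real_eval z (p * q) = real_eval z p * real_eval z q"
  by (induction p) (simp_all add: algebra_simps)

lemma real_eval_sum:
  assumes "\<And>i. i \<ge> d \<Longrightarrow> coeff p i = 0"
  shows "real_eval z p = (\<Sum>i<d. of_real (coeff p i) * z ^ i)"
proof -
  define q where "q = map_poly complex_of_real p"
  have q: "coeff q i = of_real (coeff p i)" for i by (simp add: q_def coeff_map_poly)
  have "real_eval z p = (\<Sum>i\<le>degree q. coeff q i * z ^ i)"
    by (simp add: real_eval_def q_def poly_altdef)
  also have "\<dots> = (\<Sum>i\<in>{..degree q} \<union> {..<d}. coeff q i * z ^ i)"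
    by (intro sum.mono_neutral_left) (auto simp: coeff_eq_0)
  also have "\<dots> = (\<Sum>i<d. coeff q i * z ^ i)"
    by (intro sum.mono_neutral_right) (auto simp: q assms)
  finally show ?thesis by (simp add: q)
qed

text \<open>An irreducible \<open>f\<close> that does not divide \<open>g\<close> is coprime to it,
  and a Bezout identity evaluated at the common zero would give 0 = 1.\<close>

lemma real_eval_dvd_iff:
  assumes "irreducible f" "real_eval z f = 0"
  shows "real_eval z g = 0 \<longleftrightarrow> f dvd g"
proof
  assume g: "real_eval z g = 0"
  show "f dvd g"
  proof (rule ccontr)
    assume "\<not> f dvd g"
    then have "coprime f g"
      by (rule prime_elem_imp_coprime[OF field_poly_irreducible_imp_prime[OF assms(1)]])
    then have "fst (bezout_coefficients f g) * f + snd (bezout_coefficients f g) * g = 1"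
      by (simp add: bezout_coefficients_fst_snd)
    then have "real_eval z (fst (bezout_coefficients f g) * f + snd (bezout_coefficients f g) * g) = 1"
      by simp
    then show False using g assms(2) by simp
  qed
qed (use assms in \<open>auto simp: dvd_def\<close>)

lemma Omega_root:
  assumes "f \<in> \<Omega>\<^sub>\<infinity>"
  obtains z where "real_eval z f = 0" "z \<noteq> 0" "norm z < 1"
proof -
  have f: "lead_coeff f = 1" "irreducible f" "f \<noteq> [:0, 1:]"
    and small: "\<And>z. real_eval z f = 0 \<Longrightarrow> norm z < 1"
    using assms by (auto simp: Omega_infinity_def real_eval_def)
  have "f \<noteq> 0" using f(2) by auto
  have "degree f \<noteq> 0" using f(2) \<open>f \<noteq> 0\<close> by (auto simp: irreducible_def is_unit_iff_degree)
  then have "\<not> constant (poly (map_poly complex_of_real f))"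
    by (simp add: constant_degree degree_map_poly)
  then obtain z where z: "real_eval z f = 0"
    using fundamental_theorem_of_algebra unfolding real_eval_def by blast
  \<comment> \<open>A zero at 0 would make X a divisor of \<open>f\<close>, and the only monic
    irreducible multiple of X is X itself.\<close>
  have "z \<noteq> 0"
  proof
    assume "z = 0"
    then have "poly f 0 = 0" using z by (cases f) (simp_all add: real_eval_def map_poly_pCons)
    then have "[:0, 1:] dvd f" by (simp add: poly_eq_0_iff_dvd)
    then obtain g where g: "f = [:0, 1:] * g" by (auto simp: dvd_def)
    have "\<not> is_unit ([:0, 1:] :: real poly)" by (simp add: is_unit_iff_degree)
    then have "is_unit g" using irreducibleD[OF f(2) g] by blast
    then obtain c where "g = [:c:]" by (auto simp: is_unit_poly_iff)
    with g f(1) have "f = [:0, 1:]" by (cases "c = 0") simp_all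
    with f(3) show False by simp
  qed
  with z small show ?thesis using that by blast
qed

lemma Omega_exists:
  assumes z: "z \<noteq> 0" "norm z < 1"
  obtains f where "f \<in> \<Omega>\<^sub>\<infinity>" "real_eval z f = 0"
proof (cases "z \<in> \<real>")
  case True
  then obtain a where a: "z = of_real a" by (auto elim: Reals_cases)
  have "[:- a, 1:] \<in> \<Omega>\<^sub>\<infinity>"
    using z a irreducible_linear_field_poly[of 1 "- a"]
    by (auto simp: Omega_infinity_def map_poly_pCons add_eq_0_iff)
  then show ?thesis using that a by simp
next
  case False
  define f where "f = [:(norm z)\<^sup>2, - 2 * Re z, 1:]"
  have eval: "real_eval w f = (w - z) * (w - cnj z)" for w
  proof -
    have "(w - z) * (w - cnj z) = z * cnj z - (z + cnj z) * w + w * w" by (simp add: algebra_simps)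
    also have "z * cnj z = of_real ((norm z)\<^sup>2)" by (rule complex_norm_square[symmetric])
    also have "z + cnj z = of_real (2 * Re z)" by (simp add: complex_add_cnj)
    finally show ?thesis by (simp add: f_def algebra_simps)
  qed
  have deg: "degree f = 2" by (simp add: f_def)
  have f0: "f \<noteq> 0" using deg by auto
  \<comment> \<open>A proper factor would have degree 1 and hence a real zero, whereas the only
    zeros are \<open>z\<close> and its conjugate, neither of them real.\<close>
  have "irreducible f"
  proof (rule irreducibleI)
    show "f \<noteq> 0" "\<not> is_unit f" using deg f0 by (simp_all add: is_unit_iff_degree)
    fix a b assume ab: "f = a * b"
    then have ne: "a \<noteq> 0" "b \<noteq> 0" using ab f0 by auto
    show "is_unit a \<or> is_unit b"
    proof (rule ccontr)
      assume "\<not> ?thesis"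
      then have "degree a \<noteq> 0" "degree b \<noteq> 0" using ne by (auto simp: is_unit_iff_degree)
      moreover have "degree a + degree b = 2" using deg ab ne by (simp add: degree_mult_eq)
      ultimately have "degree a = 1" by simp
      then obtain u v where uv: "a = [:u, v:]" "v \<noteq> 0" by (metis degree1_coeffs)
      define t where "t = - u / v"
      have "real_eval (of_real t) f = 0" using uv by (simp add: ab t_def)
      then have "of_real t = z \<or> of_real t = cnj z" unfolding eval by simp
      then have "z = of_real t" by (metis complex_cnj_cnj complex_cnj_complex_of_real)
      then show False using False by simp
    qed
  qed
  moreover have "norm w < 1" if "real_eval w f = 0" for w
    using that z(2) unfolding eval by auto
  moreover have "real_eval z f = 0" unfolding eval by simp
  moreover have "f \<noteq> [:0, 1:]" using deg by auto
  moreover have "lead_coeff f = 1" by (simp add: f_def)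
  ultimately have "f \<in> \<Omega>\<^sub>\<infinity>" by (auto simp: Omega_infinity_def real_eval_def)
  then show ?thesis using \<open>real_eval z f = 0\<close> by (rule that)
qed

lemma real_eval_spiral: "real_eval z p \<in> spiral_carrier z"
proof (induction p)
  case (pCons a p)
  then show ?case using spiral_carrier_add spiral_carrier_real spiral_carrier_mult by simp
qed (simp add: spiral_carrier_zero)

lemma group_E_group: "group (E_group f)"
proof -
  interpret ideal "PIdl\<^bsub>real_poly_ring\<^esub> f" real_poly_ring by (rule ideal_PIdl_real_poly)
  have "ring (E_ring f)" unfolding E_ring_def by (rule quotient_is_ring)
  then show ?thesis unfolding E_group_def by (intro abelian_group.a_group ring.is_abelian_group)
qed

lemma topspace_E_topology: "topspace (E_topology f) = carrier (E_group f)"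
  by (auto simp: E_topology_def topspace_pullback_topology E_coords_def)

text \<open>Evaluation at \<open>z\<close> written in coordinates, which makes its continuity
  visible; \<open>E_eval_class\<close> identifies it with the map induced by
  \<open>real_eval z\<close>.\<close>

definition E_eval :: "real poly \<Rightarrow> complex \<Rightarrow> real poly set \<Rightarrow> complex"
  where "E_eval f z C = (\<Sum>i<degree f. of_real (E_coords f C i) * z ^ i)"

text \<open>A right inverse of \<^term>\<open>real_eval z\<close> on \<^term>\<open>spiral_carrier z\<close> by polynomials of
  degree at most \<open>1\<close>.\<close>

definition spiral_lift :: "complex \<Rightarrow> complex \<Rightarrow> real poly"
  where "spiral_lift z w =
    (if z \<in> \<real> then [:Re w:] else [:Re w - Im w / Im z * Re z, Im w / Im z:])"

lemma real_eval_lift: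
  assumes "w \<in> spiral_carrier z" shows "real_eval z (spiral_lift z w) = w"
proof (cases "z \<in> \<real>")
  case True
  then show ?thesis using assms by (auto simp: spiral_lift_def spiral_carrier_def elim!: Reals_cases)
next
  case False
  then have "Im z \<noteq> 0" by (simp add: complex_is_Real_iff)
  then show ?thesis using False by (simp add: spiral_lift_def complex_eq_iff)
qed

context
  fixes f :: "real poly" and z :: complex
  assumes irred: "irreducible f" and root: "real_eval z f = 0"
begin

lemma irreducible_nonzero: "f \<noteq> 0" using irred by auto

lemma E_eval_class: "E_eval f z (E_class f g) = real_eval z g"
proof -
  have "degree f \<noteq> 0" using irred irreducible_nonzero by (auto simp: irreducible_def is_unit_iff_degree)
  then have "coeff (g mod f) i = 0" if "i \<ge> degree f" for i
    using degree_mod_less[OF irreducible_nonzero, of g] that by (auto intro: coeff_eq_0)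
  then have "real_eval z (g mod f) = E_eval f z (E_class f g)"
    by (simp add: real_eval_sum[of "degree f"] E_eval_def E_coords_class)
  moreover have "real_eval z g = real_eval z (g div f * f + g mod f)" by simp
  then have "real_eval z g = real_eval z (g mod f)"
    using root by (simp only: real_eval_add real_eval_mult mult_zero_right add_0_left)
  ultimately show ?thesis by simp
qed

lemma E_class_eq_iff: "E_class f g = E_class f h \<longleftrightarrow> real_eval z g = real_eval z h"
proof -
  have "E_class f g = E_class f h \<longleftrightarrow> g mod f = h mod f" by (auto simp: E_class_eq)
  also have "\<dots> \<longleftrightarrow> f dvd (g - h)" by (rule mod_eq_dvd_iff)
  also have "\<dots> \<longleftrightarrow> real_eval z (g - h) = 0" using real_eval_dvd_iff[OF irred root] by simp
  also have "real_eval z (g - h) = real_eval z g - real_eval z h"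
    using real_eval_add[of z "g - h" h] by (simp del: real_eval_add)
  finally show ?thesis by simp
qed

lemma E_eval_isomorphism:
  "contraction_group_isomorphism (E_group f) (E_topology f) (E_map f)
    (spiral_group z) (spiral_topology z) ((*) z) (E_eval f z)"
  unfolding contraction_group_isomorphism_def
proof (intro conjI ballI)
  have inj: "inj_on (E_eval f z) (carrier (E_group f))"
  proof (rule inj_onI)
    fix C D assume "C \<in> carrier (E_group f)" "D \<in> carrier (E_group f)" and eq: "E_eval f z C = E_eval f z D"
    then obtain g h where "C = E_class f g" "D = E_class f h" by (auto simp: carrier_E_group)
    with eq show "C = D" by (simp add: E_eval_class E_class_eq_iff)
  qed
  have im: "E_eval f z ` carrier (E_group f) = spiral_carrier z"
  proof
    show "E_eval f z ` carrier (E_group f) \<subseteq> spiral_carrier z"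
      by (auto simp: carrier_E_group E_eval_class real_eval_spiral)
    show "spiral_carrier z \<subseteq> E_eval f z ` carrier (E_group f)"
    proof
      fix w assume "w \<in> spiral_carrier z"
      then have "w = E_eval f z (E_class f (spiral_lift z w))" by (simp add: E_eval_class real_eval_lift)
      then show "w \<in> E_eval f z ` carrier (E_group f)" by (auto simp: carrier_E_group)
    qed
  qed
  show "E_eval f z \<in> iso (E_group f) (spiral_group z)"
    using inj im by (auto simp: iso_def hom_def bij_betw_def spiral_group_def carrier_E_group
        E_group_mult_class E_eval_class real_eval_spiral)
  show "z * E_eval f z C = E_eval f z (E_map f C)" if "C \<in> carrier (E_group f)" for C
    using that by (auto simp: carrier_E_group E_map_class E_eval_class)
  have coords: "continuous_map (E_topology f) (powertop_real {..<degree f}) (E_coords f)"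
    using homeomorphic_map_E_coords[OF irreducible_nonzero] homeomorphic_imp_continuous_map by blast
  have "continuous_map (E_topology f) euclidean (E_eval f z)"
    unfolding E_eval_def
  proof (intro continuous_map_sum)
    fix i assume "i \<in> {..<degree f}"
    then have "continuous_map (E_topology f) euclideanreal (\<lambda>C. E_coords f C i)"
      using continuous_map_compose[OF coords continuous_map_product_projection[of i]] by (simp add: comp_def)
    moreover have "continuous_map euclideanreal euclidean (\<lambda>t. complex_of_real t * z ^ i)"
      by (auto intro!: continuous_intros)
    ultimately have "continuous_map (E_topology f) euclidean
        ((\<lambda>t. complex_of_real t * z ^ i) \<circ> (\<lambda>C. E_coords f C i))"
      by (rule continuous_map_compose)
    then show "continuous_map (E_topology f) euclidean (\<lambda>C. complex_of_real (E_coords f C i) * z ^ i)"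
      by (simp add: comp_def)
  qed simp
  then have cont: "continuous_map (E_topology f) (spiral_topology z) (E_eval f z)"
    using im by (auto simp: spiral_topology_def continuous_map_in_subtopology topspace_E_topology)
  define \<sigma> where "\<sigma> = (\<lambda>w. E_class f (spiral_lift z w))"
  have coeff_lift: "continuous_on UNIV (\<lambda>w. coeff (spiral_lift z w mod f) i)" for i
  proof -
    \<comment> \<open>Reduction modulo \<open>f\<close> is linear, so the coordinates are fixed
      linear combinations of the two coefficients of the lift; the degree of \<open>f\<close> need
      not be known.\<close>
    have "spiral_lift z w mod f = smult (coeff (spiral_lift z w) 0) (1 mod f) + smult (coeff (spiral_lift z w) 1) ([:0, 1:] mod f)" for w
    proof -
      have "spiral_lift z w = smult (coeff (spiral_lift z w) 0) 1 + smult (coeff (spiral_lift z w) 1) [:0, 1:]"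
        by (simp add: spiral_lift_def)
      then show ?thesis by (metis mod_smult_left poly_mod_add_left)
    qed
    then have eq: "(\<lambda>w. coeff (spiral_lift z w mod f) i) =
        (\<lambda>w. coeff (spiral_lift z w) 0 * coeff (1 mod f) i + coeff (spiral_lift z w) 1 * coeff ([:0, 1:] mod f) i)"
      by (simp only: coeff_add coeff_smult)
    show ?thesis
      unfolding eq
      by (cases "z \<in> \<real>") (auto simp: spiral_lift_def divide_inverse intro!: continuous_intros)
  qed
  have "continuous_map (spiral_topology z) (E_topology f) \<sigma>"
    unfolding E_topology_def
  proof (rule continuous_map_pullback')
    show "topspace (spiral_topology z) \<subseteq> \<sigma> -` carrier (E_group f)" by (auto simp: \<sigma>_def carrier_E_group)
    show "continuous_map (spiral_topology z) (powertop_real {..<degree f}) (E_coords f \<circ> \<sigma>)"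
      unfolding continuous_map_componentwise
    proof (intro conjI ballI)
      fix i assume "i \<in> {..<degree f}"
      then show "continuous_map (spiral_topology z) euclideanreal (\<lambda>x. (E_coords f \<circ> \<sigma>) x i)"
        using continuous_on_subset[OF coeff_lift[of i] subset_UNIV]
        by (simp add: \<sigma>_def E_coords_class spiral_topology_def)
    qed (auto simp: E_coords_def)
  qed
  moreover have "\<sigma> (E_eval f z C) = C" if "C \<in> carrier (E_group f)" for C
  proof -
    obtain g where "C = E_class f g" using \<open>C \<in> carrier (E_group f)\<close> by (auto simp: carrier_E_group)
    then show ?thesis
      by (simp add: \<sigma>_def E_eval_class E_class_eq_iff real_eval_lift real_eval_spiral)
  qed
  moreover have "E_eval f z (\<sigma> w) = w" if "w \<in> spiral_carrier z" for w
    using that by (simp add: \<sigma>_def E_eval_class real_eval_lift)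
  ultimately have "homeomorphic_maps (E_topology f) (spiral_topology z) (E_eval f z) \<sigma>"
    using cont by (simp add: homeomorphic_maps_def topspace_E_topology) (simp add: spiral_topology_def)
  then show "homeomorphic_map (E_topology f) (spiral_topology z) (E_eval f z)"
    using homeomorphic_map_maps by blast
qed

end

lemma E_map_closed: "E_map f ` carrier (E_group f) \<subseteq> carrier (E_group f)"
  by (auto simp: carrier_E_group E_map_class)

text \<open>Additivity forces the formula at rational arguments; both sides are continuous and the
  rationals are dense.\<close>

lemma continuous_additive_real_linear:
  fixes h :: "real \<Rightarrow> complex"
  assumes cont: "continuous_on UNIV h" and add: "\<And>x y. h (x + y) = h x + h y"
  shows "h t = of_real t * h 1"
proof -
  have h0: "h 0 = 0" using add[of 0 0] by simp
  have neg: "h (- x) = - h x" for x using add[of x "- x"] h0 by (simp add: eq_neg_iff_add_eq_0 add.commute)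
  have nat: "h (of_nat n * x) = of_nat n * h x" for n x
    by (induction n) (simp_all add: h0 add algebra_simps)
  have int: "h (of_int k * x) = of_int k * h x" for k x
    by (cases k rule: int_cases2) (simp_all add: nat neg)
  have rat: "h (of_int a / of_int b) = of_real (of_int a / of_int b) * h 1" if "b > 0" for a b
  proof -
    have "of_int b * h (of_int a / of_int b) = of_int a * h 1"
      using int[of b "of_int a / of_int b"] int[of a 1] that by simp
    then show ?thesis using that by (simp add: field_simps)
  qed
  have "closed {t. h t = of_real t * h 1}"
    by (intro closed_Collect_eq cont continuous_intros)
  moreover have "\<rat> \<subseteq> {t. h t = of_real t * h 1}"
    using rat by (auto elim!: Rats_cases')
  ultimately have "closure \<rat> \<subseteq> {t. h t = of_real t * h 1}" by (intro closure_minimal)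
  then show ?thesis by (auto simp: Rats_closure_real)
qed

text \<open>The isomorphism is real-linear by continuity and intertwines \<open>z\<close> with
  \<open>w\<close>, hence intertwines p(z) with p(w) for every real polynomial p. For p = f, applied
  at 1, this gives f(w) h(1) = 0, and h(1) is nonzero by injectivity.\<close>

lemma spiral_isomorphism_root:
  assumes iso: "contraction_group_isomorphism (spiral_group z) (spiral_topology z) ((*) z)
      (spiral_group w) (spiral_topology w) ((*) w) h"
    and root: "real_eval z f = 0"
  shows "real_eval w f = 0"
proof -
  have hom: "h (x + y) = h x + h y" if "x \<in> spiral_carrier z" "y \<in> spiral_carrier z" for x y
    using iso that by (auto simp: contraction_group_isomorphism_def iso_def hom_def spiral_group_def)
  have inj: "inj_on h (spiral_carrier z)"
    using iso by (auto simp: contraction_group_isomorphism_def iso_def bij_betw_def spiral_group_def)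
  have mult: "h (z * x) = w * h x" if "x \<in> spiral_carrier z" for x
    using iso that by (simp add: contraction_group_isomorphism_def spiral_group_def)
  have "continuous_map (spiral_topology z) (spiral_topology w) h"
    using iso homeomorphic_imp_continuous_map by (auto simp: contraction_group_isomorphism_def)
  then have cont: "continuous_on (spiral_carrier z) h"
    by (simp add: spiral_topology_def continuous_map_in_subtopology)
  have scale: "h (of_real t * x) = of_real t * h x" if x: "x \<in> spiral_carrier z" for t x
  proof -
    have "continuous_on UNIV (\<lambda>t. h (of_real t * x))"
      by (intro continuous_on_compose2[OF cont] continuous_intros) (use x spiral_carrier_scale in auto)
    moreover have "h (of_real (s + t) * x) = h (of_real s * x) + h (of_real t * x)" for s t
      by (simp add: distrib_right hom spiral_carrier_scale x)
    ultimately have "h (of_real t * x) = of_real t * h (of_real 1 * x)"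
      by (rule continuous_additive_real_linear)
    then show ?thesis by simp
  qed
  have eval_closed: "real_eval z p * x \<in> spiral_carrier z" if "x \<in> spiral_carrier z" for p x
    by (induction p) (simp_all add: distrib_right mult.assoc spiral_carrier_zero spiral_carrier_add
        spiral_carrier_scale spiral_carrier_mult that)
  have eval: "h (real_eval z p * x) = real_eval w p * h x" if x: "x \<in> spiral_carrier z" for p x
  proof (induction p)
    case 0
    then show ?case using hom[of 0 0] spiral_carrier_zero by simp
  next
    case (pCons a p)
    have "h (of_real a * x + z * (real_eval z p * x)) = of_real a * h x + w * (real_eval w p * h x)"
      by (simp add: hom scale mult spiral_carrier_scale spiral_carrier_mult eval_closed x pCons)
    then show ?case by (simp add: distrib_right mult.assoc)
  qed
  have one: "1 \<in> spiral_carrier z" using spiral_carrier_real[of 1 z] by simp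
  have h0: "h 0 = 0" using hom[of 0 0] spiral_carrier_zero by simp
  have "h 1 \<noteq> 0" using inj_onD[OF inj, of 1 0] one spiral_carrier_zero h0 by auto
  moreover have "real_eval w f * h 1 = 0" using eval[OF one, of f] root h0 by simp
  ultimately show ?thesis by simp
qed

text \<open>A common zero makes two irreducible polynomials divide each other, so they differ by a
  constant, which is 1 as both are monic.\<close>

lemma Omega_unique:
  assumes f: "f \<in> \<Omega>\<^sub>\<infinity>" and g: "g \<in> \<Omega>\<^sub>\<infinity>" and "real_eval w f = 0" "real_eval w g = 0"
  shows "f = g"
proof -
  have irr: "irreducible f" "irreducible g" and lc: "lead_coeff f = 1" "lead_coeff g = 1"
    using f g by (auto simp: Omega_infinity_def)
  have dvd: "f dvd g" "g dvd f"
    using real_eval_dvd_iff[OF irr(1) assms(3), of g] real_eval_dvd_iff[OF irr(2) assms(4), of f] assms by auto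
  obtain k where k: "g = f * k" using dvd(1) by (elim dvdE)
  have ne: "f \<noteq> 0" "g \<noteq> 0" using irr by auto
  then have "k \<noteq> 0" using k by auto
  then have "degree g = degree f + degree k" using k ne by (simp add: degree_mult_eq)
  moreover have "degree g \<le> degree f" using dvd(2) ne by (intro dvd_imp_degree_le)
  ultimately obtain c where "k = [:c:]" by (metis degree_eq_zeroE add_cancel_right_right le_antisym le_add1)
  with k lc show ?thesis by (cases "c = 0") simp_all
qed

theorem theoremF:
  shows "(\<forall>(G :: 'a monoid) T \<alpha>. simple_lc_contraction_group G T \<alpha> \<longrightarrow>
            connected_space T \<or> totally_disconnected_space T) \<and>
         (\<forall>f\<in>\<Omega>\<^sub>\<infinity>. simple_lc_contraction_group (E_group f) (E_topology f) (E_map f) \<and>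
            connected_space (E_topology f)) \<and>
         (\<forall>(G :: 'a monoid) T \<alpha>. simple_lc_contraction_group G T \<alpha> \<and> connected_space T \<longrightarrow>
            (\<exists>!f. f \<in> \<Omega>\<^sub>\<infinity> \<and>
               contraction_group_isomorphic G T \<alpha> (E_group f) (E_topology f) (E_map f)))"
proof (intro conjI allI impI ballI)
  fix G :: "'a monoid" and T \<alpha>
  assume "simple_lc_contraction_group G T \<alpha>"
  then show "connected_space T \<or> totally_disconnected_space T"
    by (rule simple_lc_contraction_group.connected_or_totally_disconnected)
next
  fix f assume f: "f \<in> \<Omega>\<^sub>\<infinity>"
  then have irr: "irreducible f" by (simp add: Omega_infinity_def)
  obtain z where z: "real_eval z f = 0" "z \<noteq> 0" "norm z < 1" using Omega_root[OF f] .
  note iso = E_eval_isomorphism[OF irr z(1)]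
  show "simple_lc_contraction_group (E_group f) (E_topology f) (E_map f)"
    by (rule simple_lc_contraction_group_transport[OF group_E_group topspace_E_topology E_map_closed iso
          spiral_contraction_group(1)[OF z(2,3)]])
  have "E_topology f homeomorphic_space spiral_topology z"
    using iso homeomorphic_map_imp_homeomorphic_space by (auto simp: contraction_group_isomorphism_def)
  then show "connected_space (E_topology f)"
    using spiral_contraction_group(2)[OF z(2,3)] homeomorphic_connected_space by blast
next
  fix G :: "'a monoid" and T \<alpha>
  assume "simple_lc_contraction_group G T \<alpha> \<and> connected_space T"
  then interpret simple_lc_contraction_group G T \<alpha> by simp
  have conn: "connected_space T" using \<open>simple_lc_contraction_group G T \<alpha> \<and> connected_space T\<close> by simp
  have \<alpha>: "\<alpha> ` carrier G \<subseteq> carrier G" using automorphism by (auto simp: iso_def hom_def)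
  obtain h z where z: "z \<noteq> 0" "norm z < 1"
    and h: "contraction_group_isomorphism G T \<alpha> (spiral_group z) (spiral_topology z) ((*) z) h"
    using connected_iso_spiral[OF conn] by (elim exE conjE)
  obtain f where f: "f \<in> \<Omega>\<^sub>\<infinity>" "real_eval z f = 0" using Omega_exists[OF z] .
  show "\<exists>!f. f \<in> \<Omega>\<^sub>\<infinity> \<and> contraction_group_isomorphic G T \<alpha> (E_group f) (E_topology f) (E_map f)"
  proof (rule ex1I)
    have irr: "irreducible f" using f(1) by (simp add: Omega_infinity_def)
    obtain \<psi> where "contraction_group_isomorphism (spiral_group z) (spiral_topology z) ((*) z)
        (E_group f) (E_topology f) (E_map f) \<psi>"
      using contraction_group_isomorphism_sym[OF group_E_group topspace_E_topology E_map_closed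
          E_eval_isomorphism[OF irr f(2)]] by (elim exE conjE)
    then have "contraction_group_isomorphism G T \<alpha> (E_group f) (E_topology f) (E_map f) (\<psi> \<circ> h)"
      by (rule contraction_group_isomorphism_trans[OF h])
    then show "f \<in> \<Omega>\<^sub>\<infinity> \<and> contraction_group_isomorphic G T \<alpha> (E_group f) (E_topology f) (E_map f)"
      using f(1) by (auto simp: contraction_group_isomorphic_def)
  next
    fix g assume "g \<in> \<Omega>\<^sub>\<infinity> \<and> contraction_group_isomorphic G T \<alpha> (E_group g) (E_topology g) (E_map g)"
    then obtain k where g: "g \<in> \<Omega>\<^sub>\<infinity>"
      and k: "contraction_group_isomorphism G T \<alpha> (E_group g) (E_topology g) (E_map g) k"
      by (auto simp: contraction_group_isomorphic_def)
    have irr: "irreducible g" using g by (simp add: Omega_infinity_def)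
    obtain w where w: "real_eval w g = 0" "w \<noteq> 0" "norm w < 1" using Omega_root[OF g] .
    obtain \<psi> where \<psi>: "contraction_group_isomorphism (spiral_group z) (spiral_topology z) ((*) z) G T \<alpha> \<psi>"
      using contraction_group_isomorphism_sym[OF is_group topspace_eq_carrier \<alpha> h] by (elim exE conjE)
    \<comment> \<open>Going from the model of \<open>z\<close> back to \<open>G\<close>, then to the
      quotient by \<open>g\<close> and on to the model of \<open>w\<close> gives an isomorphism of
      models, along which the zero \<open>z\<close> of \<open>f\<close> passes to
      \<open>w\<close>.\<close>
    have "real_eval w f = 0"
      by (rule spiral_isomorphism_root[OF contraction_group_isomorphism_trans[OF \<psi>
            contraction_group_isomorphism_trans[OF k E_eval_isomorphism[OF irr w(1)]]] f(2)])
    then show "g = f" using Omega_unique[OF g f(1)] w(1) by simp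
  qed
qed

end
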